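(* The Lindelöf Hypothesis is true if and only if, for every $k\in\mathbb{N}$, the functions $\phi_{N,k}(x)=e^{-x}\sum_{n=0}^{N}\frac{(-1)^n\ell_{n,k}}{n!}x^n$ converge to $\phi_k$ in $L^2(\mathbb{R}_+)$ as $N\to\infty$.
   Context: $J_0$ is the Bessel function of the first kind of order $0$. $d_k(n)$ is the number of ordered factorizations of $n$ into $k$ factors; $\lambda_{j,k}$ are defined by $(s-1)^k\zeta^k(s)=\sum_{j\ge0}\frac{\lambda_{j,k}}{j!}(s-1)^j$ for $|s-1|\le1$; $a_{j,k}=(-1)^{k-1-j}\sum_{i=0}^{k-1-j}(-1)^i\frac{\lambda_{i,k}}{i!}$, $P_k(X)=\sum_{j=0}^{k-1}\frac{a_{j,k}}{j!}X^j$, $\Delta_k(x)=\sum_{1\le n\le x}d_k(n)-xP_k(\log x)$; $\ell_{n,k}=(-1)^n\sum_{j=1}^n\binom{n-1}{j-1}\frac{\lambda_{j+k,k}}{(j+k)!}$ for $n\ge1$, $\ell_{0,k}=(-1)^k\sum_{j=0}^{k}(-1)^j\frac{\lambda_{j,k}}{j!}$. $\phi_k(x)=\int_1^\infty\Delta_k(r)J_0(2\sqrt{x\log r})\,r^{-2}dr$ for $x\ge0$. The Lindelöf Hypothesis is the statement $\zeta(\frac12+it)=O(|t|^\varepsilon)$ for every $\varepsilon>0$. *)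

theory Defs
  imports "HOL-Complex_Analysis.Complex_Analysis" "HOL-Library.Landau_Symbols"
begin

text \<open>Riemann zeta function: the (unique) holomorphic function on the plane minus 1
  given by the Dirichlet series for Re s > 1 (analytic continuation).\<close>
definition zeta :: "complex \<Rightarrow> complex" where
  "zeta = (SOME f. f holomorphic_on (- {1}) \<and>
      (\<forall>s. 1 < Re s \<longrightarrow> (\<lambda>n. 1 / (of_nat (Suc n)) powr s) sums f s))"

definition lindelof_hypothesis :: bool where
  "lindelof_hypothesis \<longleftrightarrow>
     (\<forall>\<epsilon>>0. (\<lambda>t::real. norm (zeta (Complex (1/2) t))) \<in> O[at_infinity](\<lambda>t. \<bar>t\<bar> powr \<epsilon>))"

definition bessel_J0 :: "real \<Rightarrow> real" where
  "bessel_J0 x = (\<Sum>m. (-1) ^ m * (x / 2) ^ (2 * m) / (fact m) ^ 2)"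

definition dk :: "nat \<Rightarrow> nat \<Rightarrow> nat" where
  "dk k n = card {xs :: nat list. length xs = k \<and> prod_list xs = n}"

text \<open>The entire function (s-1)^k zeta(s)^k (removable singularity at 1 filled in).\<close>
definition zeta_pow_reg :: "nat \<Rightarrow> complex \<Rightarrow> complex" where
  "zeta_pow_reg k s = (if s = 1 then 1 else (s - 1) ^ k * zeta s ^ k)"

definition lam :: "nat \<Rightarrow> nat \<Rightarrow> complex" where
  "lam j k = (deriv ^^ j) (zeta_pow_reg k) 1"

definition a_coef :: "nat \<Rightarrow> nat \<Rightarrow> complex" where
  "a_coef j k = (-1) ^ (k - 1 - j) * (\<Sum>i=0..k - 1 - j. (-1) ^ i * lam i k / fact i)"

definition P_poly :: "nat \<Rightarrow> real \<Rightarrow> complex" where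
  "P_poly k X = (\<Sum>j=0..k - 1. a_coef j k / fact j * of_real X ^ j)"

definition Delta :: "nat \<Rightarrow> real \<Rightarrow> complex" where
  "Delta k x = of_nat (\<Sum>n=1..nat \<lfloor>x\<rfloor>. dk k n) - of_real x * P_poly k (ln x)"

definition ell :: "nat \<Rightarrow> nat \<Rightarrow> complex" where
  "ell n k = (if n = 0 then (-1) ^ k * (\<Sum>j=0..k. (-1) ^ j * lam j k / fact j)
              else (-1) ^ n * (\<Sum>j=1..n. of_nat ((n - 1) choose (j - 1)) * lam (j + k) k / fact (j + k)))"

definition phi :: "nat \<Rightarrow> real \<Rightarrow> complex" where
  "phi k x = (LBINT r:{1..}. Delta k r * of_real (bessel_J0 (2 * sqrt (x * ln r))) / of_real (r ^ 2))"

definition phi_N :: "nat \<Rightarrow> nat \<Rightarrow> real \<Rightarrow> complex" where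
  "phi_N N k x = of_real (exp (- x)) * (\<Sum>n=0..N. (-1) ^ n * ell n k / fact n * of_real x ^ n)"

end

theory Submission
  imports Defs "HOL-Probability.Distributions"
begin

text \<open>
  Write \<open>c\<^sub>n = (-1)\<^sup>n \<ell>\<^sub>n\<^sub>,\<^sub>k\<close>. Let \<open>F\<close> be \<open>\<zeta>(s)\<^sup>k / s\<close> minus its principal part at \<open>s = 1\<close>; it is the
  Mellin transform of \<open>\<Delta>\<^sub>k\<close>. Under \<open>s = 1 / (1 - z)\<close> the half-plane \<open>Re s > 1/2\<close> becomes the unit disc
  and \<open>s F(s) = \<Sum>\<^sub>n c\<^sub>n z\<^sup>n\<close>.

  If the \<open>\<phi>\<^sub>N\<^sub>,\<^sub>k\<close> converge in \<open>L\<^sup>2\<close>, then \<open>\<phi>\<^sub>N\<^sub>,\<^sub>k - \<phi>\<^sub>N\<^sub>-\<^sub>1\<^sub>,\<^sub>k \<rightarrow> 0\<close> already gives \<open>c\<^sub>n = O(n)\<close>, so on every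
  line \<open>Re s = 1/2 + \<delta>\<close> the function \<open>\<zeta>(s)\<^sup>k\<close> grows at most like \<open>\<bar>t\<bar>\<^sup>4\<close>, with an exponent that does not depend
  on \<open>k\<close>. Taking \<open>k\<close> large and moving to the critical line by convexity yields the Lindeloef Hypothesis.

  Conversely, an elementary bound \<open>\<Delta>\<^sub>k(r) = O(r powr (1 - \<delta>))\<close> makes all moments \<open>\<integral> \<Delta>\<^sub>k(r) (ln r)\<^sup>m r\<^sup>-\<^sup>2 dr\<close> converge; they
  are the Taylor coefficients of \<open>F\<close> at \<open>1\<close>, whence \<open>\<phi>\<^sub>k(x) = \<Sum>\<^sub>n c\<^sub>n e\<^sub>n(x)\<close> pointwise with the Poisson weights
  \<open>e\<^sub>n(x) = exp (-x) x\<^sup>n / n!\<close>. The Lindeloef Hypothesis puts \<open>s F(s)\<close> into the Hardy space \<open>H\<^sup>2\<close> of the disc, so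
  \<open>\<Sum> \<bar>c\<^sub>n\<bar>\<^sup>2 < \<infinity>\<close>. As \<open>\<Sum>\<^sub>n e\<^sub>n(x) = 1\<close> and \<open>\<integral> e\<^sub>n = 1\<close>, the Cauchy-Schwarz inequality bounds the squared
  \<open>L\<^sup>2\<close> distance from \<open>\<phi>\<^sub>N\<^sub>,\<^sub>k\<close> to \<open>\<phi>\<^sub>k\<close> by the tail \<open>\<Sum>\<^sub>n\<^sub>>\<^sub>N \<bar>c\<^sub>n\<bar>\<^sup>2\<close>.
\<close>

section \<open>Analytic continuation of the zeta function\<close>

text \<open>The \<open>c_n\<close> are Laguerre coefficients: \<open>c_n\<close> is the integral of
  \<open>Delta_k(r) L_n(ln r) / r^2\<close> over \<open>r >= 1\<close>, where \<open>L_n\<close> is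
  the \<open>n\<close>-th Laguerre polynomial, and the generating function
  \<open>sum L_n(u) x^n / n! = e^x J_0(2 sqrt(x u))\<close> is what ties the Bessel kernel to the
  Poisson weights. The function \<open>phi\<close> is a Bochner integral, which is 0 by convention
  when the integrand is not integrable. Expanding it therefore demands genuine absolute convergence,
  and this is what forces the power saving for \<open>Delta_k\<close>. The elementary convolution
  argument yields the main term only as some polynomial in \<open>ln x\<close>; it is identified
  with \<open>P_poly\<close> afterwards, by comparing Laurent coefficients at \<open>s = 1\<close>
  along real \<open>s > 1\<close>. In the implication from mean square convergence,
  \<open>phi\<close> enters merely as a measurable function to which the partial sums are close.
  Since \<open>zeta\<close> is given by a choice operator, its continuation has to be constructed.
  The Euler-Maclaurin formula does this and at the same time supplies the linear growth in
  \<open>Re s > 0\<close> from which the convexity arguments start.\<close>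

definition powr_mean :: "(real \<Rightarrow> real) \<Rightarrow> nat \<Rightarrow> complex \<Rightarrow> complex" where
  "powr_mean p n s = integral {0..1} (\<lambda>x. of_real (p x) * of_real (real (Suc n) + x) powr (-s))"

lemma of_real_powr_conv_exp:
  "0 < (y::real) \<Longrightarrow> of_real y powr (s::complex) = exp (s * of_real (ln y))"
  by (simp add: powr_def Ln_of_real)

lemma powr_mean_exp:
  "powr_mean p n s = integral {0..1} (\<lambda>x. of_real (p x) * exp (-s * of_real (ln (real (Suc n) + x))))"
  unfolding powr_mean_def by (intro integral_cong, subst of_real_powr_conv_exp) (auto simp: add_pos_nonneg)

lemma powr_mean_holomorphic:
  assumes "continuous_on {0..1} p"
  shows "powr_mean p n holomorphic_on UNIV"
proof -
  have "(\<lambda>s. integral (cbox 0 1) (\<lambda>x. of_real (p x) * exp (-s * of_real (ln (real (Suc n) + x))) :: complex)) holomorphic_on UNIV"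
  proof (rule leibniz_rule_holomorphic[where fx = "\<lambda>s x. of_real (p x) * (exp (-s * of_real (ln (real (Suc n) + x))) * (- of_real (ln (real (Suc n) + x))))"])
    show "continuous_on (UNIV \<times> cbox 0 1) (\<lambda>(s, x). complex_of_real (p x) * (exp (-s * of_real (ln (real (Suc n) + x))) * (- of_real (ln (real (Suc n) + x)))))"
      unfolding case_prod_beta
      by (intro continuous_intros continuous_on_compose2[OF assms]) (auto simp: add_pos_nonneg)
  qed (auto intro!: derivative_eq_intros integrable_continuous_real continuous_intros assms simp: add_pos_nonneg)
  thus ?thesis by (simp add: powr_mean_exp[abs_def])
qed

lemma powr_mean_norm_le:
  assumes p: "continuous_on {0..1} p" and B: "\<And>x. x \<in> {0..1} \<Longrightarrow> \<bar>p x\<bar> \<le> B" and s: "0 \<le> Re s"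
  shows "norm (powr_mean p n s) \<le> B * real (Suc n) powr (- Re s)"
proof -
  have "norm (powr_mean p n s) \<le> integral {0..1} (\<lambda>x::real. B * real (Suc n) powr (- Re s))"
    unfolding powr_mean_exp
  proof (rule integral_norm_bound_integral)
    show "(\<lambda>x. complex_of_real (p x) * exp (-s * of_real (ln (real (Suc n) + x)))) integrable_on {0..1}"
      by (intro integrable_continuous_real continuous_intros assms) (auto simp: add_pos_nonneg)
    fix x :: real assume x: "x \<in> {0..1}"
    have "(real (Suc n) + x) powr (- Re s) \<le> real (Suc n) powr (- Re s)"
      using x s by (intro powr_mono2') auto
    moreover have "norm (exp (-s * of_real (ln (real (Suc n) + x)))) = (real (Suc n) + x) powr (- Re s)"
      using x by (simp add: powr_def)
    ultimately show "norm (complex_of_real (p x) * exp (-s * of_real (ln (real (Suc n) + x)))) \<le> B * real (Suc n) powr (- Re s)"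
      unfolding norm_mult norm_of_real using B[OF x] by (intro mult_mono) auto
  qed auto
  thus ?thesis by simp
qed

lemma summable_Suc_powr: "1 < a \<Longrightarrow> summable (\<lambda>n. real (Suc n) powr (- a))"
  by (subst summable_Suc_iff) (simp add: summable_real_powr_iff)

lemma powr_mean_sum_holomorphic:
  assumes p: "continuous_on {0..1} p"
  shows "(\<lambda>s. \<Sum>n. powr_mean p n s) holomorphic_on {s. 1 < Re s}"
    and "1 < Re s \<Longrightarrow> summable (\<lambda>n. powr_mean p n s)"
proof -
  have "compact (p ` {0..1})" using p by (intro compact_continuous_image) auto
  then obtain B where B: "\<And>x. x \<in> {0..1} \<Longrightarrow> \<bar>p x\<bar> \<le> B"
    by (metis bounded_iff compact_imp_bounded imageI real_norm_def)
  have B0: "0 \<le> B" using B[of 0] by auto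
  have bd: "norm (powr_mean p n z) \<le> B * real (Suc n) powr (- a)" if "1 < a" "a \<le> Re z" for n z a
    using that by (intro order_trans[OF powr_mean_norm_le[OF p B]] mult_left_mono powr_mono B0) auto
  show "summable (\<lambda>n. powr_mean p n s)" if "1 < Re s"
    using that by (intro summable_norm_cancel[OF summable_comparison_test'[OF summable_mult[OF summable_Suc_powr], of "Re s" 0 _ B]])
      (use that bd[of "Re s" s] in auto)
  show "(\<lambda>s. \<Sum>n. powr_mean p n s) holomorphic_on {s. 1 < Re s}"
  proof (rule holomorphic_uniform_sequence[where f = "\<lambda>N s. \<Sum>n<N. powr_mean p n s"])
    show "open {s. 1 < Re s}" by (simp add: open_halfspace_Re_gt)
    show "(\<lambda>s. \<Sum>n<N. powr_mean p n s) holomorphic_on {s. 1 < Re s}" for N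
      by (intro holomorphic_intros holomorphic_on_subset[OF powr_mean_holomorphic] p) auto
    fix z assume z: "z \<in> {s. 1 < Re s}"
    \<comment> \<open>Half the distance to the line \<open>Re s = 1\<close>, so that the closed disc
      stays in \<open>Re s \<ge> 1 + d\<close>, where one summable majorant serves all
      points.\<close>
    define d where "d = (Re z - 1) / 2"
    have d: "0 < d" using z by (simp add: d_def)
    have Re: "1 + d \<le> Re y" if "y \<in> cball z d" for y
    proof -
      have "\<bar>Re (z - y)\<bar> \<le> norm (z - y)" by (rule abs_Re_le_cmod)
      thus ?thesis using that by (auto simp: dist_norm d_def field_simps)
    qed
    have "uniform_limit (cball z d) (\<lambda>N s. \<Sum>n<N. powr_mean p n s) (\<lambda>s. \<Sum>n. powr_mean p n s) sequentially"
    proof (rule Weierstrass_m_test)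
      show "summable (\<lambda>n. B * real (Suc n) powr (-(1 + d)))"
        using d by (intro summable_mult summable_Suc_powr) auto
      show "norm (powr_mean p n y) \<le> B * real (Suc n) powr (-(1 + d))" if "y \<in> cball z d" for n y
        using d Re[OF that] by (intro bd) auto
    qed
    moreover have "cball z d \<subseteq> {s. 1 < Re s}" using Re d by force
    ultimately show "\<exists>d>0. cball z d \<subseteq> {s. 1 < Re s} \<and>
        uniform_limit (cball z d) (\<lambda>N s. \<Sum>n<N. powr_mean p n s) (\<lambda>s. \<Sum>n. powr_mean p n s) sequentially"
      using d by blast
  qed
qed

text \<open>The freedom in the choice of \<open>q\<close> is exploited three times: the
  antiderivative of mean zero drives the continuation, \<open>saw\<close> as antiderivative of 1
  gives the trapezoidal rule, and the constant 1 as antiderivative of 0 evaluates the integral of a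
  power.\<close>

lemma powr_mean_by_parts:
  assumes p: "continuous_on {0..1} p"
    and q: "\<And>x. x \<in> {0..1} \<Longrightarrow> (q has_real_derivative p x) (at x within {0..1})"
  shows "powr_mean p n s = of_real (q 1) * of_nat (Suc (Suc n)) powr (-s)
           - of_real (q 0) * of_nat (Suc n) powr (-s) + s * powr_mean q n (s + 1)"
proof -
  have qc: "continuous_on {0..1} q"
    using q by (intro DERIV_continuous_on)
  define e where "e = (\<lambda>z x. exp (-z * of_real (ln (real (Suc n) + x))) :: complex)"
  have pm: "powr_mean f n z = integral {0..1} (\<lambda>x. of_real (f x) * e z x)" for f z
    by (simp only: powr_mean_exp e_def)
  have es: "e (s + 1) x = e s x / of_real (real (Suc n) + x)" if "x \<in> {0..1}" for x
    using that by (simp add: e_def ring_distribs exp_add exp_minus exp_of_real add_pos_nonneg field_simps exp_diff)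
  have "((\<lambda>x. of_real (p x) * e s x - s * (of_real (q x) * e (s + 1) x)) has_integral
      of_real (q 1) * e s 1 - of_real (q 0) * e s 0) {0..1}"
  proof (rule fundamental_theorem_of_calculus)
    fix x :: real assume x: "x \<in> {0..1}"
    have es': "e (1 + s) x = e s x / of_real (real (Suc n) + x)" using es[OF x] by (simp add: add.commute)
    have "((\<lambda>x. - s * complex_of_real (ln (real (Suc n) + x))) has_vector_derivative (- s * of_real (1 / (real (Suc n) + x)))) (at x within {0..1})"
      using x by (intro has_vector_derivative_mult_right has_vector_derivative_of_real)
        (auto intro!: derivative_eq_intros simp: has_real_derivative_iff_has_vector_derivative[symmetric] add_pos_nonneg)
    hence "(e s has_vector_derivative (- s * of_real (1 / (real (Suc n) + x))) * e s x) (at x within {0..1})"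
      unfolding e_def
      by (rule field_vector_diff_chain_within[where g = exp, unfolded o_def]) (auto intro!: derivative_eq_intros)
    hence "((\<lambda>x. complex_of_real (q x) * e s x) has_vector_derivative
        of_real (q x) * ((- s * of_real (1 / (real (Suc n) + x))) * e s x) + of_real (p x) * e s x) (at x within {0..1})"
      using q[OF x] by (intro has_vector_derivative_mult has_vector_derivative_of_real) (auto simp: has_real_derivative_iff_has_vector_derivative)
    thus "((\<lambda>x. complex_of_real (q x) * e s x) has_vector_derivative
        of_real (p x) * e s x - s * (of_real (q x) * e (s + 1) x)) (at x within {0..1})"
      using x by (simp add: es' algebra_simps)
  qed auto
  moreover have int: "(\<lambda>x. complex_of_real (p x) * e s x) integrable_on {0..1}" "(\<lambda>x. s * (complex_of_real (q x) * e (s + 1) x)) integrable_on {0..1}"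
    unfolding e_def by (intro integrable_continuous_real continuous_intros p qc; auto simp: add_pos_nonneg)+
  ultimately have "powr_mean p n s - s * powr_mean q n (s + 1) = of_real (q 1) * e s 1 - of_real (q 0) * e s 0"
    unfolding pm integral_mult_right[symmetric]
    by (subst integral_diff[symmetric]) (simp_all add: integral_unique)
  moreover have "e s 1 = of_nat (Suc (Suc n)) powr (-s)" "e s 0 = of_nat (Suc n) powr (-s)"
    using of_real_powr_conv_exp[of "real (Suc (Suc n))" "-s"] of_real_powr_conv_exp[of "real (Suc n)" "-s"]
    by (simp_all add: e_def add.commute)
  ultimately show ?thesis by (simp add: algebra_simps)
qed

lemma Suc_powr_tendsto_0:
  assumes "0 < Re s" shows "(\<lambda>n. of_nat (Suc n) powr (-s) :: complex) \<longlonglongrightarrow> 0"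
proof -
  have "(\<lambda>n. real (Suc n) powr (- Re s)) \<longlonglongrightarrow> 0"
    using assms by (intro tendsto_neg_powr filterlim_compose[OF filterlim_real_sequentially filterlim_Suc]) auto
  moreover have "norm (of_nat (Suc n) powr (-s) :: complex) = real (Suc n) powr (- Re s)" for n
    by (subst norm_powr_real_powr) (simp_all only: Reals_of_nat complex_Re_of_nat of_nat_0_le_iff uminus_complex.sel)
  ultimately show ?thesis by (subst tendsto_norm_zero_iff[symmetric]) (simp del: of_nat_Suc)
qed

text \<open>Integrating by parts against the antiderivative \<open>q\<close> of \<open>p\<close> that again has mean zero replaces
  \<open>p\<close> at \<open>s\<close> by \<open>q\<close> at \<open>s + 1\<close>, since the boundary terms telescope.\<close>

lemma powr_mean_sum_extends:
  assumes "continuous_on {0..1} p" "integral {0..1} p = 0"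
  shows "\<exists>f. f holomorphic_on {s. 1 - real m < Re s} \<and> (\<forall>s. 1 < Re s \<longrightarrow> (\<lambda>n. powr_mean p n s) sums f s)"
  using assms
proof (induction m arbitrary: p)
  case 0
  show ?case using powr_mean_sum_holomorphic[OF 0(1)]
    by (intro exI[of _ "\<lambda>s. \<Sum>n. powr_mean p n s"]) (auto intro: summable_sums)
next
  case (Suc m)
  define c where "c = - integral {0..1} (\<lambda>x. integral {0..x} p)"
  define q where "q = (\<lambda>x. integral {0..x} p + c)"
  have q: "(q has_real_derivative p x) (at x within {0..1})" if "x \<in> {0..1}" for x
    unfolding q_def using integral_has_real_derivative[OF Suc.prems(1) that]
    by (auto intro!: derivative_eq_intros)
  have qc: "continuous_on {0..1} q" using q by (intro DERIV_continuous_on)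
  have q01: "q 0 = c" "q 1 = c" using Suc.prems(2) by (auto simp: q_def)
  have "continuous_on {0..1} (\<lambda>x. integral {0..x} p)"
    by (intro indefinite_integral_continuous_1 integrable_continuous_real Suc.prems)
  hence "integral {0..1} q = 0"
    unfolding q_def by (subst integral_add) (auto simp: c_def intro!: integrable_continuous_real)
  from Suc.IH[OF qc this] obtain f where f: "f holomorphic_on {s. 1 - real m < Re s}"
    "\<And>s. 1 < Re s \<Longrightarrow> (\<lambda>n. powr_mean q n s) sums f s" by blast
  \<comment> \<open>Evaluating \<open>f\<close> at \<open>s + 1\<close> gains one unit to the left;
    the constant \<open>- of_real c\<close> is the sum of the telescoping boundary terms.\<close>
  have "(\<lambda>s. - of_real c + s * f (s + 1)) holomorphic_on {s. 1 - real (Suc m) < Re s}"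
    by (intro holomorphic_intros holomorphic_on_compose_gen[OF _ f(1), unfolded o_def]) auto
  moreover have "(\<lambda>n. powr_mean p n s) sums (- of_real c + s * f (s + 1))" if s: "1 < Re s" for s
  proof -
    have "(\<lambda>n. of_nat (Suc (Suc n)) powr (-s) - of_nat (Suc n) powr (-s) :: complex) sums (0 - of_nat (Suc 0) powr (-s))"
      using s by (intro telescope_sums Suc_powr_tendsto_0) auto
    hence "(\<lambda>n. of_real c * (of_nat (Suc (Suc n)) powr (-s) - of_nat (Suc n) powr (-s)) + s * powr_mean q n (s + 1))
        sums (of_real c * (0 - of_nat (Suc 0) powr (-s)) + s * f (s + 1))"
      using s by (intro sums_add sums_mult f(2)) auto
    moreover have "powr_mean p n s = of_real c * (of_nat (Suc (Suc n)) powr (-s) - of_nat (Suc n) powr (-s)) + s * powr_mean q n (s + 1)" for n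
      by (subst powr_mean_by_parts[OF Suc.prems(1) q]) (auto simp: q01 algebra_simps)
    ultimately show ?thesis by simp
  qed
  ultimately show ?case by blast
qed

text \<open>The first Bernoulli polynomial: \<open>powr_mean saw n (s + 1)\<close> is, up to the
  factor \<open>s\<close>, the first Euler-Maclaurin remainder on the interval from
  \<open>n + 1\<close> to \<open>n + 2\<close>.\<close>

definition saw :: "real \<Rightarrow> real" where "saw x = x - 1/2"

lemma saw_simps: "continuous_on {0..1} saw" "integral {0..1} saw = 0" "x \<in> {0..1} \<Longrightarrow> \<bar>saw x\<bar> \<le> 1/2"
proof -
  show "continuous_on {0..1} saw" by (auto simp: saw_def[abs_def] intro!: continuous_intros)
  have "(saw has_integral ((1^2 - 1)/2 - (0^2 - 0)/2)) {0..1}"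
    by (rule fundamental_theorem_of_calculus)
      (auto simp: saw_def has_real_derivative_iff_has_vector_derivative[symmetric] field_simps intro!: derivative_eq_intros)
  thus "integral {0..1} saw = 0" by (simp add: integral_unique)
qed (auto simp: saw_def abs_if)

text \<open>The integral of \<open>y^(-s)\<close> over \<open>[n+1, n+2]\<close> is computed twice:
  as a trapezoid plus remainder, and exactly. Equating the two expresses \<open>(n+1)^(-s)\<close>
  by telescoping differences and the remainder; their sums are \<open>1 / (s - 1)\<close>,
  \<open>1 / 2\<close> and \<open>- s * A\<close>.\<close>

lemma Dirichlet_series_conv_powr_mean:
  assumes s: "1 < Re s" and A: "(\<lambda>n. powr_mean saw n (s + 1)) sums A"
  shows "(\<lambda>n. 1 / of_nat (Suc n) powr s) sums (1 / (s - 1) + 1 / 2 - s * A)"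
proof -
  let ?a = "\<lambda>n. of_nat (Suc n) powr (-s) :: complex"
  let ?b = "\<lambda>n. of_nat (Suc n) powr (-(s-1)) :: complex"
  have s1: "s \<noteq> 1" "1 - s \<noteq> 0" using s by auto
  have 1: "powr_mean (\<lambda>_. 1) n s = 1/2 * ?a (Suc n) + 1/2 * ?a n + s * powr_mean saw n (s + 1)" for n
  proof -
    have "(saw has_real_derivative 1) (at x within {0..1})" for x
      by (auto simp: saw_def[abs_def] intro!: derivative_eq_intros)
    from powr_mean_by_parts[OF _ this, of n s] show ?thesis by (simp add: saw_def)
  qed
  have 2: "powr_mean (\<lambda>_. 1) n s = (?b n - ?b (Suc n)) / (s - 1)" for n
  proof -
    \<comment> \<open>For \<open>p = 0\<close> and \<open>q = 1\<close> at the point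
      \<open>s - 1\<close>, the formula is the fundamental theorem of calculus for
      \<open>y^(1-s)\<close>.\<close>
    have "powr_mean (\<lambda>_. 0) n (s - 1) = ?b (Suc n) - ?b n + (s - 1) * powr_mean (\<lambda>_. 1) n (s - 1 + 1)"
      by (subst powr_mean_by_parts[where q = "\<lambda>_. 1"]) auto
    thus ?thesis using s1 by (simp add: powr_mean_def field_simps)
  qed
  have 3: "(\<lambda>n. (?b n - ?b (Suc n)) / (s - 1)) sums ((?b 0 - 0) / (s - 1))"
    using s by (intro sums_divide telescope_sums' Suc_powr_tendsto_0) auto
  have 4: "(\<lambda>n. 1/2 * (?a n - ?a (Suc n))) sums (1/2 * (?a 0 - 0))"
    using s by (intro sums_mult telescope_sums' Suc_powr_tendsto_0) auto
  have "?a n = (?b n - ?b (Suc n)) / (s - 1) + 1/2 * (?a n - ?a (Suc n)) - s * powr_mean saw n (s + 1)" for n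
    using 1[of n] 2[of n] by (simp add: field_simps)
  moreover have "(\<lambda>n. (?b n - ?b (Suc n)) / (s - 1) + 1/2 * (?a n - ?a (Suc n)) - s * powr_mean saw n (s + 1))
      sums ((?b 0 - 0) / (s - 1) + 1/2 * (?a 0 - 0) - s * A)"
    by (intro sums_add sums_diff sums_mult 3 4 A)
  ultimately have "?a sums ((?b 0 - 0) / (s - 1) + 1/2 * (?a 0 - 0) - s * A)"
    by simp
  thus ?thesis by (simp add: powr_minus field_simps)
qed


lemma half_plane_eqI:
  assumes "f holomorphic_on {s. a < Re s}" "g holomorphic_on {s. a < Re s}"
    and "\<And>s. b < Re s \<Longrightarrow> f s = g s" and "a < Re z"
  shows "f z = g z"
proof (rule analytic_continuation_open[where s = "{s. max a b < Re s}" and s' = "{s. a < Re s}" and f = f and g = g])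
  show "{s. max a b < Re s} \<noteq> {}"
    by (auto intro!: exI[of _ "of_real (max a b + 1)"])
  show "open {s. max a b < Re s}" by (rule open_halfspace_Re_gt)
qed (use assms in \<open>auto simp: open_halfspace_Re_gt convex_connected convex_halfspace_Re_gt\<close>)

lemma powr_mean_saw_entire:
  "\<exists>B. B holomorphic_on UNIV \<and> (\<forall>s. 1 < Re s \<longrightarrow> (\<lambda>n. powr_mean saw n s) sums B s)"
proof -
  have "\<forall>m. \<exists>f. f holomorphic_on {s. 1 - real m < Re s} \<and> (\<forall>s. 1 < Re s \<longrightarrow> (\<lambda>n. powr_mean saw n s) sums f s)"
    using powr_mean_sum_extends[OF saw_simps(1,2)] by blast
  then obtain A where A: "\<And>m. A m holomorphic_on {s. 1 - real m < Re s}"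
    "\<And>m s. 1 < Re s \<Longrightarrow> (\<lambda>n. powr_mean saw n s) sums A m s" by metis
  \<comment> \<open>The index is large enough for the half-plane of the chosen extension to contain
    \<open>s\<close>; uniqueness makes the choice among such extensions immaterial.\<close>
  define B where "B s = A (nat \<lceil>2 - Re s\<rceil>) s" for s
  have le: "A m s = A n s" if "m \<le> n" "1 - real m < Re s" for m n s
  proof (rule half_plane_eqI[where f = "A m" and g = "A n" and a = "1 - real m" and b = 1])
    show "A n holomorphic_on {s. 1 - real m < Re s}"
      by (rule holomorphic_on_subset[OF A(1)]) (use that in auto)
    show "A m s = A n s" if "1 < Re s" for s
      using A(2)[OF that] sums_unique2 by blast
  qed (use A that in auto)
  have BA: "B s = A M s" if "1 - real M < Re s" for M s
  proof -
    have "1 - real (nat \<lceil>2 - Re s\<rceil>) < Re s" by linarith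
    thus ?thesis using le[of M "nat \<lceil>2 - Re s\<rceil>" s] le[of "nat \<lceil>2 - Re s\<rceil>" M s] that
      unfolding B_def by (metis nat_le_linear)
  qed
  have "B holomorphic_on (\<Union>M. {s. 1 - real M < Re s})"
  proof (rule holomorphic_on_UN_open)
    show "B holomorphic_on {s. 1 - real M < Re s}" for M
      using A(1)[of M] by (rule holomorphic_transform) (auto simp: BA)
  qed (simp add: open_halfspace_Re_gt)
  also have "(\<Union>M. {s. 1 - real M < Re s}) = UNIV"
  proof safe
    fix s :: complex
    obtain M where "1 - Re s < real M" using reals_Archimedean2 by blast
    thus "s \<in> (\<Union>M. {s. 1 - real M < Re s})" by (auto intro!: exI[of _ M])
  qed auto
  finally have "B holomorphic_on UNIV" .
  moreover have "(\<lambda>n. powr_mean saw n s) sums B s" if "1 < Re s" for s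
    using that A(2)[of s 0] BA[of 0 s] by simp
  ultimately show ?thesis by blast
qed

text \<open>The definition of \<open>zeta\<close> by choice becomes usable only once a witness is
  exhibited.\<close>

lemma zeta_exists:
  "\<exists>f. f holomorphic_on (- {1}) \<and> (\<forall>s. 1 < Re s \<longrightarrow> (\<lambda>n. 1 / (of_nat (Suc n)) powr s) sums f s)"
proof -
  obtain B where B: "B holomorphic_on UNIV" "\<And>s. 1 < Re s \<Longrightarrow> (\<lambda>n. powr_mean saw n s) sums B s"
    using powr_mean_saw_entire by blast
  have "(\<lambda>s. 1 / (s - 1) + 1 / 2 - s * B (s + 1)) holomorphic_on (- {1})"
    by (intro holomorphic_intros holomorphic_on_compose_gen[OF _ B(1), unfolded o_def]) auto
  moreover have "(\<lambda>n. 1 / (of_nat (Suc n)) powr s) sums (1 / (s - 1) + 1 / 2 - s * B (s + 1))" if "1 < Re s" for s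
    using that by (intro Dirichlet_series_conv_powr_mean B) auto
  ultimately show ?thesis by blast
qed

section \<open>Representation and size of the zeta function\<close>

lemma zeta_holomorphic: "zeta holomorphic_on (- {1})"
  and zeta_sums: "1 < Re s \<Longrightarrow> (\<lambda>n. 1 / (of_nat (Suc n)) powr s) sums zeta s"
  using someI_ex[OF zeta_exists] unfolding zeta_def[symmetric] by auto

text \<open>The bound on \<open>B\<close> is recorded along with the formula: at
  \<open>s + 1\<close> it holds for \<open>Re s > 0\<close>, so that in this half-plane only the
  explicit factor \<open>s\<close> can make \<open>zeta\<close> grow away from the pole.\<close>

lemma zeta_representation:
  obtains B where "B holomorphic_on UNIV"
    "\<And>s. s \<noteq> 1 \<Longrightarrow> zeta s = 1 / (s - 1) + 1 / 2 - s * B (s + 1)"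
    "\<And>s. 1 < Re s \<Longrightarrow> norm (B s) \<le> (\<Sum>n. real (Suc n) powr (- Re s))"
proof -
  obtain B where B: "B holomorphic_on UNIV" "\<And>s. 1 < Re s \<Longrightarrow> (\<lambda>n. powr_mean saw n s) sums B s"
    using powr_mean_saw_entire by blast
  have "zeta s = 1 / (s - 1) + 1 / 2 - s * B (s + 1)" if "s \<noteq> 1" for s
  proof (rule analytic_continuation_open[where s = "{s. 1 < Re s}" and s' = "- {1}" and f = zeta and g = "\<lambda>s. 1 / (s - 1) + 1 / 2 - s * B (s + 1)"])
    show "{s. 1 < Re s} \<noteq> {}" by (auto intro!: exI[of _ 2])
    show "connected (- {1 :: complex})" by (simp add: connected_punctured_universe)
    show "(\<lambda>s. 1 / (s - 1) + 1 / 2 - s * B (s + 1)) holomorphic_on (- {1})"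
      by (intro holomorphic_intros holomorphic_on_compose_gen[OF _ B(1), unfolded o_def]) auto
    show "zeta s = 1 / (s - 1) + 1 / 2 - s * B (s + 1)" if "s \<in> {s. 1 < Re s}" for s
      using that by (intro sums_unique2[OF zeta_sums Dirichlet_series_conv_powr_mean] B) auto
  qed (use that zeta_holomorphic in \<open>auto simp: open_halfspace_Re_gt\<close>)
  moreover have "norm (B s) \<le> (\<Sum>n. real (Suc n) powr (- Re s))" if s: "1 < Re s" for s
  proof -
    have le: "norm (powr_mean saw n s) \<le> real (Suc n) powr (- Re s)" for n
      using powr_mean_norm_le[OF saw_simps(1), of 1 s n] saw_simps(3) s by force
    have sm: "summable (\<lambda>n. real (Suc n) powr (- Re s))" using s by (rule summable_Suc_powr)
    have "norm (\<Sum>n. powr_mean saw n s) \<le> (\<Sum>n. real (Suc n) powr (- Re s))"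
      using le by (intro norm_suminf_le sm)
    thus ?thesis using B(2)[OF s] by (simp add: sums_iff)
  qed
  ultimately show thesis using that B(1) by blast
qed

text \<open>Multiplied by \<open>s - 1\<close>, the representation has no pole left and takes the
  value 1 at \<open>s = 1\<close>, which is the value filled in by
  \<open>zeta_pow_reg\<close>.\<close>

lemma zeta_pow_reg_holomorphic: "zeta_pow_reg k holomorphic_on UNIV"
proof -
  obtain B where B: "B holomorphic_on UNIV"
    "\<And>s. s \<noteq> 1 \<Longrightarrow> zeta s = 1 / (s - 1) + 1 / 2 - s * B (s + 1)"
    by (rule zeta_representation) blast
  have "(\<lambda>s. (1 + (s - 1) / 2 - (s - 1) * s * B (s + 1)) ^ k) holomorphic_on UNIV"
    by (intro holomorphic_intros holomorphic_on_compose_gen[OF _ B(1), unfolded o_def]) auto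
  also have "(\<lambda>s. (1 + (s - 1) / 2 - (s - 1) * s * B (s + 1)) ^ k) = zeta_pow_reg k"
    by (auto simp: zeta_pow_reg_def fun_eq_iff B(2) power_mult_distrib[symmetric] field_simps)
  finally show ?thesis .
qed

text \<open>This crude growth provides the a priori bound inside the strips to which convexity is
  applied, and also the left edge in \<open>lindelof_if_right_of_line\<close>.\<close>

lemma norm_zeta_le_linear:
  assumes "0 < a"
  obtains C where "0 < C" "\<And>s. a \<le> Re s \<Longrightarrow> 1 \<le> \<bar>Im s\<bar> \<Longrightarrow> norm (zeta s) \<le> C * norm s"
proof -
  obtain B where B: "\<And>s. s \<noteq> 1 \<Longrightarrow> zeta s = 1 / (s - 1) + 1 / 2 - s * B (s + 1)"
     "\<And>s. 1 < Re s \<Longrightarrow> norm (B s) \<le> (\<Sum>n. real (Suc n) powr (- Re s))"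
    by (rule zeta_representation) blast
  define M where "M = (\<Sum>n. real (Suc n) powr (- (1 + a)))"
  have sm: "summable (\<lambda>n. real (Suc n) powr (- (1 + a)))" using assms by (intro summable_Suc_powr) auto
  have M0: "0 \<le> M" unfolding M_def by (intro suminf_nonneg sm) auto
  have "norm (zeta s) \<le> (2 + M) * norm s" if s: "a \<le> Re s" "1 \<le> \<bar>Im s\<bar>" for s
  proof -
    have n1: "1 \<le> norm s" using s(2) abs_Im_le_cmod[of s] by linarith
    have n2: "1 \<le> norm (s - 1)" using s(2) abs_Im_le_cmod[of "s - 1"] by simp
    have ne: "s \<noteq> 1" using s(2) by auto
    have "norm (B (s + 1)) \<le> (\<Sum>n. real (Suc n) powr (- Re (s + 1)))"
      using s assms by (intro B(2)) auto
    also have "\<dots> \<le> M" unfolding M_def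
      using s assms by (intro suminf_le sm summable_Suc_powr powr_mono) auto
    finally have b: "norm (B (s + 1)) \<le> M" .
    have "norm (zeta s) \<le> norm (1 / (s - 1)) + norm (1 / 2 :: complex) + norm (s * B (s + 1))"
      unfolding B(1)[OF ne] by (intro order_trans[OF norm_triangle_ineq4] add_mono norm_triangle_ineq order_refl)
    also have "\<dots> \<le> 1 + 1 / 2 + norm s * M"
      using n2 b by (intro add_mono) (auto simp: norm_divide norm_mult divide_simps intro!: mult_left_mono)
    also have "\<dots> \<le> (2 + M) * norm s" using n1 M0 by (simp add: algebra_simps)
    finally show ?thesis .
  qed
  thus thesis using M0 that[of "2 + M"] by auto
qed

lemma norm_zeta_le_const:
  obtains C where "0 < C" "\<And>s. 2 \<le> Re s \<Longrightarrow> norm (zeta s) \<le> C"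
proof -
  define M where "M = (\<Sum>n. real (Suc n) powr (- 2))"
  have sm: "summable (\<lambda>n. real (Suc n) powr (- 2))" by (intro summable_Suc_powr) auto
  have M0: "0 \<le> M" unfolding M_def by (intro suminf_nonneg sm) auto
  have "norm (zeta s) \<le> M" if s: "2 \<le> Re s" for s
  proof -
    have nm: "norm (1 / of_nat (Suc n) powr s) = real (Suc n) powr (- Re s)" for n
      unfolding norm_divide by (subst norm_powr_real_powr) (simp_all only: Reals_of_nat complex_Re_of_nat of_nat_0_le_iff norm_one powr_minus_divide)
    have "norm (\<Sum>n. 1 / of_nat (Suc n) powr s) \<le> M"
      unfolding M_def nm[symmetric]
      by (intro norm_suminf_le sm, subst nm) (use s in \<open>auto intro!: powr_mono\<close>)
    thus ?thesis using zeta_sums[of s] s by (simp add: sums_iff)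
  qed
  hence "norm (zeta s) \<le> M + 1" if "2 \<le> Re s" for s using that by (smt (verit))
  thus thesis using M0 that[of "M + 1"] by auto
qed

section \<open>Convexity in vertical strips\<close>

text \<open>Use \<open>ln x \<le> x\<close> and complete the square in
  \<open>M * x - x\<^sup>2 / 4\<close>.\<close>

lemma powr_times_exp_le:
  fixes x M :: real
  assumes "1 \<le> x" "0 \<le> M"
  shows "x powr M * exp (- (x\<^sup>2 / 4)) \<le> exp (M\<^sup>2)"
proof -
  have "M * ln x \<le> M * x"
    using assms ln_bound[of x] by (intro mult_left_mono) auto
  moreover have "0 \<le> (M - x / 2)\<^sup>2" by simp
  ultimately have "M * ln x - x\<^sup>2 / 4 \<le> M\<^sup>2" by (simp add: power2_eq_square algebra_simps)
  thus ?thesis using assms by (simp add: powr_def exp_add[symmetric])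
qed

text \<open>The factor \<open>exp ((s - w)\<^sup>2)\<close> makes the horizontal sides of a tall rectangle around \<open>w\<close>
  negligible, and the power of \<open>\<bar>t\<bar>\<close> balances the two vertical sides.\<close>

lemma strip_convexity:
  fixes f :: "complex \<Rightarrow> complex" and a b \<alpha> \<beta> \<gamma> K :: real
  assumes ab: "a < b" and nonneg: "0 \<le> \<alpha>" "0 \<le> \<beta>" "0 \<le> \<gamma>" "0 \<le> K"
    and hol: "f holomorphic_on U" "open U" "\<And>s. a \<le> Re s \<Longrightarrow> Re s \<le> b \<Longrightarrow> 1 \<le> \<bar>Im s\<bar> \<Longrightarrow> s \<in> U"
    and inner: "\<And>s. a \<le> Re s \<Longrightarrow> Re s \<le> b \<Longrightarrow> 1 \<le> \<bar>Im s\<bar> \<Longrightarrow> norm (f s) \<le> K * \<bar>Im s\<bar> powr \<gamma>"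
    and left: "\<And>t. 1 \<le> \<bar>t\<bar> \<Longrightarrow> norm (f (Complex a t)) \<le> K * \<bar>t\<bar> powr \<alpha>"
    and right: "\<And>t. 1 \<le> \<bar>t\<bar> \<Longrightarrow> norm (f (Complex b t)) \<le> K * \<bar>t\<bar> powr \<beta>"
  obtains K' where "0 \<le> K'" "\<And>\<sigma> t. a \<le> \<sigma> \<Longrightarrow> \<sigma> \<le> b \<Longrightarrow> 2 \<le> \<bar>t\<bar> \<Longrightarrow>
    norm (f (Complex \<sigma> t)) \<le> K' * \<bar>t\<bar> powr ((\<alpha> * (b - \<sigma>) + \<beta> * (\<sigma> - a)) / (b - a))"
proof -
  \<comment> \<open>The slope for which \<open>\<alpha> + \<kappa> * (a - \<sigma>)\<close> and
    \<open>\<beta> + \<kappa> * (b - \<sigma>)\<close> both equal the interpolated exponent at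
    \<open>\<sigma>\<close>.\<close>
  define \<kappa> where "\<kappa> = (\<alpha> - \<beta>) / (b - a)"
  define M where "M = \<gamma> + \<bar>\<kappa>\<bar> * (b - a)"
  define D where "D = exp ((b - a)\<^sup>2)"
  define K' where "K' = D * (K * (3/2) powr \<alpha> + K * (3/2) powr \<beta> + K * (3/2) powr \<gamma> * exp (M\<^sup>2))"
  have D0: "0 < D" by (simp add: D_def)
  have M0: "0 \<le> M" using nonneg ab by (simp add: M_def)
  have "norm (f (Complex \<sigma> t)) \<le> K' * \<bar>t\<bar> powr ((\<alpha> * (b - \<sigma>) + \<beta> * (\<sigma> - a)) / (b - a))"
    if \<sigma>: "a \<le> \<sigma>" "\<sigma> \<le> b" and t: "2 \<le> \<bar>t\<bar>" for \<sigma> t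
  proof -
    define e where "e = (\<alpha> * (b - \<sigma>) + \<beta> * (\<sigma> - a)) / (b - a)"
    define w where "w = Complex \<sigma> t"
    define g where "g s = f s * exp ((s - w) * of_real (\<kappa> * ln \<bar>t\<bar>) + (s - w)\<^sup>2)" for s
    \<comment> \<open>With this height, \<open>\<bar>Im s\<bar>\<close> lies between
      \<open>\<bar>t\<bar> / 2\<close> and \<open>3/2 * \<bar>t\<bar>\<close> on \<open>R\<close>.
      The lower bound is at least 1 because \<open>\<bar>t\<bar>\<close> is at least 2, and the
      upper bound is the origin of the factors 3/2.\<close>
    define R where "R = cbox (Complex a (t - \<bar>t\<bar>/2)) (Complex b (t + \<bar>t\<bar>/2))"
    have e0: "0 \<le> e" using \<sigma> ab nonneg by (simp add: e_def)
    have te: "1 \<le> \<bar>t\<bar> powr e" using t e0 by (intro ge_one_powr_ge_zero) auto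
    have R: "a \<le> Re s" "Re s \<le> b" "\<bar>t\<bar> / 2 \<le> \<bar>Im s\<bar>" "\<bar>Im s\<bar> \<le> 3/2 * \<bar>t\<bar>" "1 \<le> \<bar>Im s\<bar>" if "s \<in> R" for s
      using that t by (auto simp: R_def in_cbox_complex_iff)
    have RU: "R \<subseteq> U" using hol(3) R by blast
    have ng: "norm (g s) \<le> norm (f s) * \<bar>t\<bar> powr (\<kappa> * (Re s - \<sigma>)) * (D * exp (- (Im s - t)\<^sup>2))" if "s \<in> R" for s
    proof -
      have "(Re s - \<sigma>)\<^sup>2 \<le> (b - a)\<^sup>2"
        using R[OF that] \<sigma> by (intro abs_le_square_iff[THEN iffD1]) auto
      hence "exp ((Re s - \<sigma>)\<^sup>2 - (Im s - t)\<^sup>2) \<le> D * exp (- (Im s - t)\<^sup>2)"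
        unfolding D_def exp_add[symmetric] by simp
      hence "norm (f s) * \<bar>t\<bar> powr (\<kappa> * (Re s - \<sigma>)) * exp ((Re s - \<sigma>)\<^sup>2 - (Im s - t)\<^sup>2)
          \<le> norm (f s) * \<bar>t\<bar> powr (\<kappa> * (Re s - \<sigma>)) * (D * exp (- (Im s - t)\<^sup>2))"
        by (intro mult_left_mono) auto
      moreover have "norm (g s) = norm (f s) * \<bar>t\<bar> powr (\<kappa> * (Re s - \<sigma>)) * exp ((Re s - \<sigma>)\<^sup>2 - (Im s - t)\<^sup>2)"
      proof -
        have "Re ((s - w) * of_real (\<kappa> * ln \<bar>t\<bar>) + (s - w)\<^sup>2) = (Re s - \<sigma>) * (\<kappa> * ln \<bar>t\<bar>) + ((Re s - \<sigma>)\<^sup>2 - (Im s - t)\<^sup>2)"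
          by (simp add: w_def power2_eq_square)
        thus ?thesis using t unfolding g_def norm_mult norm_exp_eq_Re
          by (auto simp: exp_add powr_def mult_ac)
      qed
      ultimately show ?thesis by simp
    qed
    have powr_im: "\<bar>Im s\<bar> powr c \<le> (3/2) powr c * \<bar>t\<bar> powr c" if "s \<in> R" "0 \<le> c" for s c
      using R[OF that(1)] that(2) t by (subst powr_mult[symmetric]) (auto intro!: powr_mono2)
    have "norm (g w) \<le> K' * \<bar>t\<bar> powr e"
    proof (rule maximum_modulus_frontier[of g R])
      show "g holomorphic_on interior R"
        unfolding g_def using RU interior_subset by (intro holomorphic_intros holomorphic_on_subset[OF hol(1)]) blast
      show "continuous_on (closure R) g"
        unfolding g_def R_def using RU
        by (intro continuous_intros holomorphic_on_imp_continuous_on holomorphic_on_subset[OF hol(1)]) (auto simp: R_def)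
      show "bounded R" unfolding R_def by (rule bounded_cbox)
      show "w \<in> R" using \<sigma> by (auto simp: R_def in_cbox_complex_iff w_def)
      fix s assume "s \<in> frontier R"
      hence sR: "s \<in> R" and "s \<notin> box (Complex a (t - \<bar>t\<bar>/2)) (Complex b (t + \<bar>t\<bar>/2))"
        by (auto simp: R_def frontier_cbox)
      note s = R[OF sR]
      have side: "norm (g s) \<le> K' * \<bar>t\<bar> powr e"
        if fs: "norm (f s) \<le> K * \<bar>Im s\<bar> powr c" and c: "0 \<le> c" "c + \<kappa> * (Re s - \<sigma>) = e" "K * (3/2) powr c \<le> K' / D" for c
      proof -
        have "norm (f s) \<le> K * ((3/2) powr c * \<bar>t\<bar> powr c)"
          using sR nonneg c by (intro order_trans[OF fs] mult_left_mono powr_im) auto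
        hence "norm (g s) \<le> K * ((3/2) powr c * \<bar>t\<bar> powr c) * \<bar>t\<bar> powr (\<kappa> * (Re s - \<sigma>)) * (D * 1)"
          using D0 nonneg by (intro order_trans[OF ng[OF sR]] mult_mono) auto
        also have "\<dots> = K * (3/2) powr c * (D * \<bar>t\<bar> powr e)"
          by (simp add: c(2)[symmetric] powr_add mult_ac)
        also have "\<dots> \<le> K' / D * (D * \<bar>t\<bar> powr e)" using c(3) D0 by (intro mult_right_mono) auto
        finally show ?thesis using D0 by simp
      qed
      consider "Re s = a" | "Re s = b" | "\<bar>Im s - t\<bar> = \<bar>t\<bar> / 2"
        using sR \<open>s \<notin> box _ _\<close> by (fastforce simp: R_def in_cbox_complex_iff in_box_complex_iff)
      thus "norm (g s) \<le> K' * \<bar>t\<bar> powr e"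
      proof cases
        case 1
        have "norm (f s) \<le> K * \<bar>Im s\<bar> powr \<alpha>" using left[of "Im s"] s 1 by (metis complex_surj)
        thus ?thesis by (rule side) (use nonneg ab D0 1 in \<open>auto simp: K'_def e_def \<kappa>_def field_simps\<close>)
      next
        case 2
        have "norm (f s) \<le> K * \<bar>Im s\<bar> powr \<beta>" using right[of "Im s"] s 2 by (metis complex_surj)
        thus ?thesis by (rule side) (use nonneg ab D0 2 in \<open>auto simp: K'_def e_def \<kappa>_def field_simps\<close>)
      next
        case 3
        have "norm (f s) \<le> K * \<bar>Im s\<bar> powr \<gamma>" using s by (intro inner)
        also have "\<dots> \<le> K * ((3/2) powr \<gamma> * \<bar>t\<bar> powr \<gamma>)" using sR nonneg by (intro mult_left_mono powr_im) auto
        finally have fs: "norm (f s) \<le> K * (3/2) powr \<gamma> * \<bar>t\<bar> powr \<gamma>" by (simp add: mult.assoc)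
        have "\<kappa> * (Re s - \<sigma>) \<le> \<bar>\<kappa>\<bar> * \<bar>Re s - \<sigma>\<bar>" by (metis abs_ge_self abs_mult)
        also have "\<dots> \<le> \<bar>\<kappa>\<bar> * (b - a)" using s \<sigma> by (intro mult_left_mono) auto
        finally have ts: "\<bar>t\<bar> powr (\<kappa> * (Re s - \<sigma>)) \<le> \<bar>t\<bar> powr (\<bar>\<kappa>\<bar> * (b - a))"
          using t by (intro powr_mono) auto
        have ims: "(Im s - t)\<^sup>2 = \<bar>t\<bar>\<^sup>2 / 4" using 3 by (metis power2_abs power_divide four_x_squared numeral_Bit0 power2_eq_square numeral_times_numeral mult_2 num_double)
        have "norm (g s) \<le> (K * (3/2) powr \<gamma> * \<bar>t\<bar> powr \<gamma>) * \<bar>t\<bar> powr (\<bar>\<kappa>\<bar> * (b - a)) * (D * exp (- (\<bar>t\<bar>\<^sup>2 / 4)))"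
          using fs D0 nonneg ts ims by (intro order_trans[OF ng[OF sR]] mult_mono) auto
        also have "\<dots> = D * (K * (3/2) powr \<gamma> * (\<bar>t\<bar> powr M * exp (- (\<bar>t\<bar>\<^sup>2 / 4))))"
          by (simp add: M_def powr_add mult_ac)
        also have "\<dots> \<le> D * (K * (3/2) powr \<gamma> * exp (M\<^sup>2))"
          using t M0 D0 nonneg by (intro mult_left_mono powr_times_exp_le) auto
        also have "\<dots> \<le> K'"
          unfolding K'_def using D0 nonneg by (intro mult_left_mono) auto
        also have "\<dots> \<le> K' * \<bar>t\<bar> powr e"
        proof -
          have "0 \<le> K'" unfolding K'_def using D0 nonneg by (intro mult_nonneg_nonneg add_nonneg_nonneg) auto
          thus ?thesis using mult_left_mono[OF te, of K'] by simp
        qed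
        finally show ?thesis .
      qed
    qed
    moreover have "g w = f w" by (simp add: g_def)
    ultimately show ?thesis by (simp add: e_def w_def)
  qed
  moreover have "0 \<le> K'" unfolding K'_def using D0 nonneg by (intro mult_nonneg_nonneg add_nonneg_nonneg) auto
  ultimately show thesis using that by blast
qed


section \<open>The Lindeloef Hypothesis on both sides of the critical line\<close>

lemma norm_le_Im:
  assumes "0 \<le> Re s" "Re s \<le> b" "1 \<le> \<bar>Im s\<bar>"
  shows "norm s \<le> (1 + b) * \<bar>Im s\<bar>"
proof -
  have "norm s \<le> \<bar>Re s\<bar> + \<bar>Im s\<bar>" by (rule cmod_le)
  also have "\<bar>Re s\<bar> \<le> b * \<bar>Im s\<bar>" using assms mult_mono[of "Re s" b 1 "\<bar>Im s\<bar>"] by auto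
  finally show ?thesis by (simp add: algebra_simps)
qed

text \<open>Both edges \<open>Re s = 1/2\<close> and \<open>Re s = 2\<close> carry the exponent
  \<open>e\<close>, so convexity carries it across the strip unchanged; further to the right the
  Dirichlet series is bounded.\<close>

lemma lindelof_strip:
  assumes "lindelof_hypothesis" "0 < e"
  obtains C where "0 \<le> C" "\<And>s. 1/2 \<le> Re s \<Longrightarrow> 2 \<le> \<bar>Im s\<bar> \<Longrightarrow> norm (zeta s) \<le> C * \<bar>Im s\<bar> powr e"
proof -
  obtain C1 where C1: "0 < C1" "\<And>s. 1/2 \<le> Re s \<Longrightarrow> 1 \<le> \<bar>Im s\<bar> \<Longrightarrow> norm (zeta s) \<le> C1 * norm s"
    using norm_zeta_le_linear[of "1/2"] by auto
  obtain C2 where C2: "0 < C2" "\<And>s. 2 \<le> Re s \<Longrightarrow> norm (zeta s) \<le> C2"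
    using norm_zeta_le_const by auto
  have "(\<lambda>t::real. norm (zeta (Complex (1/2) t))) \<in> O[at_infinity](\<lambda>t. \<bar>t\<bar> powr e)"
    using assms by (simp add: lindelof_hypothesis_def)
  then obtain c where c: "0 < c" "\<forall>\<^sub>F t in at_infinity. norm (norm (zeta (Complex (1/2) t))) \<le> c * norm (\<bar>t\<bar> powr e)"
    by (rule landau_o.bigE)
  then obtain T where T: "\<And>t. T \<le> \<bar>t\<bar> \<Longrightarrow> norm (zeta (Complex (1/2) t)) \<le> c * \<bar>t\<bar> powr e"
    by (auto simp: eventually_at_infinity)
  \<comment> \<open>\<open>c\<close> and \<open>C2\<close> serve the two edges. The last summand
    serves the interior of the strip and the part \<open>\<bar>t\<bar> < T\<close> of the critical
    line, about which the asymptotic bound is silent.\<close>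
  define K where "K = c + C2 + C1 * 3 * (1 + \<bar>T\<bar>)"
  have one: "1 \<le> \<bar>t\<bar> powr e" if "1 \<le> \<bar>t\<bar>" for t :: real
    using that assms by (intro ge_one_powr_ge_zero) auto
  have lin: "norm (zeta s) \<le> C1 * 3 * \<bar>Im s\<bar>" if "1/2 \<le> Re s" "Re s \<le> 2" "1 \<le> \<bar>Im s\<bar>" for s
  proof -
    have "norm (zeta s) \<le> C1 * norm s" using that by (intro C1)
    also have "\<dots> \<le> C1 * ((1 + 2) * \<bar>Im s\<bar>)" using that C1(1) by (intro mult_left_mono norm_le_Im) auto
    finally show ?thesis by (simp add: mult_ac)
  qed
  have K: "C1 * 3 \<le> K" "c \<le> K" "C2 \<le> K" "C1 * 3 * \<bar>T\<bar> \<le> K" using c(1) C1(1) C2(1) by (auto simp: K_def algebra_simps)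
  have K0: "0 \<le> K" using K(2) c(1) by linarith
  obtain K' where K': "0 \<le> K'" "\<And>\<sigma> t. 1/2 \<le> \<sigma> \<Longrightarrow> \<sigma> \<le> 2 \<Longrightarrow> 2 \<le> \<bar>t\<bar> \<Longrightarrow>
    norm (zeta (Complex \<sigma> t)) \<le> K' * \<bar>t\<bar> powr ((e * (2 - \<sigma>) + e * (\<sigma> - 1/2)) / (2 - 1/2))"
  proof (rule strip_convexity[of "1/2" 2 e e 1 K zeta "- {1}"])
    show "norm (zeta s) \<le> K * \<bar>Im s\<bar> powr 1" if "1/2 \<le> Re s" "Re s \<le> 2" "1 \<le> \<bar>Im s\<bar>" for s
    proof -
      have "C1 * 3 * \<bar>Im s\<bar> \<le> K * \<bar>Im s\<bar>" using K by (intro mult_right_mono) auto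
      thus ?thesis using lin[OF that] that by simp
    qed
    show "norm (zeta (Complex (1/2) t)) \<le> K * \<bar>t\<bar> powr e" if t: "1 \<le> \<bar>t\<bar>" for t
    proof (cases "T \<le> \<bar>t\<bar>")
      case True
      have "c * \<bar>t\<bar> powr e \<le> K * \<bar>t\<bar> powr e" using K by (intro mult_right_mono) auto
      thus ?thesis using T[OF True] by linarith
    next
      case False
      have "norm (zeta (Complex (1/2) t)) \<le> C1 * 3 * \<bar>t\<bar>" using lin[of "Complex (1/2) t"] t by simp
      also have "\<dots> \<le> C1 * 3 * \<bar>T\<bar>" using False C1(1) by (intro mult_left_mono) auto
      also have "\<dots> \<le> K * 1" using K by simp
      also have "\<dots> \<le> K * \<bar>t\<bar> powr e" using K0 one[OF t] by (intro mult_left_mono) auto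
      finally show ?thesis .
    qed
    show "norm (zeta (Complex 2 t)) \<le> K * \<bar>t\<bar> powr e" if "1 \<le> \<bar>t\<bar>" for t
    proof -
      have "norm (zeta (Complex 2 t)) \<le> K * 1" using C2(2)[of "Complex 2 t"] K by auto
      also have "\<dots> \<le> K * \<bar>t\<bar> powr e" using K0 one[OF that] by (intro mult_left_mono) auto
      finally show ?thesis .
    qed
  qed (use assms K0 zeta_holomorphic in auto)
  have "norm (zeta s) \<le> (K' + C2) * \<bar>Im s\<bar> powr e" if s: "1/2 \<le> Re s" "2 \<le> \<bar>Im s\<bar>" for s
  proof (cases "Re s \<le> 2")
    case True
    have "(e * (2 - Re s) + e * (Re s - 1/2)) / (2 - 1/2) = e" by (simp add: field_simps)
    hence "norm (zeta s) \<le> K' * \<bar>Im s\<bar> powr e" using K'(2)[of "Re s" "Im s"] s True by simp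
    also have "\<dots> \<le> (K' + C2) * \<bar>Im s\<bar> powr e" using C2(1) by (intro mult_right_mono) auto
    finally show ?thesis .
  next
    case False
    have "norm (zeta s) \<le> C2 * 1" using C2(2)[of s] False by auto
    also have "\<dots> \<le> (K' + C2) * \<bar>Im s\<bar> powr e" using C2(1) K'(1) one[of "Im s"] s by (intro mult_mono) auto
    finally show ?thesis .
  qed
  thus thesis using that[of "K' + C2"] K'(1) C2(1) by auto
qed

text \<open>The critical line lies outside the region of the assumed bounds, so they are
  interpolated with the linear bound on \<open>Re s = 1/4\<close>. As the right edge tends to the
  critical line, the weight of the linear bound tends to 0.\<close>

lemma lindelof_if_right_of_line:
  assumes "\<And>\<delta> e. 0 < \<delta> \<Longrightarrow> 0 < e \<Longrightarrow> \<exists>C. \<forall>t. 1 \<le> \<bar>t\<bar> \<longrightarrow> norm (zeta (Complex (1/2 + \<delta>) t)) \<le> C * \<bar>t\<bar> powr e"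
  shows "lindelof_hypothesis"
  unfolding lindelof_hypothesis_def
proof (intro allI impI)
  fix e :: real assume e: "0 < e"
  \<comment> \<open>At real part 1/2 the interpolated exponent is
    \<open>(\<delta> + e/8) / (1/4 + \<delta>)\<close>, which is at most \<open>e\<close> once
    \<open>\<delta> \<le> e/8\<close>. The cap 1 keeps the strip inside
    \<open>Re s \<le> 2\<close>.\<close>
  define \<delta> where "\<delta> = min 1 (e / 8)"
  have \<delta>: "0 < \<delta>" "\<delta> \<le> 1" "\<delta> \<le> e / 8" using e by (auto simp: \<delta>_def)
  obtain C1 where C1: "0 < C1" "\<And>s. 1/4 \<le> Re s \<Longrightarrow> 1 \<le> \<bar>Im s\<bar> \<Longrightarrow> norm (zeta s) \<le> C1 * norm s"
    using norm_zeta_le_linear[of "1/4"] by auto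
  obtain C where C: "\<And>t. 1 \<le> \<bar>t\<bar> \<Longrightarrow> norm (zeta (Complex (1/2 + \<delta>) t)) \<le> C * \<bar>t\<bar> powr (e / 2)"
    using assms[of \<delta> "e / 2"] \<delta> e by auto
  define K where "K = \<bar>C\<bar> + C1 * 3"
  have K0: "0 \<le> K" and KC: "C \<le> K" and KC1: "C1 * 3 \<le> K" using C1(1) by (auto simp: K_def)
  have lin: "norm (zeta s) \<le> K * \<bar>Im s\<bar> powr 1" if "1/4 \<le> Re s" "Re s \<le> 1/2 + \<delta>" "1 \<le> \<bar>Im s\<bar>" for s
  proof -
    have "norm (zeta s) \<le> C1 * norm s" using that by (intro C1)
    also have "\<dots> \<le> C1 * ((1 + 2) * \<bar>Im s\<bar>)" using that C1(1) \<delta> by (intro mult_left_mono norm_le_Im) auto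
    also have "\<dots> = C1 * 3 * \<bar>Im s\<bar>" by simp
    also have "\<dots> \<le> K * \<bar>Im s\<bar>" using KC1 by (intro mult_right_mono) auto
    finally show ?thesis using that by simp
  qed
  obtain K' where K': "0 \<le> K'" "\<And>\<sigma> t. 1/4 \<le> \<sigma> \<Longrightarrow> \<sigma> \<le> 1/2 + \<delta> \<Longrightarrow> 2 \<le> \<bar>t\<bar> \<Longrightarrow>
    norm (zeta (Complex \<sigma> t)) \<le> K' * \<bar>t\<bar> powr ((1 * (1/2 + \<delta> - \<sigma>) + e/2 * (\<sigma> - 1/4)) / (1/2 + \<delta> - 1/4))"
  proof (rule strip_convexity[of "1/4" "1/2 + \<delta>" 1 "e/2" 1 K zeta "- {1}"])
    show "norm (zeta (Complex (1/4) t)) \<le> K * \<bar>t\<bar> powr 1" if t: "1 \<le> \<bar>t\<bar>" for t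
      using lin[of "Complex (1/4) t"] t \<delta> by simp
    show "norm (zeta (Complex (1/2 + \<delta>) t)) \<le> K * \<bar>t\<bar> powr (e/2)" if "1 \<le> \<bar>t\<bar>" for t
      by (rule order_trans[OF C[OF that]]) (intro mult_right_mono KC powr_ge_zero)
  qed (use lin e \<delta> K0 zeta_holomorphic in auto)
  have "norm (zeta (Complex (1/2) t)) \<le> K' * \<bar>t\<bar> powr e" if t: "2 \<le> \<bar>t\<bar>" for t
  proof -
    have "\<delta> + e / 8 \<le> e * (1/4 + \<delta>)"
    proof -
      have "0 \<le> e * \<delta>" using \<delta> e by simp
      moreover have "e * (1/4 + \<delta>) = e / 4 + e * \<delta>" by (simp add: algebra_simps)
      ultimately show ?thesis using \<delta> by linarith
    qed
    hence "(1 * (1/2 + \<delta> - 1/2) + e/2 * (1/2 - 1/4)) / (1/2 + \<delta> - 1/4) \<le> e"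
      using \<delta> by (simp add: field_simps)
    hence "K' * \<bar>t\<bar> powr ((1 * (1/2 + \<delta> - 1/2) + e/2 * (1/2 - 1/4)) / (1/2 + \<delta> - 1/4)) \<le> K' * \<bar>t\<bar> powr e"
      using t K'(1) by (intro mult_left_mono powr_mono) auto
    thus ?thesis using K'(2)[of "1/2" t] t \<delta> by simp
  qed
  thus "(\<lambda>t::real. norm (zeta (Complex (1/2) t))) \<in> O[at_infinity](\<lambda>t. \<bar>t\<bar> powr e)"
    by (intro bigoI[of _ K']) (auto simp: eventually_at_infinity intro!: exI[of _ 2])
qed

section \<open>Taylor coefficients in the disc\<close>

definition lam_fps :: "nat \<Rightarrow> complex fps" where
  "lam_fps k = Abs_fps (\<lambda>j. lam j k / fact j)"

text \<open>The Taylor coefficients of \<open>(s - 1)\<^sup>k \<zeta>(s)\<^sup>k / s\<close> at \<open>s = 1\<close>.\<close>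

definition quot_coef :: "nat \<Rightarrow> nat \<Rightarrow> complex" where
  "quot_coef k m = (\<Sum>i\<le>m. (-1) ^ (m - i) * (lam i k / fact i))"

text \<open>The sign undoes the factor \<open>(-1) ^ n\<close> in \<open>ell\<close>, leaving the
  Laguerre coefficient itself.\<close>

definition lag_coef :: "nat \<Rightarrow> nat \<Rightarrow> complex" where
  "lag_coef k n = (-1) ^ n * ell n k"

lemma quot_coef_alt: "quot_coef k m = (-1) ^ m * (\<Sum>i=0..m. (-1) ^ i * lam i k / fact i)"
  unfolding quot_coef_def sum_distrib_left atLeast0AtMost
  by (intro sum.cong) (auto simp: minus_one_power_iff)

text \<open>Coefficient comparison after multiplying the quotient by its denominator
  \<open>s = 1 + (s - 1)\<close>.\<close>

lemma quot_coef_Suc: "quot_coef k (Suc m) + quot_coef k m = lam (Suc m) k / fact (Suc m)"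
  by (simp add: quot_coef_alt algebra_simps minus_one_power_iff)

text \<open>So \<open>a_coef j k\<close> is the coefficient of \<open>(s - 1)^(-j-1)\<close> in
  \<open>\<zeta>(s)^k / s\<close>, and dividing it by \<open>j!\<close> gives the term of the main
  term whose Mellin transform has exactly this pole.\<close>

lemma a_coef_conv_quot_coef: "a_coef j k = quot_coef k (k - 1 - j)"
  by (simp add: a_coef_def quot_coef_alt)

lemma lag_coef_0: "lag_coef k 0 = quot_coef k k"
  by (simp add: lag_coef_def ell_def quot_coef_alt)

lemma lag_coef_Suc: "lag_coef k (Suc n) = (\<Sum>j\<le>n. of_nat (n choose j) * (lam (Suc j + k) k / fact (Suc j + k)))"
proof -
  have "lag_coef k (Suc n) = (\<Sum>j=Suc 0..Suc n. of_nat (n choose (j - 1)) * lam (j + k) k / fact (j + k))"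
    by (simp add: lag_coef_def ell_def power_add[symmetric] mult.assoc[symmetric] power_mult_distrib[symmetric])
  also have "\<dots> = (\<Sum>j=0..n. of_nat (n choose j) * lam (Suc j + k) k / fact (Suc j + k))"
    by (subst sum.shift_bounds_cl_Suc_ivl) simp
  finally show ?thesis by (simp add: atLeast0AtMost)
qed

text \<open>Rewriting each Taylor coefficient in \<open>ell\<close> by \<open>quot_coef_Suc\<close>
  gives two sums with lower binomials, which Pascal's rule merges. The result is a plain binomial
  transform that also covers \<open>n = 0\<close>, the form in which \<open>phi\<close> is
  expanded.\<close>

lemma lag_coef_conv_quot_coef: "lag_coef k n = (\<Sum>m\<le>n. of_nat (n choose m) * quot_coef k (k + m))"
proof (cases n)
  case 0 thus ?thesis by (simp add: lag_coef_0)
next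
  case (Suc N)
  let ?b = "\<lambda>m. quot_coef k (k + m)"
  have "lag_coef k n = (\<Sum>j\<le>N. of_nat (N choose j) * ?b (Suc j)) + (\<Sum>j\<le>N. of_nat (N choose j) * ?b j)"
    unfolding Suc lag_coef_Suc sum.distrib[symmetric] distrib_left[symmetric]
  proof (intro sum.cong arg_cong2[where f = "(*)"] refl)
    fix j show "lam (Suc j + k) k / fact (Suc j + k) = ?b (Suc j) + ?b j"
      using quot_coef_Suc[of k "k + j"] by (simp only: add_Suc add_Suc_right add.commute[of j k])
  qed
  also have "(\<Sum>j\<le>N. of_nat (N choose j) * ?b j) = (\<Sum>j\<le>n. of_nat (N choose j) * ?b j)"
    by (simp add: Suc)
  also have "\<dots> = ?b 0 + (\<Sum>j\<le>N. of_nat (N choose Suc j) * ?b (Suc j))"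
    unfolding Suc by (subst sum.atMost_Suc_shift) simp
  also have "(\<Sum>j\<le>N. of_nat (N choose j) * ?b (Suc j)) + (?b 0 + (\<Sum>j\<le>N. of_nat (N choose Suc j) * ?b (Suc j)))
      = ?b 0 + (\<Sum>j\<le>N. of_nat (n choose Suc j) * ?b (Suc j))"
    by (simp add: Suc sum.distrib[symmetric] algebra_simps)
  also have "\<dots> = (\<Sum>m\<le>n. of_nat (n choose m) * ?b m)"
    unfolding Suc by (simp only: sum.atMost_Suc_shift) simp
  finally show ?thesis .
qed

lemma zeta_pow_reg_fps: "(\<lambda>w. zeta_pow_reg k (1 + w)) has_fps_expansion lam_fps k"
proof -
  have "zeta_pow_reg k analytic_on {1}"
    using zeta_pow_reg_holomorphic[of k] analytic_on_open[OF open_UNIV] analytic_on_subset by blast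
  from analytic_at_imp_has_fps_expansion[OF this] show ?thesis
    by (simp add: fps_expansion_def lam_fps_def lam_def)
qed

lemma geometric_fps:
  fixes c :: complex
  assumes "norm c = 1"
  shows "(\<lambda>w. 1 / (1 - c * w)) has_fps_expansion Abs_fps (\<lambda>n. c ^ n)"
proof (rule has_fps_expansionI)
  have "eventually (\<lambda>u::complex. u \<in> ball 0 1) (nhds 0)" by (intro eventually_nhds_in_open) auto
  thus "\<forall>\<^sub>F u in nhds 0. (\<lambda>n. fps_nth (Abs_fps (\<lambda>n. c ^ n)) n * u ^ n) sums (1 / (1 - c * u))"
    by eventually_elim (use assms geometric_sums[of "c * u" for u] in \<open>auto simp: power_mult_distrib norm_mult\<close>)
qed

lemma quot_coef_fps: "(\<lambda>w. zeta_pow_reg k (1 + w) / (1 + w)) has_fps_expansion Abs_fps (quot_coef k)"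
proof -
  have "(\<lambda>w::complex. 1 / (1 + w)) has_fps_expansion Abs_fps (\<lambda>n. (-1) ^ n)"
    using geometric_fps[of "-1"] by simp
  from has_fps_expansion_mult[OF zeta_pow_reg_fps[of k] this]
  have "(\<lambda>w. zeta_pow_reg k (1 + w) / (1 + w)) has_fps_expansion lam_fps k * Abs_fps (\<lambda>n. (-1) ^ n)" by simp
  also have "lam_fps k * Abs_fps (\<lambda>n. (-1) ^ n) = Abs_fps (quot_coef k)"
    by (auto simp: fps_eq_iff fps_mult_nth lam_fps_def quot_coef_def atLeast0AtMost intro!: sum.cong)
  finally show ?thesis .
qed

lemma fps_geometric_power_nth:
  "fps_nth ((Abs_fps (\<lambda>_. 1) :: complex fps) ^ Suc i) n = of_nat ((n + i) choose i)"
proof (induction i arbitrary: n)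
  case (Suc i)
  have "fps_nth ((Abs_fps (\<lambda>_. 1) :: complex fps) ^ Suc (Suc i)) n = (\<Sum>j\<le>n. of_nat ((j + i) choose i))"
    unfolding power_Suc2[of _ "Suc i"] fps_mult_nth by (simp only: Suc atLeast0AtMost) simp
  also have "\<dots> = of_nat (\<Sum>j\<le>n. (i + j) choose j)"
    unfolding of_nat_sum
  proof (intro sum.cong arg_cong[where f = of_nat] refl)
    fix j show "(j + i) choose i = (i + j) choose j" using binomial_symmetric[of j "i + j"] by (simp add: add.commute)
  qed
  also have "\<dots> = of_nat ((n + Suc i) choose Suc i)"
    unfolding sum_choose_lower using binomial_symmetric[of n "Suc (i + n)"] by (simp add: add_ac)
  finally show ?case .
qed simp

text \<open>The powers of \<open>z / (1 - z)\<close> are the origin of the binomial coefficients in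
  \<open>ell\<close>.\<close>

lemma moebius_fps_power_nth:
  "fps_nth ((fps_X * Abs_fps (\<lambda>_. 1) :: complex fps) ^ Suc i) (Suc n) = of_nat (n choose i)"
  unfolding power_mult_distrib fps_X_power_mult_nth fps_geometric_power_nth by (auto simp: not_less)

lemma moebius_fps: "(\<lambda>z::complex. z / (1 - z)) has_fps_expansion fps_X * Abs_fps (\<lambda>_. 1)"
proof -
  have "(\<lambda>z::complex. 1 / (1 - z)) has_fps_expansion Abs_fps (\<lambda>_. 1)"
    using geometric_fps[of 1] by simp
  from has_fps_expansion_mult[OF has_fps_expansion_fps_X this] show ?thesis by simp
qed

text \<open>In the variable \<open>w = s - 1\<close>, the function \<open>E\<close> is \<open>s F(s)\<close>, where \<open>F\<close> is the Mellin transform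
  \<open>\<zeta>(s)\<^sup>k / s\<close> minus its principal part at \<open>s = 1\<close>. The map \<open>z \<mapsto> z / (1 - z)\<close> takes the unit disc
  to the half-plane \<open>Re s > 1/2\<close>.\<close>

lemma regularised_zeta_power:
  assumes k: "1 \<le> k"
  obtains E where "E holomorphic_on UNIV"
    "\<And>w. w \<noteq> 0 \<Longrightarrow> E w = zeta (1 + w) ^ k - (\<Sum>i<k. lam i k / fact i / w ^ (k - i)) - quot_coef k (k - 1)"
    "\<And>z. norm z < 1 \<Longrightarrow> (\<lambda>n. lag_coef k n * z ^ n) sums E (z / (1 - z))"
proof -
  let ?F = "lam_fps k"
  let ?b = "quot_coef k (k - 1)"
  define T where "T w = (\<Sum>i<k. lam i k / fact i * w ^ i)" for w :: complex
  have T: "T has_fps_expansion fps_cutoff k ?F"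
  proof -
    have "(\<lambda>w. \<Sum>i<k. fps_nth ?F i * w ^ i) has_fps_expansion (\<Sum>i<k. fps_const (fps_nth ?F i) * fps_X ^ i)"
      by (intro fps_expansion_intros)
    also have "(\<Sum>i<k. fps_const (fps_nth ?F i) * fps_X ^ i) = fps_cutoff k ?F"
      by (simp add: fps_eq_iff fps_sum_nth mult_delta_right)
    also have "(\<lambda>w. \<Sum>i<k. fps_nth ?F i * w ^ i) = T" by (simp add: T_def lam_fps_def fun_eq_iff)
    finally show ?thesis .
  qed
  \<comment> \<open>The principal part of \<open>\<zeta>(s)^k / s\<close>, multiplied by
    \<open>s = 1 + w\<close>, is the polar part of \<open>\<zeta>(s)^k\<close> plus the constant
    \<open>?b\<close>; hence the subtraction. The value at \<open>w = 0\<close> fills the removable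
    singularity.\<close>
  define E where "E w = (if w = 0 then fps_nth ?F k else (zeta_pow_reg k (1 + w) - T w) / w ^ k) - ?b" for w
  have sub: "k \<le> subdegree (?F - fps_cutoff k ?F) \<or> ?F - fps_cutoff k ?F = 0"
    by (auto intro!: subdegree_geI)
  have sh: "fps_shift k (?F - fps_cutoff k ?F) = fps_shift k ?F" by (simp add: fps_eq_iff)
  have E: "E has_fps_expansion fps_shift k ?F - fps_const ?b"
  proof -
    have "(\<lambda>w. if w = 0 then fps_nth ?F k else (zeta_pow_reg k (1 + w) - T w) / w ^ k) has_fps_expansion fps_shift k (?F - fps_cutoff k ?F)"
    \<comment> \<open>The zero series has subdegree 0 and escapes the rule for shifting, so it is
      treated apart.\<close>
    proof (cases "?F - fps_cutoff k ?F = 0")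
      case False
      thus ?thesis using sub
        by (intro has_fps_expansion_shift has_fps_expansion_diff zeta_pow_reg_fps T) auto
    next
      case True
      hence "(\<lambda>w. zeta_pow_reg k (1 + w) - T w) has_fps_expansion 0"
        using has_fps_expansion_diff[OF zeta_pow_reg_fps T] by metis
      moreover have "fps_nth ?F k = 0"
        using arg_cong[OF True, of "\<lambda>f. fps_nth f k"] by simp
      ultimately show ?thesis unfolding True fps_shift_zero has_fps_expansion_0_iff
        by (auto elim!: eventually_mono)
    qed
    from has_fps_expansion_diff[OF this has_fps_expansion_const[of ?b]] show ?thesis
      unfolding sh E_def .
  qed
  have holE: "E holomorphic_on UNIV"
  proof -
    have "E holomorphic_on UNIV - {0}"
    proof (rule holomorphic_transform)
      show "(\<lambda>w. (zeta_pow_reg k (1 + w) - T w) / w ^ k - ?b) holomorphic_on UNIV - {0}"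
        unfolding T_def by (intro holomorphic_intros holomorphic_on_compose_gen[OF _ zeta_pow_reg_holomorphic, unfolded o_def]) auto
    qed (auto simp: E_def)
    hence "E analytic_on UNIV - {0}" by (subst analytic_on_open) auto
    moreover have "E analytic_on {0}" using E by (rule has_fps_expansion_imp_analytic_0)
    ultimately have "E analytic_on (UNIV - {0}) \<union> {0}" by (simp only: analytic_on_Un)
    thus ?thesis by (intro analytic_imp_holomorphic) (simp add: insert_absorb)
  qed
  have "E w = zeta (1 + w) ^ k - (\<Sum>i<k. lam i k / fact i / w ^ (k - i)) - ?b" if w: "w \<noteq> 0" for w
  proof -
    have "(\<Sum>i<k. lam i k / fact i / w ^ (k - i)) = T w / w ^ k"
      unfolding T_def sum_divide_distrib
    proof (intro sum.cong refl)
      fix i assume "i \<in> {..<k}"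
      hence "w ^ k = w ^ (k - i) * w ^ i" by (simp add: power_add[symmetric])
      thus "lam i k / fact i / w ^ (k - i) = lam i k / fact i * w ^ i / w ^ k" using w by simp
    qed
    thus ?thesis using w by (simp add: E_def zeta_pow_reg_def diff_divide_distrib)
  qed
  moreover have "(\<lambda>n. lag_coef k n * z ^ n) sums E (z / (1 - z))" if z: "norm z < 1" for z
  proof -
    let ?G = "fps_X * Abs_fps (\<lambda>_. 1) :: complex fps"
    have fe: "(E \<circ> (\<lambda>z. z / (1 - z))) has_fps_expansion fps_compose (fps_shift k ?F - fps_const ?b) ?G"
      by (intro has_fps_expansion_compose E moebius_fps) simp
    have hol: "(E \<circ> (\<lambda>z. z / (1 - z))) holomorphic_on eball 0 1"
      by (intro holomorphic_on_compose_gen[OF _ holE] holomorphic_intros) auto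
    have coef: "fps_nth (fps_compose (fps_shift k ?F - fps_const ?b) ?G) n = lag_coef k n" for n
    proof (cases n)
      case 0
      obtain j where j: "k = Suc j" using k by (cases k) auto
      \<comment> \<open>The constant coefficient is \<open>lam k k / fact k - ?b\<close>, which the
        recursion turns into \<open>quot_coef k k\<close>.\<close>
      show ?thesis using quot_coef_Suc[of k j] by (simp add: 0 lag_coef_0 fps_compose_nth lam_fps_def j algebra_simps)
    next
      case (Suc N)
      show ?thesis
        unfolding Suc fps_compose_nth lag_coef_Suc atLeast0AtMost sum.atMost_Suc_shift
        by (simp only: moebius_fps_power_nth) (auto simp: lam_fps_def intro!: sum.cong)
    qed
    have "(\<lambda>n. fps_nth (fps_compose (fps_shift k ?F - fps_const ?b) ?G) n * z ^ n) sums (E \<circ> (\<lambda>z. z / (1 - z))) z"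
      by (rule has_fps_expansion_imp_sums_complex[OF fe hol]) (use z in \<open>simp add: one_ereal_def\<close>)
    thus ?thesis by (simp only: coef o_def)
  qed
  ultimately show thesis using that holE by blast
qed

lemma norm_principal_part_le:
  assumes "1 \<le> norm w"
  shows "norm (\<Sum>i<k. lam i k / fact i / w ^ (k - i)) \<le> (\<Sum>i<k. norm (lam i k / fact i))"
proof (intro order_trans[OF norm_sum] sum_mono)
  fix i
  have "1 \<le> norm w ^ (k - i)" using assms by simp
  hence "norm (lam i k / fact i) / norm w ^ (k - i) \<le> norm (lam i k / fact i) / 1"
    by (intro divide_left_mono) auto
  thus "norm (lam i k / fact i / w ^ (k - i)) \<le> norm (lam i k / fact i)"
    by (simp only: norm_divide norm_power div_by_1)
qed


section \<open>From mean square convergence to the growth of zeta\<close>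

lemma bessel_J0_measurable [measurable]: "bessel_J0 \<in> borel_measurable borel"
  unfolding bessel_J0_def[abs_def] by measurable

lemma Delta_measurable [measurable]: "Delta k \<in> borel_measurable borel"
proof -
  have "(\<lambda>x::real. nat \<lfloor>x\<rfloor>) \<in> measurable borel (count_space UNIV)" by measurable
  moreover have "(\<lambda>m. complex_of_nat (\<Sum>n=1..m. dk k n)) \<in> borel_measurable (count_space UNIV)" by simp
  ultimately have [measurable]: "(\<lambda>x::real. complex_of_nat (\<Sum>n=1..nat \<lfloor>x\<rfloor>. dk k n)) \<in> borel_measurable borel"
    by (rule measurable_compose)
  show ?thesis unfolding Delta_def[abs_def] P_poly_def by measurable
qed

lemma phi_measurable [measurable]: "phi k \<in> borel_measurable borel"
  unfolding phi_def[abs_def] set_lebesgue_integral_def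
  by (rule sigma_finite_measure.borel_measurable_lebesgue_integral[OF sigma_finite_lborel]) measurable

lemma phi_N_conv: "phi_N N k x = of_real (exp (- x)) * (\<Sum>n\<le>N. lag_coef k n / fact n * of_real x ^ n)"
  by (simp add: phi_N_def lag_coef_def atLeast0AtMost)

lemma phi_N_measurable [measurable]: "phi_N N k \<in> borel_measurable borel"
  unfolding phi_N_def[abs_def] by measurable

lemma nn_integral_poisson: "(\<integral>\<^sup>+x\<in>{0..}. ennreal (exp (- x) * x ^ n / fact n) \<partial>lborel) = 1"
proof -
  have "(\<integral>\<^sup>+x\<in>{0..}. ennreal (exp (- x) * x ^ n / fact n) \<partial>lborel)
      = (\<integral>\<^sup>+x. ennreal (1 / fact n) * (ennreal (x ^ n * exp (- x)) * indicator {0..} x) \<partial>lborel)"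
    by (intro nn_integral_cong) (auto simp: indicator_def ennreal_mult'[symmetric] mult_ac)
  also have "\<dots> = ennreal (1 / fact n) * ennreal (fact n)"
    using nn_intergal_power_times_exp_Ici[of n] by (subst nn_integral_cmult) auto
  also have "\<dots> = 1" by (simp add: ennreal_mult'[symmetric])
  finally show ?thesis .
qed

text \<open>The substitution \<open>x \<mapsto> x / 2\<close> turns the squared weight of order
  \<open>n\<close> into a multiple of the weight of order \<open>2 n\<close>, whose integral is 1;
  the factor 1/2 is the Jacobian.\<close>

lemma nn_integral_poisson_square:
  "(\<integral>\<^sup>+x\<in>{0..}. ennreal ((exp (- x) * x ^ n / fact n)\<^sup>2) \<partial>lborel) = ennreal (real ((2 * n) choose n) / (2 * 4 ^ n))"
proof -
  let ?f = "\<lambda>x. ennreal ((exp (- (0 + 1/2 * x)) * (0 + 1/2 * x) ^ n / fact n)\<^sup>2) * indicator {0..} (0 + 1/2 * x)"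
  let ?g = "\<lambda>x. ennreal (real ((2 * n) choose n) / 4 ^ n) * (ennreal (exp (- x) * x ^ (2 * n) / fact (2 * n)) * indicator {0..} x)"
  have "(\<integral>\<^sup>+x\<in>{0..}. ennreal ((exp (- x) * x ^ n / fact n)\<^sup>2) \<partial>lborel)
      = ennreal \<bar>1/2\<bar> * (\<integral>\<^sup>+x. ?f x \<partial>lborel)"
    by (rule nn_integral_real_affine[where t = 0 and c = "1/2"]) auto
  also have "(\<integral>\<^sup>+x. ?f x \<partial>lborel)
      = (\<integral>\<^sup>+x. ?g x \<partial>lborel)"
  proof (intro nn_integral_cong)
    fix x :: real
    have "real ((2 * n) choose n) = fact (2 * n) / (fact n * fact n)"
      by (subst binomial_fact) (auto simp: mult_2)
    moreover have "exp (- x) = (exp (- (x / 2)))\<^sup>2"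
      by (simp add: exp_double[symmetric])
    moreover have "x ^ (2 * n) = (x ^ n)\<^sup>2" by (simp add: power_mult[symmetric] mult.commute)
    moreover have "(4::real) ^ n = (2 ^ n)\<^sup>2" by (simp add: power2_eq_square power_mult_distrib[symmetric])
    ultimately have "(exp (- (0 + 1/2 * x)) * (0 + 1/2 * x) ^ n / fact n)\<^sup>2 = real ((2 * n) choose n) / 4 ^ n * (exp (- x) * x ^ (2 * n) / fact (2 * n))"
      by (simp add: power_divide power_mult_distrib field_simps power2_eq_square)
    thus "?f x
       = ?g x"
      by (auto simp: indicator_def ennreal_mult'[symmetric])
  qed
  also have "\<dots> = ennreal (real ((2 * n) choose n) / 4 ^ n)"
    using nn_integral_poisson[of "2 * n"] by (subst nn_integral_cmult) auto
  also have "ennreal \<bar>1/2\<bar> * ennreal (real ((2 * n) choose n) / 4 ^ n) = ennreal (real ((2 * n) choose n) / (2 * 4 ^ n))"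
    by (subst ennreal_mult'[symmetric]) (simp_all add: field_simps)
  finally show ?thesis .
qed

text \<open>Consecutive partial sums differ by one coefficient times one Poisson weight, and by the
  lower bound for central binomial coefficients the squared norm of that weight is at least
  \<open>1 / (4 n)\<close>. So eventually the squared coefficient is below
  \<open>4 n\<close>.\<close>

lemma lag_coef_linear_bound:
  assumes lim: "(\<lambda>N. \<integral>\<^sup>+ x\<in>{0..}. ennreal ((cmod (phi_N N k x - phi k x))\<^sup>2) \<partial>lborel) \<longlonglongrightarrow> 0"
  obtains C where "0 \<le> C" "\<And>n. norm (lag_coef k n) \<le> C * real (Suc n)"
proof -
  define d where "d N = (\<integral>\<^sup>+ x\<in>{0..}. ennreal ((cmod (phi_N N k x - phi k x))\<^sup>2) \<partial>lborel)" for N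
  have "(\<lambda>N. 2 * d (Suc N) + 2 * d N) \<longlonglongrightarrow> 2 * 0 + 2 * 0"
    using lim unfolding d_def[symmetric]
    by (intro tendsto_add ennreal_tendsto_cmult LIMSEQ_Suc) auto
  hence "eventually (\<lambda>N. 2 * d (Suc N) + 2 * d N < 1) sequentially"
    by (intro order_tendstoD(2)) auto
  then obtain M where M: "\<And>N. M \<le> N \<Longrightarrow> 2 * d (Suc N) + 2 * d N < 1"
    by (auto simp: eventually_sequentially)
  have bound: "norm (lag_coef k (Suc N)) \<le> 2 * real (Suc (Suc N))" if N: "M \<le> N" for N
  proof -
    let ?n = "Suc N"
    let ?d = "\<lambda>x. cmod (phi_N ?n k x - phi_N N k x)"
    let ?c = "(norm (lag_coef k ?n))\<^sup>2"
    have "ennreal (?c / (4 * real ?n)) \<le> ennreal (?c * (real ((2 * ?n) choose ?n) / (2 * 4 ^ ?n)))"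
    proof (rule ennreal_leI)
      have "4 ^ ?n / (2 * real ?n) \<le> real ((2 * ?n) choose ?n)" by (rule central_binomial_lower_bound) simp
      hence "1 / (4 * real ?n) \<le> real ((2 * ?n) choose ?n) / (2 * 4 ^ ?n)"
        by (simp add: field_simps del: binomial_Suc_Suc of_nat_Suc power_Suc)
      from mult_left_mono[OF this, of ?c] show "?c / (4 * real ?n) \<le> ?c * (real ((2 * ?n) choose ?n) / (2 * 4 ^ ?n))"
        by simp
    qed
    also have "\<dots> = ennreal ?c * (\<integral>\<^sup>+x\<in>{0..}. ennreal ((exp (- x) * x ^ ?n / fact ?n)\<^sup>2) \<partial>lborel)"
      by (subst nn_integral_poisson_square, subst ennreal_mult'[symmetric]) (simp_all only: zero_le_power2)
    also have "\<dots> = (\<integral>\<^sup>+x\<in>{0..}. ennreal ((?d x)\<^sup>2) \<partial>lborel)"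
    proof (subst nn_integral_cmult[symmetric], measurable, intro nn_integral_cong)
      fix x :: real
      have "phi_N ?n k x - phi_N N k x = lag_coef k ?n * of_real (exp (- x) * x ^ ?n / fact ?n)"
        unfolding phi_N_conv sum.atMost_Suc by (simp add: algebra_simps del: fact_Suc power_Suc)
      hence "(?d x)\<^sup>2 = ?c * (exp (- x) * x ^ ?n / fact ?n)\<^sup>2"
        by (simp only: norm_mult norm_of_real power_mult_distrib power2_abs)
      thus "ennreal ?c * (ennreal ((exp (- x) * x ^ ?n / fact ?n)\<^sup>2) * indicator {0..} x) =
        ennreal ((?d x)\<^sup>2) * indicator {0..} x"
        by (simp only: ennreal_mult' zero_le_power2 mult.assoc)
    qed
    also have "\<dots> \<le> (\<integral>\<^sup>+x. 2 * (ennreal ((cmod (phi_N ?n k x - phi k x))\<^sup>2) * indicator {0..} x)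
        + 2 * (ennreal ((cmod (phi_N N k x - phi k x))\<^sup>2) * indicator {0..} x) \<partial>lborel)"
    proof (intro nn_integral_mono)
      fix x :: real
      let ?a = "cmod (phi_N ?n k x - phi k x)" and ?b = "cmod (phi_N N k x - phi k x)"
      have "?d x \<le> ?a + ?b"
        using norm_triangle_ineq4[of "phi_N ?n k x - phi k x" "phi_N N k x - phi k x"] by simp
      hence "(?d x)\<^sup>2 \<le> (?a + ?b)\<^sup>2" by (intro power_mono) auto
      also have "\<dots> \<le> 2 * ?a\<^sup>2 + 2 * ?b\<^sup>2"
        using zero_le_power2[of "?a - ?b"] by (simp add: power2_eq_square algebra_simps)
      finally have "ennreal ((?d x)\<^sup>2) \<le> ennreal (2 * ?a\<^sup>2 + 2 * ?b\<^sup>2)"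
        by (rule ennreal_leI)
      also have "\<dots> = 2 * ennreal (?a\<^sup>2) + 2 * ennreal (?b\<^sup>2)"
        by (subst ennreal_plus) (auto simp: ennreal_mult')
      finally show "ennreal ((?d x)\<^sup>2) * indicator {0..} x \<le>
         2 * (ennreal (?a\<^sup>2) * indicator {0..} x) + 2 * (ennreal (?b\<^sup>2) * indicator {0..} x)"
        by (auto simp: indicator_def)
    qed
    also have "\<dots> = 2 * d ?n + 2 * d N"
      unfolding d_def by (subst nn_integral_add; (subst nn_integral_cmult)?; (measurable; fail)?)
        (simp add: nn_integral_cmult)
    also have "\<dots> < 1" using M[OF N] .
    finally have "ennreal (?c / (4 * real ?n)) < ennreal 1" unfolding ennreal_1 .
    hence "?c / (4 * real ?n) < 1" by (subst (asm) ennreal_less_iff) simp_all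
    hence "?c < 4 * real ?n" by (simp add: field_simps)
    \<comment> \<open>The square root is weakened to a linear bound, because the series of
      \<open>(n + 1) * r^n\<close> has a closed form.\<close>
    also have "\<dots> \<le> (2 * real (Suc ?n))\<^sup>2" by (simp add: power2_eq_square algebra_simps)
    finally have "?c \<le> (2 * real (Suc ?n))\<^sup>2" by (rule less_imp_le)
    thus ?thesis by (rule power2_le_imp_le) simp
  qed
  define C where "C = 2 + (\<Sum>n\<le>M. norm (lag_coef k n))"
  have C2: "2 \<le> C" by (simp add: C_def sum_nonneg)
  have "norm (lag_coef k n) \<le> C * real (Suc n)" for n
  proof (cases "n \<le> M")
    case True
    have "norm (lag_coef k n) \<le> (\<Sum>n\<le>M. norm (lag_coef k n))"
      using True by (intro member_le_sum) auto
    also have "\<dots> \<le> C * 1" by (simp add: C_def)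
    also have "\<dots> \<le> C * real (Suc n)" using C2 by (intro mult_left_mono) auto
    finally show ?thesis .
  next
    case False
    then obtain N where N: "n = Suc N" "M \<le> N" by (cases n) auto
    have "norm (lag_coef k n) \<le> 2 * real (Suc n)" using bound[OF N(2)] N by simp
    also have "\<dots> \<le> C * real (Suc n)" using C2 by (intro mult_right_mono) auto
    finally show ?thesis .
  qed
  thus thesis using that[of C] C2 by auto
qed

text \<open>For \<open>z = (s - 1) / s\<close> on \<open>Re s = 1/2 + \<delta>\<close> one has
  \<open>\<bar>s\<bar>^2 - \<bar>s - 1\<bar>^2 = 2 \<delta>\<close>, hence
  \<open>1 - \<bar>z\<bar> \<ge> \<delta> / \<bar>s\<bar>^2\<close>. The majorant
  \<open>sum (n + 1) \<bar>z\<bar>^n = (1 - \<bar>z\<bar>)^(-2)\<close> is then at most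
  \<open>\<bar>s\<bar>^4 / \<delta>^2\<close>, which is the origin of the exponent 4.\<close>

lemma zeta_power_bound_from_coefs:
  assumes k: "1 \<le> k" and C: "0 \<le> C" "\<And>n. norm (lag_coef k n) \<le> C * real (Suc n)" and \<delta>: "0 < \<delta>"
  obtains K where "1 \<le> K" "\<And>t. 1 \<le> \<bar>t\<bar> \<Longrightarrow> norm (zeta (Complex (1/2 + \<delta>) t)) ^ k \<le> K * \<bar>t\<bar> ^ 4"
proof -
  obtain E where E: 
    "\<And>w. w \<noteq> 0 \<Longrightarrow> E w = zeta (1 + w) ^ k - (\<Sum>i<k. lam i k / fact i / w ^ (k - i)) - quot_coef k (k - 1)"
    "\<And>z. norm z < 1 \<Longrightarrow> (\<lambda>n. lag_coef k n * z ^ n) sums E (z / (1 - z))"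
    by (rule regularised_zeta_power[OF k]) blast
  define A where "A = (\<Sum>i<k. norm (lam i k / fact i)) + norm (quot_coef k (k - 1))"
  define K where "K = C * (2 + \<delta>) ^ 4 / \<delta>\<^sup>2 + A + 1"
  have A0: "0 \<le> A" by (auto simp: A_def intro!: add_nonneg_nonneg sum_nonneg)
  have "norm (zeta (Complex (1/2 + \<delta>) t)) ^ k \<le> K * \<bar>t\<bar> ^ 4" if t: "1 \<le> \<bar>t\<bar>" for t
  proof -
    define s where "s = Complex (1/2 + \<delta>) t"
    define w where "w = s - 1"
    define z where "z = w / s"
    have s0: "s \<noteq> 0" using t by (auto simp: s_def complex_eq_iff)
    have w1: "1 \<le> norm w" using t abs_Im_le_cmod[of w] by (simp add: w_def s_def)
    have w0: "w \<noteq> 0" using w1 by auto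
    have "1 - z = 1 / s" using s0 by (simp add: z_def w_def diff_divide_distrib)
    hence zw: "z / (1 - z) = w" using s0 by (simp add: z_def)
    have n2: "(norm s)\<^sup>2 - (norm w)\<^sup>2 = 2 * \<delta>"
      by (simp add: s_def w_def cmod_power2) (simp add: power2_eq_square algebra_simps)
    have "1 - (norm z)\<^sup>2 = 2 * \<delta> / (norm s)\<^sup>2"
    proof -
      have "(norm z)\<^sup>2 = (norm w)\<^sup>2 / (norm s)\<^sup>2" by (simp add: z_def norm_divide power_divide)
      moreover have "1 = (norm s)\<^sup>2 / (norm s)\<^sup>2" using s0 by simp
      ultimately have "1 - (norm z)\<^sup>2 = ((norm s)\<^sup>2 - (norm w)\<^sup>2) / (norm s)\<^sup>2" by (simp add: diff_divide_distrib)
      thus ?thesis by (simp only: n2)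
    qed
    hence n3: "(1 - norm z) * (1 + norm z) = 2 * \<delta> / (norm s)\<^sup>2" by (simp add: power2_eq_square algebra_simps)
    have pos: "0 < 2 * \<delta> / (norm s)\<^sup>2" using \<delta> s0 by simp
    have z1: "norm z < 1"
    proof (rule ccontr)
      assume "\<not> norm z < 1"
      hence "(1 - norm z) * (1 + norm z) \<le> 0" by (intro mult_nonpos_nonneg) auto
      thus False using n3 pos by linarith
    qed
    have lower: "\<delta> / (norm s)\<^sup>2 \<le> 1 - norm z"
    proof -
      have "2 * \<delta> / (norm s)\<^sup>2 \<le> (1 - norm z) * 2" unfolding n3[symmetric] using z1 by (intro mult_left_mono) auto
      thus ?thesis by simp
    qed
    have sm: "(\<lambda>n. C * (of_nat (Suc n) * norm z ^ n)) sums (C * (1 / (1 - norm z)\<^sup>2))"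
      using geometric_deriv_sums[of "norm z"] z1 by (intro sums_mult) auto
    have "norm (E w) \<le> C * (1 / (1 - norm z)\<^sup>2)"
    proof -
      have "norm (\<Sum>n. lag_coef k n * z ^ n) \<le> (\<Sum>n. C * (of_nat (Suc n) * norm z ^ n))"
      proof (rule norm_suminf_le)
        fix n show "norm (lag_coef k n * z ^ n) \<le> C * (of_nat (Suc n) * norm z ^ n)"
          using mult_right_mono[OF C(2)[of n], of "norm z ^ n"] by (simp add: norm_mult norm_power mult_ac)
      qed (use sm in \<open>simp add: sums_iff\<close>)
      thus ?thesis using sm E(2)[OF z1] by (simp add: sums_iff zw)
    qed
    also have "\<dots> \<le> C * (1 / (\<delta> / (norm s)\<^sup>2)\<^sup>2)"
      using lower \<delta> s0 C(1) z1 by (intro mult_left_mono divide_left_mono power_mono mult_pos_pos) auto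
    also have "\<dots> = C * (norm s) ^ 4 / \<delta>\<^sup>2"
      using \<delta> by (simp add: power_divide)
    also have "\<dots> \<le> C * ((2 + \<delta>) * \<bar>t\<bar>) ^ 4 / \<delta>\<^sup>2"
    proof -
      have "norm s \<le> (2 + \<delta>) * \<bar>t\<bar>"
        using norm_le_Im[of s "1 + \<delta>"] t \<delta> by (simp add: s_def)
      thus ?thesis using C(1) \<delta> by (intro divide_right_mono mult_left_mono power_mono) auto
    qed
    finally have nE: "norm (E w) \<le> C * (2 + \<delta>) ^ 4 / \<delta>\<^sup>2 * \<bar>t\<bar> ^ 4"
      by (simp add: power_mult_distrib mult_ac)
    have t4: "1 \<le> \<bar>t\<bar> ^ 4" by (rule one_le_power[OF t])
    have "zeta s ^ k = E w + (\<Sum>i<k. lam i k / fact i / w ^ (k - i)) + quot_coef k (k - 1)"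
      using E(1)[OF w0] by (simp add: w_def)
    hence "norm (zeta s) ^ k \<le> norm (E w) + norm (\<Sum>i<k. lam i k / fact i / w ^ (k - i)) + norm (quot_coef k (k - 1))"
      unfolding norm_power[symmetric]
      by (simp only:) (intro order_trans[OF norm_triangle_ineq] add_mono norm_triangle_ineq order_refl)
    also have "norm (\<Sum>i<k. lam i k / fact i / w ^ (k - i)) \<le> (\<Sum>i<k. norm (lam i k / fact i))"
      using w1 by (rule norm_principal_part_le)
    finally have "norm (zeta s) ^ k \<le> norm (E w) + A" by (simp add: A_def)
    also have "\<dots> \<le> C * (2 + \<delta>) ^ 4 / \<delta>\<^sup>2 * \<bar>t\<bar> ^ 4 + (A + 1) * \<bar>t\<bar> ^ 4"
      using nE A0 t4 mult_mono[of A "A + 1" 1 "\<bar>t\<bar> ^ 4"] by simp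
    also have "\<dots> = K * \<bar>t\<bar> ^ 4" by (simp add: K_def algebra_simps)
    finally show ?thesis by (simp add: s_def)
  qed
  moreover have "1 \<le> K" using A0 C(1) by (simp add: K_def)
  ultimately show thesis using that by blast
qed

lemma lindelof_if_L2_convergence:
  assumes "\<And>k. 1 \<le> k \<Longrightarrow> (\<lambda>N. \<integral>\<^sup>+ x\<in>{0..}. ennreal ((cmod (phi_N N k x - phi k x))\<^sup>2) \<partial>lborel) \<longlonglongrightarrow> 0"
  shows "lindelof_hypothesis"
proof (rule lindelof_if_right_of_line)
  fix \<delta> e :: real assume \<delta>: "0 < \<delta>" and e: "0 < e"
  \<comment> \<open>Taking the \<open>k\<close>-th root turns the exponent 4 into
    \<open>4 / k\<close>, which is below \<open>e\<close>.\<close>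
  obtain k :: nat where k0: "4 / e < real k" using reals_Archimedean2 by blast
  have k1: "1 \<le> k" using k0 e by (cases k) (auto simp: field_simps)
  have k4: "4 \<le> e * real k" using k0 e by (simp add: field_simps)
  obtain C where C: "0 \<le> C" "\<And>n. norm (lag_coef k n) \<le> C * real (Suc n)"
    using lag_coef_linear_bound[OF assms[OF k1]] by blast
  obtain K where K: "1 \<le> K" "\<And>t. 1 \<le> \<bar>t\<bar> \<Longrightarrow> norm (zeta (Complex (1/2 + \<delta>) t)) ^ k \<le> K * \<bar>t\<bar> ^ 4"
    using zeta_power_bound_from_coefs[OF k1 C \<delta>] by blast
  have "norm (zeta (Complex (1/2 + \<delta>) t)) \<le> K * \<bar>t\<bar> powr e" if t: "1 \<le> \<bar>t\<bar>" for t
  proof (rule power_le_imp_le_base)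
    have "norm (zeta (Complex (1/2 + \<delta>) t)) ^ Suc (k - 1) \<le> K * \<bar>t\<bar> ^ 4" using K(2)[OF t] k1 by simp
    also have "\<bar>t\<bar> ^ 4 = \<bar>t\<bar> powr 4" using t powr_realpow[of "\<bar>t\<bar>" 4] by simp
    also have "\<dots> \<le> \<bar>t\<bar> powr (e * real k)" using t k4 by (intro powr_mono) auto
    \<comment> \<open>Thanks to \<open>1 \<le> K\<close> the constant may be raised to the
      \<open>k\<close>-th power before taking roots.\<close>
    also have "K * \<dots> \<le> K ^ k * \<dots>" using K(1) k1 self_le_power[of K k] by (intro mult_right_mono) auto
    also have "\<dots> = (K * \<bar>t\<bar> powr e) ^ k" using t by (simp add: power_mult_distrib powr_power mult.commute)
    finally show "norm (zeta (Complex (1/2 + \<delta>) t)) ^ Suc (k - 1) \<le> (K * \<bar>t\<bar> powr e) ^ Suc (k - 1)"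
      using k1 K(1) by simp
  qed (use K(1) in auto)
  thus "\<exists>C. \<forall>t. 1 \<le> \<bar>t\<bar> \<longrightarrow> norm (zeta (Complex (1/2 + \<delta>) t)) \<le> C * \<bar>t\<bar> powr e" by blast
qed

section \<open>Summatory functions of generalised divisor functions\<close>

text \<open>\<open>Tsum\<close> and \<open>Tint\<close> are multiplicative convolution with counting and Lebesgue measure on \<open>[1, \<infinity>)\<close>.
  They commute, the summatory function of \<open>d\<^sub>k\<close> is the \<open>k\<close>-th \<open>Tsum\<close>-iterate of the unit step, and
  expanding \<open>Tsum = Tint + Tdiff\<close> produces the main term, because iterates of \<open>Tdiff\<close> on the unit step save a
  power of \<open>x\<close> while \<open>Tint\<close> only contributes polynomials in \<open>ln x\<close>.\<close>

definition Tsum :: "(real \<Rightarrow> real) \<Rightarrow> real \<Rightarrow> real" where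
  "Tsum f x = (\<Sum>n=1..nat \<lfloor>x\<rfloor>. f (x / real n))"

abbreviation sqwt :: "(real \<Rightarrow> real) \<Rightarrow> real \<Rightarrow> real" where
  "sqwt f \<equiv> \<lambda>v. f v / v\<^sup>2"

text \<open>The substitution \<open>v = x / t\<close> turns the convolution integral of
  \<open>f (x / t)\<close> over \<open>t \<ge> 1\<close> into this form. Starting at 0 is harmless
  since the functions considered vanish below 1.\<close>

definition Tint :: "(real \<Rightarrow> real) \<Rightarrow> real \<Rightarrow> real" where
  "Tint f x = x * integral {0..x} (sqwt f)"

definition Tdiff :: "(real \<Rightarrow> real) \<Rightarrow> real \<Rightarrow> real" where
  "Tdiff f x = Tsum f x - Tint f x"

text \<open>A class stable under \<open>Tsum\<close> and \<open>Tint\<close>: the arbitrarily small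
  \<open>e\<close> absorbs the logarithms that each application creates, and monotonicity yields
  both measurability and the integral test.\<close>

definition cumulative :: "(real \<Rightarrow> real) \<Rightarrow> bool" where
  "cumulative f \<longleftrightarrow> mono f \<and> (\<forall>x<1. f x = 0) \<and> (\<forall>e>0. \<exists>C. \<forall>x\<ge>1. f x \<le> C * x powr (1 + e))"

lemma cumulativeD:
  assumes "cumulative f"
  shows "x \<le> y \<Longrightarrow> f x \<le> f y" "x < 1 \<Longrightarrow> f x = 0" "0 \<le> f x"
    and "0 < e \<Longrightarrow> \<exists>C\<ge>0. \<forall>x\<ge>1. f x \<le> C * x powr (1 + e)"
proof -
  show mono: "f x \<le> f y" if "x \<le> y" for x y using assms that by (auto simp: cumulative_def mono_def)
  show "x < 1 \<Longrightarrow> f x = 0" using assms by (auto simp: cumulative_def)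
  show "0 \<le> f x" using mono[of "min 0 x" x] assms by (auto simp: cumulative_def)
  assume "0 < e"
  then obtain C where C: "\<forall>x\<ge>1. f x \<le> C * x powr (1 + e)" using assms by (auto simp: cumulative_def)
  have "f x \<le> \<bar>C\<bar> * x powr (1 + e)" if "1 \<le> x" for x
    using C that by (intro order_trans[OF C[rule_format, OF that]] mult_right_mono) auto
  thus "\<exists>C\<ge>0. \<forall>x\<ge>1. f x \<le> C * x powr (1 + e)" by (intro exI[of _ "\<bar>C\<bar>"]) auto
qed

lemma borel_bounded_integrable:
  fixes f :: "real \<Rightarrow> real"
  assumes "f \<in> borel_measurable borel" "\<And>v. v \<in> {a..b} \<Longrightarrow> \<bar>f v\<bar> \<le> B"
  shows "f integrable_on {a..b}"
proof (rule measurable_bounded_by_integrable_imp_integrable)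
  show "f \<in> borel_measurable (lebesgue_on {a..b})"
    using assms(1) by (intro measurable_restrict_space1 measurable_completion) simp
  show "(\<lambda>_. B) integrable_on {a..b}" by (rule integrable_const_ivl)
qed (use assms(2) in auto)

lemma cumulative_integrable:
  assumes f: "cumulative f"
  shows "(sqwt f) integrable_on {a..b}"
proof (rule borel_bounded_integrable)
  have [measurable]: "f \<in> borel_measurable borel"
    using f by (intro borel_measurable_mono) (auto simp: cumulative_def)
  show "(sqwt f) \<in> borel_measurable borel" by measurable
  fix v assume v: "v \<in> {a..b}"
  show "\<bar>f v / v\<^sup>2\<bar> \<le> f b"
  proof (cases "v < 1")
    case True thus ?thesis using cumulativeD[OF f] by simp
  next
    case False
    hence "f v / v\<^sup>2 \<le> f v / 1" using cumulativeD(3)[OF f] by (intro divide_left_mono) auto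
    also have "\<dots> \<le> f b" using v cumulativeD(1)[OF f] by auto
    finally show ?thesis using cumulativeD(3)[OF f] by simp
  qed
qed

lemma cumulative_add: "cumulative f \<Longrightarrow> cumulative g \<Longrightarrow> cumulative (\<lambda>x. f x + g x)"
  unfolding cumulative_def
proof (intro conjI allI impI; (elim conjE)?)
  fix e :: real assume e: "0 < e" and "\<forall>e>0. \<exists>C. \<forall>x\<ge>1. f x \<le> C * x powr (1 + e)" "\<forall>e>0. \<exists>C. \<forall>x\<ge>1. g x \<le> C * x powr (1 + e)"
  then obtain C1 C2 where "\<forall>x\<ge>1. f x \<le> C1 * x powr (1 + e)" "\<forall>x\<ge>1. g x \<le> C2 * x powr (1 + e)" by meson
  thus "\<exists>C. \<forall>x\<ge>1. f x + g x \<le> C * x powr (1 + e)"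
    by (intro exI[of _ "C1 + C2"]) (auto simp: distrib_right intro!: add_mono)
qed (auto simp: mono_def intro!: add_mono)

lemma cumulative_Tsum:
  assumes f: "cumulative f" shows "cumulative (Tsum f)"
  unfolding cumulative_def
proof (intro conjI allI impI)
  show "mono (Tsum f)"
  proof (rule monoI)
    fix x y :: real assume xy: "x \<le> y"
    have "Tsum f x \<le> (\<Sum>n=1..nat \<lfloor>x\<rfloor>. f (y / real n))"
      unfolding Tsum_def using xy by (intro sum_mono cumulativeD[OF f] divide_right_mono) auto
    also have "\<dots> \<le> Tsum f y"
      unfolding Tsum_def using xy by (intro sum_mono2 cumulativeD[OF f]) (auto intro: order_trans nat_mono floor_mono)
    finally show "Tsum f x \<le> Tsum f y" .
  qed
  show "Tsum f x = 0" if "x < 1" for x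
  proof -
    have "nat \<lfloor>x\<rfloor> = 0" using that by linarith
    thus ?thesis by (simp add: Tsum_def)
  qed
  fix e :: real assume e: "0 < e"
  obtain C where C: "0 \<le> C" "\<forall>x\<ge>1. f x \<le> C * x powr (1 + e)" using cumulativeD(4)[OF f e] by blast
  have sm: "summable (\<lambda>n. real n powr (-(1 + e)))" using e by (simp add: summable_real_powr_iff)
  show "\<exists>C. \<forall>x\<ge>1. Tsum f x \<le> C * x powr (1 + e)"
  proof (intro exI allI impI)
    fix x :: real assume x: "1 \<le> x"
    have "Tsum f x \<le> (\<Sum>n=1..nat \<lfloor>x\<rfloor>. C * x powr (1 + e) * real n powr (-(1 + e)))"
      unfolding Tsum_def
    proof (intro sum_mono)
      fix n assume n: "n \<in> {1..nat \<lfloor>x\<rfloor>}"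
      have "real n \<le> x" "1 \<le> real n" using n x by (auto simp: le_nat_iff le_floor_iff)
      hence "f (x / real n) \<le> C * (x / real n) powr (1 + e)" by (intro C(2)[rule_format]) (auto simp: field_simps)
      also have "(x / real n) powr (1 + e) = x powr (1 + e) * real n powr (-(1 + e))"
        using x n powr_minus_divide[of "real n" "1 + e"] by (simp add: powr_divide)
      finally show "f (x / real n) \<le> C * x powr (1 + e) * real n powr (-(1 + e))" by (simp add: mult_ac)
    qed
    also have "\<dots> = C * x powr (1 + e) * (\<Sum>n=1..nat \<lfloor>x\<rfloor>. real n powr (-(1 + e)))"
      by (simp only: sum_distrib_left)
    also have "\<dots> \<le> C * x powr (1 + e) * (\<Sum>n. real n powr (-(1 + e)))"
      using C(1) by (intro mult_left_mono sum_le_suminf sm) auto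
    finally show "Tsum f x \<le> (C * (\<Sum>n. real n powr (-(1 + e)))) * x powr (1 + e)" by (simp only: mult_ac)
  qed
qed

lemma integral_powr_le:
  fixes x a :: real
  assumes "0 < a" "1 \<le> x"
  shows "integral {1..x} (\<lambda>v. v powr (a - 1)) \<le> x powr a / a"
proof -
  have "((\<lambda>v. v powr (a - 1)) has_integral (x powr a / a - 1 powr a / a)) {1..x}"
    using assms by (intro fundamental_theorem_of_calculus)
      (auto simp: has_real_derivative_iff_has_vector_derivative[symmetric] intro!: derivative_eq_intros)
  thus ?thesis using assms by (simp add: integral_unique)
qed

lemma cumulative_integral_from_1:
  assumes "cumulative f" "1 \<le> x"
  shows "integral {0..x} (sqwt f) = integral {1..x} (sqwt f)"
proof -
  have "integral {0..1} (sqwt f) = integral {0..1} (\<lambda>v::real. 0::real)"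
    by (rule integral_spike[of "{1}"]) (use cumulativeD(2)[OF assms(1)] in auto)
  moreover have "integral {0..1} (sqwt f) + integral {1..x} (sqwt f) = integral {0..x} (sqwt f)"
    using assms by (intro Henstock_Kurzweil_Integration.integral_combine cumulative_integrable) auto
  ultimately show ?thesis by simp
qed

lemma cumulative_Tint:
  assumes f: "cumulative f" shows "cumulative (Tint f)"
  unfolding cumulative_def
proof (intro conjI allI impI)
  have nn: "0 \<le> f v / v\<^sup>2" for v using cumulativeD(3)[OF f] by simp
  have z: "Tint f x = 0" if "x < 1" for x
  proof -
    have "integral {0..x} (sqwt f) = integral {0..x} (\<lambda>v. 0)"
      using that by (intro integral_cong) (auto simp: cumulativeD(2)[OF f])
    thus ?thesis by (simp add: Tint_def)
  qed
  show "Tint f x = 0" if "x < 1" for x using z that .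
  show "mono (Tint f)"
  proof (rule monoI)
    fix x y :: real assume xy: "x \<le> y"
    show "Tint f x \<le> Tint f y"
    proof (cases "x < 1")
      case True
      have "0 \<le> Tint f y"
      proof (cases "y < 1")
        case False
        thus ?thesis unfolding Tint_def
          by (intro mult_nonneg_nonneg integral_nonneg cumulative_integrable f nn) auto
      qed (simp add: z)
      thus ?thesis using True z by simp
    next
      case False
      have "integral {0..x} (sqwt f) \<le> integral {0..y} (sqwt f)"
        using xy nn by (intro integral_subset_le cumulative_integrable f) auto
      thus ?thesis unfolding Tint_def using False xy nn
        by (intro mult_mono integral_nonneg cumulative_integrable f) auto
    qed
  qed
  fix e :: real assume e: "0 < e"
  obtain C where C: "0 \<le> C" "\<forall>x\<ge>1. f x \<le> C * x powr (1 + e)" using cumulativeD(4)[OF f e] by blast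
  show "\<exists>C. \<forall>x\<ge>1. Tint f x \<le> C * x powr (1 + e)"
  proof (intro exI allI impI)
    fix x :: real assume x: "1 \<le> x"
    have pw: "(\<lambda>v. v powr (e - 1)) integrable_on {1..x}"
      by (intro integrable_continuous_real continuous_intros) auto
    have "integral {0..x} (sqwt f) \<le> integral {1..x} (\<lambda>v. C * v powr (e - 1))"
      unfolding cumulative_integral_from_1[OF f x]
    proof (intro integral_le cumulative_integrable f)
      fix v assume v: "v \<in> {1..x}"
      have "f v / v\<^sup>2 \<le> C * v powr (1 + e) / v\<^sup>2" using v C(2) by (intro divide_right_mono) auto
      also have "\<dots> = C * v powr (e - 1)"
        using v by (simp add: powr_add powr_diff power2_eq_square)
      finally show "f v / v\<^sup>2 \<le> C * v powr (e - 1)" .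
    qed (use pw in \<open>auto intro!: integrable_on_mult_right\<close>)
    also have "\<dots> \<le> C * (x powr e / e)"
      using e x C(1) by (subst integral_mult_right) (intro mult_left_mono integral_powr_le)
    finally have "Tint f x \<le> x * (C * (x powr e / e))" unfolding Tint_def using x by (intro mult_left_mono) auto
    also have "\<dots> = C / e * x powr (1 + e)" using x by (simp add: powr_add)
    finally show "Tint f x \<le> C / e * x powr (1 + e)" .
  qed
qed

text \<open>Rescaling \<open>v\<close> by \<open>n\<close> handles a single summand. Since
  \<open>f\<close> vanishes below 1, the summation range can be frozen at the integer part of
  \<open>x\<close>, which leaves a finite sum to exchange with the integral.\<close>

lemma Tsum_Tint_commute:
  assumes f: "cumulative f"
  shows "Tsum (Tint f) x = Tint (Tsum f) x"
proof (cases "x < 1")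
  case True
  thus ?thesis using cumulativeD(2)[OF cumulative_Tsum[OF cumulative_Tint[OF f]]]
     cumulativeD(2)[OF cumulative_Tint[OF cumulative_Tsum[OF f]]] by simp
next
  case False
  let ?M = "nat \<lfloor>x\<rfloor>"
  have hi: "((\<lambda>v. f (v / real n) / v\<^sup>2) has_integral (1 / real n) * integral {0..x / real n} (sqwt f)) {0..x}"
    if n: "n \<in> {1..?M}" for n
  proof -
    have n0: "0 < real n" using n by auto
    have "((sqwt f) has_integral integral {0..x / real n} (sqwt f)) {0..x / real n}"
      by (intro integrable_integral cumulative_integrable f)
    from has_integral_stretch_real[OF this, of "1 / real n"]
    have "((\<lambda>v. f (v / real n) / (v / real n)\<^sup>2) has_integral real n * integral {0..x / real n} (sqwt f)) ((\<lambda>v. v * real n) ` {0..x / real n})"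
      using n0 by simp
    also have "(\<lambda>v. v * real n) ` {0..x / real n} = {0..x}"
      using n0 False by (subst image_mult_atLeastAtMost_if') auto
    finally have "((\<lambda>v. (1 / real n)\<^sup>2 * (f (v / real n) / (v / real n)\<^sup>2)) has_integral (1 / real n)\<^sup>2 * (real n * integral {0..x / real n} (sqwt f))) {0..x}"
      by (rule has_integral_mult_right)
    moreover have "(1 / real n)\<^sup>2 * (f (v / real n) / (v / real n)\<^sup>2) = f (v / real n) / v\<^sup>2" for v
      using n0 by (simp add: power_divide)
    moreover have "(1 / real n)\<^sup>2 * (real n * integral {0..x / real n} (sqwt f)) = (1 / real n) * integral {0..x / real n} (sqwt f)"
      using n0 by (simp add: power2_eq_square)
    ultimately show ?thesis by simp
  qed
  have "((\<lambda>v. \<Sum>n=1..?M. f (v / real n) / v\<^sup>2) has_integral (\<Sum>n=1..?M. (1 / real n) * integral {0..x / real n} (sqwt f))) {0..x}"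
    by (intro has_integral_sum hi) auto
  hence "((\<lambda>v. Tsum f v / v\<^sup>2) has_integral (\<Sum>n=1..?M. (1 / real n) * integral {0..x / real n} (sqwt f))) {0..x}"
  proof (rule has_integral_eq[rotated])
    fix v assume v: "v \<in> {0..x}"
    have "Tsum f v = (\<Sum>n=1..?M. f (v / real n))"
      unfolding Tsum_def
    proof (rule sum.mono_neutral_left)
      show "{1..nat \<lfloor>v\<rfloor>} \<subseteq> {1..?M}" using v by (auto intro: order_trans nat_mono floor_mono)
      show "\<forall>i\<in>{1..?M} - {1..nat \<lfloor>v\<rfloor>}. f (v / real i) = 0"
      proof
        fix i assume i: "i \<in> {1..?M} - {1..nat \<lfloor>v\<rfloor>}"
        hence "v < real i" using v by (auto simp: not_le) linarith
        thus "f (v / real i) = 0" using i by (intro cumulativeD(2)[OF f]) auto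
      qed
    qed auto
    thus "(\<Sum>n=1..?M. f (v / real n) / v\<^sup>2) = Tsum f v / v\<^sup>2" by (simp add: sum_divide_distrib)
  qed
  hence "Tint (Tsum f) x = x * (\<Sum>n=1..?M. (1 / real n) * integral {0..x / real n} (sqwt f))"
    by (simp add: Tint_def integral_unique)
  also have "\<dots> = Tsum (Tint f) x"
    by (simp add: Tsum_def Tint_def sum_distrib_left)
  finally show ?thesis by simp
qed

text \<open>The integral of \<open>x / v\<^sup>2\<close> from \<open>x / (n+1)\<close> to
  \<open>x / n\<close> equals 1, so by monotonicity \<open>G n - G (Suc n)\<close> lies between
  \<open>f (x / (n+1))\<close> and \<open>f (x / n)\<close>. Summing telescopes, and only the
  boundary term at \<open>N\<close> remains as error.\<close>

lemma Tsum_tail_approx: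
  assumes f: "cumulative f" and N: "1 \<le> N" "real N \<le> x"
  shows "\<bar>(\<Sum>n\<in>{N<..nat \<lfloor>x\<rfloor>}. f (x / real n)) - x * integral {0..x / real N} (sqwt f)\<bar> \<le> f (x / real N)"
proof -
  let ?M = "nat \<lfloor>x\<rfloor>"
  define G where "G n = x * integral {0..x / real n} (sqwt f)" for n :: nat
  have x: "1 \<le> x" using N by linarith
  have NM: "N \<le> ?M" using N by (simp add: le_nat_iff le_floor_iff)
  have step: "f (x / real (Suc n)) \<le> G n - G (Suc n)" "G n - G (Suc n) \<le> f (x / real n)" if n: "1 \<le> n" for n
  proof -
    let ?a = "x / real (Suc n)" and ?b = "x / real n"
    have ab: "0 < ?a" "?a \<le> ?b" using x n by (auto simp: field_simps)
    have "integral {0..?a} (sqwt f) + integral {?a..?b} (sqwt f) = integral {0..?b} (sqwt f)"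
      using ab by (intro Henstock_Kurzweil_Integration.integral_combine cumulative_integrable f) auto
    hence eq: "G n - G (Suc n) = x * integral {?a..?b} (sqwt f)"
      by (simp add: G_def algebra_simps flip: distrib_left)
    have hi: "((\<lambda>v. c / v\<^sup>2) has_integral c / x) {?a..?b}" for c
    proof -
      have "((\<lambda>v. c / v\<^sup>2) has_integral (- c / ?b - (- c / ?a))) {?a..?b}"
        using ab by (intro fundamental_theorem_of_calculus)
          (auto simp: has_real_derivative_iff_has_vector_derivative[symmetric] power2_eq_square intro!: derivative_eq_intros)
      moreover have "- c / ?b - (- c / ?a) = c / x" using x n by (simp add: field_simps)
      ultimately show ?thesis by metis
    qed
    have "f ?a / x \<le> integral {?a..?b} (sqwt f)"
      using hi[of "f ?a"] ab
      by (intro has_integral_le[OF hi integrable_integral[OF cumulative_integrable[OF f]]] divide_right_mono cumulativeD(1)[OF f]) auto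
    moreover have "integral {?a..?b} (sqwt f) \<le> f ?b / x"
      by (intro has_integral_le[OF integrable_integral[OF cumulative_integrable[OF f]] hi] divide_right_mono cumulativeD(1)[OF f]) auto
    ultimately show "f ?a \<le> G n - G (Suc n)" "G n - G (Suc n) \<le> f ?b"
      unfolding eq using x by (auto simp: field_simps)
  qed
  have "x < real (Suc ?M)" using x by linarith
  hence "x / real (Suc ?M) < 1" by (simp add: divide_less_eq)
  hence fM: "f (x / real (Suc ?M)) = 0" and "Tint f (x / real (Suc ?M)) = 0"
    by (intro cumulativeD(2)[OF f] cumulativeD(2)[OF cumulative_Tint[OF f]]; simp)+
  moreover have "x / real (Suc ?M) \<noteq> 0" using x by (simp del: of_nat_Suc)
  ultimately have GM: "G (Suc ?M) = 0" unfolding G_def Tint_def by (metis mult_eq_0_iff)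
  have tele: "G N = (\<Sum>n=N..?M. G n - G (Suc n))"
    using sum_Suc_diff[of N ?M "\<lambda>n. - G n"] NM GM by simp
  have ins: "{N..?M} = insert N {N<..?M}" using NM by auto
  have "G N \<le> (\<Sum>n=N..?M. f (x / real n))" unfolding tele using N by (intro sum_mono step) auto
  also have "\<dots> = f (x / real N) + (\<Sum>n\<in>{N<..?M}. f (x / real n))" unfolding ins by simp
  finally have up: "G N \<le> f (x / real N) + (\<Sum>n\<in>{N<..?M}. f (x / real n))" .
  have "(\<Sum>n\<in>{N<..?M}. f (x / real n)) = (\<Sum>n\<in>{Suc N..Suc ?M}. f (x / real n))"
  proof (rule sum.mono_neutral_left)
    show "\<forall>i\<in>{Suc N..Suc ?M} - {N<..?M}. f (x / real i) = 0"
    proof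
      fix i assume "i \<in> {Suc N..Suc ?M} - {N<..?M}"
      hence "i = Suc ?M" by auto
      thus "f (x / real i) = 0" using fM by simp
    qed
  qed auto
  also have "\<dots> = (\<Sum>n=N..?M. f (x / real (Suc n)))" by (rule sum.shift_bounds_cl_Suc_ivl)
  also have "\<dots> \<le> G N" unfolding tele using N by (intro sum_mono step) auto
  finally have "(\<Sum>n\<in>{N<..?M}. f (x / real n)) \<le> G N" .
  thus ?thesis using up unfolding G_def by linarith
qed


text \<open>\<open>Tdiff\<close> destroys monotonicity. Differences of cumulative functions form a
  class stable under all three operators, with two monotone parts still available for the integral
  test.\<close>

definition bicumulative :: "(real \<Rightarrow> real) \<Rightarrow> bool" where
  "bicumulative g \<longleftrightarrow> (\<exists>f1 f2. cumulative f1 \<and> cumulative f2 \<and> g = (\<lambda>x. f1 x - f2 x))"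

lemma Tsum_diff: "Tsum (\<lambda>x. f1 x - f2 x) = (\<lambda>x. Tsum f1 x - Tsum f2 x)"
  by (rule ext) (simp add: Tsum_def sum_subtractf)

lemma bicumulative_integrable: "bicumulative g \<Longrightarrow> (sqwt g) integrable_on {a..b}"
  unfolding bicumulative_def
  by (elim exE conjE) (simp only: diff_divide_distrib, intro integrable_diff cumulative_integrable)

lemma Tint_diff:
  assumes "bicumulative f1" "bicumulative f2"
  shows "Tint (\<lambda>x. f1 x - f2 x) = (\<lambda>x. Tint f1 x - Tint f2 x)"
  by (rule ext) (simp add: Tint_def diff_divide_distrib integral_diff bicumulative_integrable assms right_diff_distrib)

lemma cumulative_0: "cumulative (\<lambda>_. 0)"
  by (auto simp: cumulative_def mono_def intro!: exI[of _ 0])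

lemma cumulative_imp_bicumulative: "cumulative f \<Longrightarrow> bicumulative f"
  unfolding bicumulative_def using cumulative_0 by (intro exI[of _ f] exI[of _ "\<lambda>_. 0"]) auto

lemma bicumulative_diff:
  assumes "bicumulative f" "bicumulative g" shows "bicumulative (\<lambda>x. f x - g x)"
proof -
  obtain f1 f2 g1 g2 where "cumulative f1" "cumulative f2" "cumulative g1" "cumulative g2"
    "f = (\<lambda>x. f1 x - f2 x)" "g = (\<lambda>x. g1 x - g2 x)"
    using assms unfolding bicumulative_def by blast
  thus ?thesis unfolding bicumulative_def
    by (intro exI[of _ "\<lambda>x. f1 x + g2 x"] exI[of _ "\<lambda>x. f2 x + g1 x"]) (auto intro: cumulative_add)
qed

lemma bicumulative_Tsum: "bicumulative g \<Longrightarrow> bicumulative (Tsum g)"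
  unfolding bicumulative_def using Tsum_diff cumulative_Tsum by metis

lemma bicumulative_Tint:
  assumes "bicumulative g" shows "bicumulative (Tint g)"
proof -
  obtain f1 f2 where f: "cumulative f1" "cumulative f2" "g = (\<lambda>x. f1 x - f2 x)"
    using assms unfolding bicumulative_def by blast
  show ?thesis unfolding f(3)
    by (subst Tint_diff) (intro bicumulative_diff cumulative_imp_bicumulative cumulative_Tint f)+
qed

lemma bicumulative_Tdiff: "bicumulative g \<Longrightarrow> bicumulative (Tdiff g)"
  unfolding Tdiff_def[abs_def] by (intro bicumulative_diff bicumulative_Tsum bicumulative_Tint)

lemma bicumulative_commute:
  assumes "bicumulative g" shows "Tsum (Tint g) = Tint (Tsum g)"
proof -
  obtain f1 f2 where f: "cumulative f1" "cumulative f2" and g: "g = (\<lambda>x. f1 x - f2 x)"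
    using assms unfolding bicumulative_def by blast
  have "Tint g = (\<lambda>x. Tint f1 x - Tint f2 x)" unfolding g
    by (intro Tint_diff cumulative_imp_bicumulative f)
  moreover have "Tint (Tsum g) = (\<lambda>x. Tint (Tsum f1) x - Tint (Tsum f2) x)" unfolding g Tsum_diff
    by (intro Tint_diff cumulative_imp_bicumulative cumulative_Tsum f)
  ultimately show ?thesis by (simp add: Tsum_diff Tsum_Tint_commute f)
qed

lemma Tdiff_Tsum:
  assumes "bicumulative g" shows "Tdiff (Tsum g) = Tsum (Tdiff g)"
  unfolding Tdiff_def[abs_def] Tsum_diff bicumulative_commute[OF assms] ..

text \<open>Hyperbola method: the terms \<open>n \<le> N\<close> are estimated trivially, the remaining ones by the
  integral test for the two monotone parts of \<open>g\<close>.\<close>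

lemma Tdiff_power_saving:
  assumes g: "bicumulative g" and d: "0 < d" "d \<le> 1"
    and C: "\<And>x. 1 \<le> x \<Longrightarrow> \<bar>g x\<bar> \<le> C * x powr (1 - d)"
  shows "\<exists>C'. \<forall>x\<ge>1. \<bar>Tdiff g x\<bar> \<le> C' * x powr (1 - d / 4)"
proof -
  obtain f1 f2 where f: "cumulative f1" "cumulative f2" and gf: "g = (\<lambda>x. f1 x - f2 x)"
    using g unfolding bicumulative_def by blast
  have d4: "0 < d / 4" using d by simp
  obtain B1 where B1: "0 \<le> B1" "\<And>x. 1 \<le> x \<Longrightarrow> f1 x \<le> B1 * x powr (1 + d / 4)" using cumulativeD(4)[OF f(1) d4] by blast
  obtain B2 where B2: "0 \<le> B2" "\<And>x. 1 \<le> x \<Longrightarrow> f2 x \<le> B2 * x powr (1 + d / 4)" using cumulativeD(4)[OF f(2) d4] by blast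
  have C0: "0 \<le> C" using C[of 1] by simp
  define B where "B = (B1 + B2) * 2 powr (1 + d / 4)"
  have B0: "0 \<le> B" using B1 B2 by (simp add: B_def)
  show ?thesis
  proof (intro exI allI impI)
    fix x :: real assume x: "1 \<le> x"
    \<comment> \<open>With this cut-off the trivially estimated terms contribute
      \<open>N * x powr (1 - d)\<close>, at most \<open>x powr (1 - d / 2)\<close>, and the boundary
      terms of size \<open>(x / N) powr (1 + d / 4)\<close> are
      \<open>O(x powr (1 - d / 4))\<close>.\<close>
    define N where "N = nat \<lfloor>x powr (d / 2)\<rfloor>"
    let ?M = "nat \<lfloor>x\<rfloor>" and ?X = "x powr (1 - d / 4)" and ?J = "\<lambda>f. integral {0..x / real N} (sqwt f)"
    have px: "1 \<le> x powr (d / 2)" using x d by (intro ge_one_powr_ge_zero) auto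
    have N1: "1 \<le> N" using px by (simp add: N_def le_nat_iff le_floor_iff)
    have Nle: "real N \<le> x powr (d / 2)" using px by (simp add: N_def)
    have Nge: "x powr (d / 2) \<le> 2 * real N"
    proof -
      have "x powr (d / 2) < real N + 1" using px by (simp add: N_def)
      thus ?thesis using N1 by linarith
    qed
    have "x powr (d / 2) \<le> x powr 1" using x d by (intro powr_mono) auto
    hence Nx: "real N \<le> x" using Nle x by simp
    have NM: "N \<le> ?M" using Nx by (simp add: le_nat_iff le_floor_iff)
    have main: "Tdiff g x = (\<Sum>n=1..N. g (x / real n))
        + ((\<Sum>n\<in>{N<..?M}. f1 (x / real n)) - x * ?J f1)
        - ((\<Sum>n\<in>{N<..?M}. f2 (x / real n)) - x * ?J f2)
        - x * integral {x / real N..x} (sqwt g)"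
    proof -
      have "{1..?M} = {1..N} \<union> {N<..?M}" using NM N1 by auto
      hence "Tsum g x = (\<Sum>n=1..N. g (x / real n)) + (\<Sum>n\<in>{N<..?M}. g (x / real n))"
        unfolding Tsum_def by (simp only:) (rule sum.union_disjoint; auto)
      moreover have "(\<Sum>n\<in>{N<..?M}. g (x / real n)) = (\<Sum>n\<in>{N<..?M}. f1 (x / real n)) - (\<Sum>n\<in>{N<..?M}. f2 (x / real n))"
        unfolding gf by (rule sum_subtractf)
      moreover have "?J g + integral {x / real N..x} (sqwt g) = integral {0..x} (sqwt g)"
        using x N1 by (intro Henstock_Kurzweil_Integration.integral_combine bicumulative_integrable g) (auto simp: divide_le_eq)
      hence "Tint g x = x * ?J g + x * integral {x / real N..x} (sqwt g)"
        by (simp add: Tint_def flip: distrib_left)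
      moreover have "?J g = ?J f1 - ?J f2"
        unfolding gf diff_divide_distrib by (intro integral_diff cumulative_integrable f)
      ultimately show ?thesis by (simp add: Tdiff_def algebra_simps)
    qed
    have gx: "\<bar>g v\<bar> \<le> C * x powr (1 - d)" if "1 \<le> v" "v \<le> x" for v
    proof -
      have "v powr (1 - d) \<le> x powr (1 - d)" using that d by (intro powr_mono2) auto
      thus ?thesis using C[OF that(1)] mult_left_mono[OF _ C0] by (meson order_trans)
    qed
    have e1: "x powr (1 - d) * real N \<le> ?X"
    proof -
      have "x powr (1 - d) * real N \<le> x powr (1 - d) * x powr (d / 2)" using Nle by (intro mult_left_mono) auto
      also have "\<dots> = x powr (1 - d / 2)" using x by (simp add: powr_add[symmetric])
      also have "\<dots> \<le> ?X" using x d by (intro powr_mono) auto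
      finally show ?thesis .
    qed
    have s1: "\<bar>\<Sum>n=1..N. g (x / real n)\<bar> \<le> C * ?X"
    proof -
      have "\<bar>\<Sum>n=1..N. g (x / real n)\<bar> \<le> (\<Sum>n=1..N. C * x powr (1 - d))"
      proof (intro order_trans[OF sum_abs] sum_mono gx)
        fix n assume n: "n \<in> {1..N}"
        have "real n \<le> x" using n Nx by (auto intro: order_trans[OF of_nat_mono])
        thus "1 \<le> x / real n" "x / real n \<le> x" using n x by (auto simp: field_simps)
      qed
      also have "\<dots> = C * (x powr (1 - d) * real N)" by simp
      also have "\<dots> \<le> C * ?X" using e1 C0 by (intro mult_left_mono)
      finally show ?thesis .
    qed
    have s2: "\<bar>x * integral {x / real N..x} (sqwt g)\<bar> \<le> C * ?X"
    proof -
      let ?D = "C * x powr (1 - d)"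
      have xN: "1 \<le> x / real N" "x / real N \<le> x" using N1 Nx x by (auto simp: field_simps)
      have hi: "((\<lambda>v. ?D / v\<^sup>2) has_integral (- ?D / x - (- ?D / (x / real N)))) {x / real N..x}"
        using xN by (intro fundamental_theorem_of_calculus)
          (auto simp: has_real_derivative_iff_has_vector_derivative[symmetric] power2_eq_square intro!: derivative_eq_intros)
      have "\<bar>integral {x / real N..x} (sqwt g)\<bar> \<le> integral {x / real N..x} (\<lambda>v. ?D / v\<^sup>2)"
      proof (rule integral_norm_bound_integral[where f = "\<lambda>v. g v / v\<^sup>2", unfolded real_norm_def])
        show "\<bar>g v / v\<^sup>2\<bar> \<le> ?D / v\<^sup>2" if "v \<in> {x / real N..x}" for v
          using gx[of v] that xN by (auto simp: abs_div intro!: divide_right_mono)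
      qed (use hi bicumulative_integrable[OF g] in \<open>auto simp: integrable_on_def\<close>)
      also have "\<dots> = - ?D / x - (- ?D / (x / real N))" using hi by (rule integral_unique)
      finally have "x * \<bar>integral {x / real N..x} (sqwt g)\<bar> \<le> x * (- ?D / x - (- ?D / (x / real N)))"
        using x by (intro mult_left_mono) auto
      also have "\<dots> = ?D * real N - ?D" using x by (simp add: field_simps)
      also have "\<dots> \<le> C * (x powr (1 - d) * real N)" using C0 by (simp add: mult_ac)
      also have "\<dots> \<le> C * ?X" using e1 C0 by (intro mult_left_mono)
      finally show ?thesis using x by (simp add: abs_mult)
    qed
    have s3: "f1 (x / real N) + f2 (x / real N) \<le> B * ?X"
    proof -
      have xN: "1 \<le> x / real N" using N1 Nx by (auto simp: field_simps)
      have "x / real N \<le> 2 * x powr (1 - d / 2)"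
      proof -
        have "x = x powr (1 - d / 2) * x powr (d / 2)" using x by (simp add: powr_add[symmetric])
        also have "\<dots> \<le> x powr (1 - d / 2) * (2 * real N)" using Nge by (intro mult_left_mono) auto
        finally show ?thesis using N1 by (simp add: field_simps)
      qed
      hence "(x / real N) powr (1 + d / 4) \<le> (2 * x powr (1 - d / 2)) powr (1 + d / 4)"
        using xN d by (intro powr_mono2) auto
      also have "\<dots> = 2 powr (1 + d / 4) * x powr ((1 - d / 2) * (1 + d / 4))"
        by (simp add: powr_mult powr_powr)
      also have "\<dots> \<le> 2 powr (1 + d / 4) * ?X"
      proof -
        have "(1 - d / 2) * (1 + d / 4) = 1 - d / 4 - d\<^sup>2 / 8" by (simp add: power2_eq_square algebra_simps)
        also have "\<dots> \<le> 1 - d / 4" by simp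
        finally show ?thesis using x by (intro mult_left_mono powr_mono) auto
      qed
      finally have p: "(x / real N) powr (1 + d / 4) \<le> 2 powr (1 + d / 4) * ?X" .
      have "f1 (x / real N) + f2 (x / real N) \<le> (B1 + B2) * (x / real N) powr (1 + d / 4)"
        using B1(2)[OF xN] B2(2)[OF xN] by (simp add: distrib_right)
      also have "\<dots> \<le> (B1 + B2) * (2 powr (1 + d / 4) * ?X)"
        using p B1(1) B2(1) by (intro mult_left_mono) auto
      finally show ?thesis by (simp add: B_def mult_ac)
    qed
    have "\<bar>Tdiff g x\<bar> \<le> C * ?X + C * ?X + B * ?X"
      unfolding main using s1 s2 s3 Tsum_tail_approx[OF f(1) N1 Nx] Tsum_tail_approx[OF f(2) N1 Nx] by linarith
    thus "\<bar>Tdiff g x\<bar> \<le> (2 * C + B) * x powr (1 - d / 4)" by (simp add: algebra_simps)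
  qed
qed


section \<open>Asymptotics with main term x times a polynomial in ln x\<close>

definition log_poly_asymp :: "(real \<Rightarrow> real) \<Rightarrow> bool" where
  "log_poly_asymp g \<longleftrightarrow> (\<exists>p C \<delta>. 0 < \<delta> \<and> \<delta> \<le> 1 \<and> (\<forall>x\<ge>1. \<bar>g x - x * poly p (ln x)\<bar> \<le> C * x powr (1 - \<delta>)))"

lemma log_poly_asymp_add:
  assumes "log_poly_asymp f" "log_poly_asymp g" shows "log_poly_asymp (\<lambda>x. f x + g x)"
proof -
  obtain p1 C1 d1 where 1: "0 < d1" "d1 \<le> 1" "\<And>x. x \<ge> 1 \<Longrightarrow> \<bar>f x - x * poly p1 (ln x)\<bar> \<le> C1 * x powr (1 - d1)"
    using assms(1) unfolding log_poly_asymp_def by blast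
  obtain p2 C2 d2 where 2: "0 < d2" "d2 \<le> 1" "\<And>x. x \<ge> 1 \<Longrightarrow> \<bar>g x - x * poly p2 (ln x)\<bar> \<le> C2 * x powr (1 - d2)"
    using assms(2) unfolding log_poly_asymp_def by blast
  have C: "0 \<le> C1" "0 \<le> C2" using 1(3)[of 1] 2(3)[of 1] by auto
  have "\<bar>f x + g x - x * poly (p1 + p2) (ln x)\<bar> \<le> (C1 + C2) * x powr (1 - min d1 d2)" if x: "1 \<le> x" for x
  proof -
    have "C1 * x powr (1 - d1) \<le> C1 * x powr (1 - min d1 d2)" "C2 * x powr (1 - d2) \<le> C2 * x powr (1 - min d1 d2)"
      using x C by (auto intro!: mult_left_mono powr_mono)
    thus ?thesis using 1(3)[OF x] 2(3)[OF x] by (simp add: algebra_simps)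
  qed
  thus ?thesis unfolding log_poly_asymp_def using 1(1,2) 2(1,2)
    by (intro exI[of _ "p1 + p2"] exI[of _ "C1 + C2"] exI[of _ "min d1 d2"]) auto
qed

lemma poly_antiderivative: "\<exists>P. pderiv P = (p :: real poly)"
proof -
  have sum: "pderiv (\<Sum>i\<in>A. f i) = (\<Sum>i\<in>A. pderiv (f i))" for f :: "nat \<Rightarrow> real poly" and A
    by (induction A rule: infinite_finite_induct) (auto simp: pderiv_add)
  have "pderiv (\<Sum>i\<le>degree p. monom (coeff p i / real (Suc i)) (Suc i)) = (\<Sum>i\<le>degree p. monom (coeff p i) i)"
    by (simp add: sum pderiv_monom del: of_nat_Suc)
  thus ?thesis using poly_as_sum_of_monoms[of p] by metis
qed

text \<open>The main term integrates to an antiderivative of \<open>p\<close>, evaluated at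
  \<open>ln x\<close>. The integral of the error converges, with tail of order
  \<open>x powr (- \<delta>)\<close>; its limit \<open>L\<close> contributes to the constant
  coefficient of the new polynomial and the tail becomes the new error.\<close>

lemma log_poly_asymp_Tint:
  assumes g: "log_poly_asymp g" and b: "bicumulative g"
  shows "log_poly_asymp (Tint g)"
proof -
  obtain p C \<delta> where \<delta>: "0 < \<delta>" "\<delta> \<le> 1" and C: "\<And>x. x \<ge> 1 \<Longrightarrow> \<bar>g x - x * poly p (ln x)\<bar> \<le> C * x powr (1 - \<delta>)"
    using g unfolding log_poly_asymp_def by blast
  have C0: "0 \<le> C" using C[of 1] by auto
  obtain P where P: "pderiv P = p" using poly_antiderivative by blast
  have hiP: "((\<lambda>v. poly p (ln v) / v) has_integral (poly P (ln y) - poly P (ln x))) {x..y}" if "1 \<le> x" "x \<le> y" for x y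
    using that by (intro fundamental_theorem_of_calculus)
      (auto simp: has_real_derivative_iff_has_vector_derivative[symmetric] P intro!: derivative_eq_intros DERIV_chain2[OF poly_DERIV])
  \<comment> \<open>The integral of the error term alone, since \<open>poly P (ln x)\<close> has
    derivative \<open>poly p (ln x) / x\<close>.\<close>
  define J where "J x = integral {1..x} (sqwt g) - (poly P (ln x) - poly P 0)" for x
  have JJ: "\<bar>J y - J x\<bar> \<le> C / \<delta> * x powr (- \<delta>)" if xy: "1 \<le> x" "x \<le> y" for x y
  proof -
    have "integral {1..x} (sqwt g) + integral {x..y} (sqwt g) = integral {1..y} (sqwt g)"
      using xy by (intro Henstock_Kurzweil_Integration.integral_combine bicumulative_integrable b) auto
    hence "J y - J x = integral {x..y} (sqwt g) - (poly P (ln y) - poly P (ln x))"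
      by (simp add: J_def)
    also have "\<dots> = integral {x..y} (\<lambda>v. g v / v\<^sup>2 - poly p (ln v) / v)"
      using hiP[OF xy] by (subst integral_diff[OF bicumulative_integrable[OF b]]) (auto simp: integral_unique)
    finally have eq: "J y - J x = integral {x..y} (\<lambda>v. g v / v\<^sup>2 - poly p (ln v) / v)" .
    have hi: "((\<lambda>v. C * v powr (- \<delta> - 1)) has_integral (- (C / \<delta> * y powr (- \<delta>)) - (- (C / \<delta> * x powr (- \<delta>))))) {x..y}"
      using xy \<delta> by (intro fundamental_theorem_of_calculus)
        (auto simp: has_real_derivative_iff_has_vector_derivative[symmetric] intro!: derivative_eq_intros)
    have "\<bar>J y - J x\<bar> \<le> integral {x..y} (\<lambda>v. C * v powr (- \<delta> - 1))"
      unfolding eq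
    proof (rule integral_norm_bound_integral[where f = "\<lambda>v. g v / v\<^sup>2 - poly p (ln v) / v", unfolded real_norm_def])
      show "(\<lambda>v. g v / v\<^sup>2 - poly p (ln v) / v) integrable_on {x..y}"
        using hiP[OF xy] by (intro integrable_diff bicumulative_integrable b) (auto simp: integrable_on_def)
      fix v assume v: "v \<in> {x..y}"
      hence v1: "1 \<le> v" using xy by auto
      have "g v / v\<^sup>2 - poly p (ln v) / v = (g v - v * poly p (ln v)) / v\<^sup>2"
        using v1 by (simp add: diff_divide_distrib power2_eq_square)
      hence "\<bar>g v / v\<^sup>2 - poly p (ln v) / v\<bar> \<le> C * v powr (1 - \<delta>) / v\<^sup>2"
        using C[OF v1] v1 by (simp add: abs_div divide_right_mono)
      also have "\<dots> = C * v powr (- \<delta> - 1)"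
        using v1 by (simp add: powr_diff powr_minus power2_eq_square field_simps)
      finally show "\<bar>g v / v\<^sup>2 - poly p (ln v) / v\<bar> \<le> C * v powr (- \<delta> - 1)" .
    qed (use hi in \<open>auto simp: integrable_on_def\<close>)
    also have "\<dots> = - (C / \<delta> * y powr (- \<delta>)) - (- (C / \<delta> * x powr (- \<delta>)))" using hi by (rule integral_unique)
    also have "\<dots> \<le> C / \<delta> * x powr (- \<delta>)" using C0 \<delta> by simp
    finally show ?thesis .
  qed
  have lim0: "(\<lambda>n. C / \<delta> * real (Suc n) powr (- \<delta>)) \<longlonglongrightarrow> C / \<delta> * 0"
    using \<delta> by (intro tendsto_mult tendsto_const tendsto_neg_powr filterlim_compose[OF filterlim_real_sequentially filterlim_Suc]) auto
  have "Cauchy (\<lambda>n. J (real (Suc n)))"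
  proof (rule metric_CauchyI)
    fix e :: real assume "0 < e"
    hence "eventually (\<lambda>n. C / \<delta> * real (Suc n) powr (- \<delta>) < e) sequentially"
      using lim0 by (intro order_tendstoD(2)) auto
    then obtain M where M: "\<And>n. M \<le> n \<Longrightarrow> C / \<delta> * real (Suc n) powr (- \<delta>) < e" by (auto simp: eventually_sequentially)
    have lt: "\<bar>J (real (Suc n)) - J (real (Suc m))\<bar> < e" if "M \<le> m" "m \<le> n" for m n
      using JJ[of "real (Suc m)" "real (Suc n)"] M[OF that(1)] that by simp
    have "dist (J (real (Suc m))) (J (real (Suc n))) < e" if "M \<le> m" "M \<le> n" for m n
      using lt[of m n] lt[of n m] that by (cases "m \<le> n") (auto simp: dist_real_def abs_minus_commute)
    thus "\<exists>M. \<forall>m\<ge>M. \<forall>n\<ge>M. dist (J (real (Suc m))) (J (real (Suc n))) < e" by blast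
  qed
  then obtain L where L: "(\<lambda>n. J (real (Suc n))) \<longlonglongrightarrow> L" using Cauchy_convergent_iff convergent_def by blast
  have JL: "\<bar>J x - L\<bar> \<le> C / \<delta> * x powr (- \<delta>)" if x: "1 \<le> x" for x
  proof (rule LIMSEQ_le_const2)
    show "(\<lambda>n. \<bar>J x - J (real (Suc n))\<bar>) \<longlonglongrightarrow> \<bar>J x - L\<bar>" using L by (intro tendsto_intros)
    show "\<exists>N. \<forall>n\<ge>N. \<bar>J x - J (real (Suc n))\<bar> \<le> C / \<delta> * x powr (- \<delta>)"
    proof (intro exI[of _ "nat \<lceil>x\<rceil>"] allI impI)
      fix n assume "nat \<lceil>x\<rceil> \<le> n"
      hence "x \<le> real (Suc n)" by linarith
      from JJ[OF x this] show "\<bar>J x - J (real (Suc n))\<bar> \<le> C / \<delta> * x powr (- \<delta>)" by (simp add: abs_minus_commute)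
    qed
  qed
  define Q where "Q = P + [:L - poly P 0:]"
  have "\<bar>Tint g x - x * poly Q (ln x)\<bar> \<le> C / \<delta> * x powr (1 - \<delta>)" if x: "1 \<le> x" for x
  proof -
    have "integral {0..x} (sqwt g) = integral {1..x} (sqwt g)"
    proof -
      obtain f1 f2 where f: "cumulative f1" "cumulative f2" "g = (\<lambda>x. f1 x - f2 x)"
        using b unfolding bicumulative_def by blast
      show ?thesis unfolding f(3) diff_divide_distrib
        by (simp add: integral_diff cumulative_integrable f cumulative_integral_from_1 x)
    qed
    hence "Tint g x - x * poly Q (ln x) = x * (J x - L)"
      by (simp add: Tint_def Q_def J_def algebra_simps)
    hence "\<bar>Tint g x - x * poly Q (ln x)\<bar> = x * \<bar>J x - L\<bar>" using x by (simp add: abs_mult)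
    also have "\<dots> \<le> x * (C / \<delta> * x powr (- \<delta>))" using x JL[OF x] by (intro mult_left_mono) auto
    also have "\<dots> = C / \<delta> * x powr (1 - \<delta>)" using x by (simp add: powr_diff powr_minus field_simps)
    finally show ?thesis .
  qed
  thus ?thesis unfolding log_poly_asymp_def using \<delta> by blast
qed

definition unit_step :: "real \<Rightarrow> real" where "unit_step x = (if 1 \<le> x then 1 else 0)"

lemma cumulative_unit_step: "cumulative unit_step"
  unfolding cumulative_def
proof (intro conjI allI impI)
  fix \<epsilon> :: real assume "0 < \<epsilon>"
  thus "\<exists>C. \<forall>x\<ge>1. unit_step x \<le> C * x powr (1 + \<epsilon>)"
    by (intro exI[of _ 1]) (auto simp: unit_step_def intro!: ge_one_powr_ge_zero)
qed (auto simp: unit_step_def mono_def)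

lemma bicumulative_iterates: "bicumulative ((Tdiff ^^ j) ((Tsum ^^ i) unit_step))"
proof -
  have "bicumulative ((Tsum ^^ i) unit_step)"
    by (induction i) (auto intro: cumulative_imp_bicumulative cumulative_unit_step bicumulative_Tsum)
  thus ?thesis by (induction j) (auto intro: bicumulative_Tdiff)
qed

text \<open>The unit step is bounded, that is \<open>\<delta> = 1\<close>, and every application of
  \<open>Tdiff\<close> divides the saving by 4.\<close>

lemma Tdiff_iterates_power_saving:
  "\<exists>C \<delta>. 0 < \<delta> \<and> \<delta> \<le> 1 \<and> (\<forall>x\<ge>1. \<bar>(Tdiff ^^ j) unit_step x\<bar> \<le> C * x powr (1 - \<delta>))"
proof (induction j)
  case 0
  show ?case by (intro exI[of _ 1]) (auto simp: unit_step_def)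
next
  case (Suc j)
  then obtain C \<delta> where *: "0 < \<delta>" "\<delta> \<le> 1" "\<And>x. 1 \<le> x \<Longrightarrow> \<bar>(Tdiff ^^ j) unit_step x\<bar> \<le> C * x powr (1 - \<delta>)" by blast
  obtain C' where "\<forall>x\<ge>1. \<bar>Tdiff ((Tdiff ^^ j) unit_step) x\<bar> \<le> C' * x powr (1 - \<delta> / 4)"
    using Tdiff_power_saving[OF bicumulative_iterates[of j 0, simplified] *] by blast
  thus ?case using * by (intro exI[of _ C'] exI[of _ "\<delta> / 4"]) auto
qed

lemma Tdiff_iterates_Tsum: "bicumulative g \<Longrightarrow> (Tdiff ^^ j) (Tsum g) = Tsum ((Tdiff ^^ j) g)"
proof (induction j)
  case (Suc j)
  have "bicumulative ((Tdiff ^^ j) g)" using Suc.prems by (induction j) (auto intro: bicumulative_Tdiff)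
  thus ?case using Suc by (simp add: Tdiff_Tsum)
qed simp

text \<open>\<open>Tdiff ^^ j\<close> moves past the outermost \<open>Tsum\<close>, which then
  splits into \<open>Tint\<close> and \<open>Tdiff\<close>. The second summand has one
  \<open>Tdiff\<close> more, so the induction on \<open>i\<close> must run over all \<open>j\<close>
  at once.\<close>

lemma log_poly_asymp_iterates: "log_poly_asymp ((Tdiff ^^ j) ((Tsum ^^ i) unit_step))"
proof (induction i arbitrary: j)
  case 0
  obtain C \<delta> where "0 < \<delta>" "\<delta> \<le> 1" "\<forall>x\<ge>1. \<bar>(Tdiff ^^ j) unit_step x\<bar> \<le> C * x powr (1 - \<delta>)"
    using Tdiff_iterates_power_saving by blast
  thus ?case unfolding log_poly_asymp_def by (intro exI[of _ 0] exI[of _ C] exI[of _ \<delta>]) auto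
next
  case (Suc i)
  let ?g = "(Tdiff ^^ j) ((Tsum ^^ i) unit_step)"
  have "(Tdiff ^^ j) ((Tsum ^^ Suc i) unit_step) = (\<lambda>x. Tint ?g x + Tdiff ?g x)"
    using Tdiff_iterates_Tsum[OF bicumulative_iterates[of 0 i, simplified], of j] by (simp add: Tdiff_def fun_eq_iff)
  moreover have "log_poly_asymp (\<lambda>x. Tint ?g x + Tdiff ?g x)"
    using Suc[of j] Suc[of "Suc j"] by (intro log_poly_asymp_add log_poly_asymp_Tint bicumulative_iterates) auto
  ultimately show ?case by simp
qed

section \<open>Divisor sums as iterated convolutions\<close>

lemma finite_card_lists_prod_le:
  "finite {xs::nat list. length xs = k \<and> prod_list xs \<in> {1..N}} \<and>
   card {xs::nat list. length xs = Suc k \<and> prod_list xs \<in> {1..N}} = (\<Sum>d=1..N. card {xs::nat list. length xs = k \<and> prod_list xs \<in> {1..N div d}})"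
proof -
  let ?L = "\<lambda>k N. {xs::nat list. length xs = k \<and> prod_list xs \<in> {1..N}}"
  \<comment> \<open>Split off the first factor \<open>d\<close>: the remaining factors have product
    at most \<open>N div d\<close>.\<close>
  have eq: "?L (Suc k) N = (\<Union>d\<in>{1..N}. (#) d ` ?L k (N div d))" for k N
  proof (intro set_eqI iffI)
    fix xs assume "xs \<in> ?L (Suc k) N"
    then obtain d ys where xs: "xs = d # ys" "length ys = k" and p: "1 \<le> d * prod_list ys" "d * prod_list ys \<le> N"
      by (cases xs) auto
    have d: "0 < d" "0 < prod_list ys" using p by (auto simp: Suc_le_eq)
    have "d * 1 \<le> d * prod_list ys" using d by (intro mult_le_mono2) auto
    hence "d * 1 \<le> N" using p(2) by linarith
    moreover have "prod_list ys \<le> N div d" using d p(2) by (simp add: less_eq_div_iff_mult_less_eq mult.commute)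
    ultimately show "xs \<in> (\<Union>d\<in>{1..N}. (#) d ` ?L k (N div d))"
      using xs d by (auto simp: Suc_le_eq)
  next
    fix xs assume "xs \<in> (\<Union>d\<in>{1..N}. (#) d ` ?L k (N div d))"
    thus "xs \<in> ?L (Suc k) N" by (auto simp: less_eq_div_iff_mult_less_eq mult.commute Suc_le_eq)
  qed
  have fin: "finite (?L k N)" for k N
  proof (induction k arbitrary: N)
    case (Suc k) show ?case unfolding eq using Suc by auto
  qed (auto intro: finite_subset[of _ "{[]}"])
  have "card (?L (Suc k) N) = (\<Sum>d=1..N. card ((#) d ` ?L k (N div d)))"
    unfolding eq by (intro card_UN_disjoint) (use fin in auto)
  also have "\<dots> = (\<Sum>d=1..N. card (?L k (N div d)))"
    by (intro sum.cong card_image refl) auto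
  finally show ?thesis using fin by blast
qed

lemma sum_dk: "(\<Sum>n=1..N. dk k n) = card {xs::nat list. length xs = k \<and> prod_list xs \<in> {1..N}}"
proof -
  have "{xs::nat list. length xs = k \<and> prod_list xs \<in> {1..N}} = (\<Union>n\<in>{1..N}. {xs. length xs = k \<and> prod_list xs = n})" by auto
  also have "card \<dots> = (\<Sum>n=1..N. card {xs::nat list. length xs = k \<and> prod_list xs = n})"
  proof (intro card_UN_disjoint)
    show "\<forall>n\<in>{1..N}. finite {xs::nat list. length xs = k \<and> prod_list xs = n}"
      using finite_card_lists_prod_le[of k N] by (auto elim!: finite_subset[rotated])
  qed auto
  finally show ?thesis by (simp add: dk_def)
qed

lemma sum_dk_conv_Tsum: "real (\<Sum>n=1..nat \<lfloor>x\<rfloor>. dk k n) = (Tsum ^^ k) unit_step x"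
proof (induction k arbitrary: x)
  case 0
  have "{xs::nat list. length xs = 0 \<and> prod_list xs \<in> {1..nat \<lfloor>x\<rfloor>}} = (if 1 \<le> x then {[]} else {})"
    by (auto simp: le_nat_iff le_floor_iff)
  thus ?case unfolding sum_dk by (simp add: unit_step_def)
next
  case (Suc k)
  have fl: "nat \<lfloor>x\<rfloor> div n = nat \<lfloor>x / real n\<rfloor>" for n
  proof (cases "0 \<le> x")
    case True
    thus ?thesis using floor_divide_real_eq_div[of "int n" x] by (simp add: nat_div_distrib)
  next
    case False
    hence "x / real n \<le> 0" by (simp add: divide_nonpos_nonneg)
    hence "\<lfloor>x / real n\<rfloor> \<le> 0" by (simp add: floor_le_iff)
    thus ?thesis using False by simp
  qed
  have "real (\<Sum>n=1..nat \<lfloor>x\<rfloor>. dk (Suc k) n) = (\<Sum>d=1..nat \<lfloor>x\<rfloor>. real (\<Sum>n=1..nat \<lfloor>x / real d\<rfloor>. dk k n))"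
    unfolding sum_dk using finite_card_lists_prod_le[of k "nat \<lfloor>x\<rfloor>"] by (simp add: fl)
  also have "\<dots> = (Tsum ^^ Suc k) unit_step x" by (simp only: Suc) (simp add: Tsum_def[of "(Tsum ^^ k) unit_step" x])
  finally show ?case .
qed

lemma divisor_sum_asymp:
  obtains p C \<delta> where "0 < \<delta>" "\<delta> \<le> 1"
    "\<And>x. 1 \<le> x \<Longrightarrow> \<bar>(Tsum ^^ k) unit_step x - x * poly p (ln x)\<bar> \<le> C * x powr (1 - \<delta>)"
  using log_poly_asymp_iterates[of 0 k] unfolding log_poly_asymp_def by auto

section \<open>Mellin transforms and moments\<close>

text \<open>Dilation by \<open>m\<close> multiplies the Mellin integral by
  \<open>m powr (- s)\<close>. Working with nonnegative extended integrals permits summation under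
  the integral and carries finiteness along.\<close>

lemma Mellin_Tsum:
  fixes s :: real
  assumes f: "cumulative f" and s: "1 < s"
  shows "(\<integral>\<^sup>+r. ennreal (Tsum f r * r powr (- s - 1)) \<partial>lborel) =
    ennreal (\<Sum>n. real (Suc n) powr (- s)) * (\<integral>\<^sup>+r. ennreal (f r * r powr (- s - 1)) \<partial>lborel)"
proof -
  let ?I = "\<integral>\<^sup>+r. ennreal (f r * r powr (- s - 1)) \<partial>lborel"
  have [measurable]: "f \<in> borel_measurable borel"
    using f by (intro borel_measurable_mono) (auto simp: cumulative_def)
  have ptw: "ennreal (Tsum f r * r powr (- s - 1)) = (\<Sum>n. ennreal (f (r / real (Suc n)) * r powr (- s - 1)))" for r
  proof -
    have "f (r / real (Suc n)) = 0" if "n \<notin> {..<nat \<lfloor>r\<rfloor>}" for n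
    proof (rule cumulativeD(2)[OF f])
      have "r < real (Suc n)" using that by simp linarith
      thus "r / real (Suc n) < 1" by (simp add: divide_less_eq)
    qed
    hence "(\<Sum>n. ennreal (f (r / real (Suc n)) * r powr (- s - 1))) = (\<Sum>n<nat \<lfloor>r\<rfloor>. ennreal (f (r / real (Suc n)) * r powr (- s - 1)))"
      by (intro suminf_finite) auto
    also have "\<dots> = ennreal (\<Sum>n<nat \<lfloor>r\<rfloor>. f (r / real (Suc n)) * r powr (- s - 1))"
      using cumulativeD(3)[OF f] by (intro sum_ennreal) auto
    also have "(\<Sum>n<nat \<lfloor>r\<rfloor>. f (r / real (Suc n)) * r powr (- s - 1)) = Tsum f r * r powr (- s - 1)"
      unfolding Tsum_def sum_distrib_right[symmetric] by (simp add: sum.atLeast1_atMost_eq)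
    finally show ?thesis by simp
  qed
  have sc: "(\<integral>\<^sup>+r. ennreal (f (r / real m) * r powr (- s - 1)) \<partial>lborel) =
      ennreal (real m powr (- s)) * ?I" if m: "1 \<le> m" for m
  proof -
    have "(\<integral>\<^sup>+r. ennreal (f (r / real m) * r powr (- s - 1)) \<partial>lborel) =
      ennreal \<bar>real m\<bar> * (\<integral>\<^sup>+r. ennreal (f ((0 + real m * r) / real m) * (0 + real m * r) powr (- s - 1)) \<partial>lborel)"
      using m by (intro nn_integral_real_affine) auto
    also have "(\<integral>\<^sup>+r. ennreal (f ((0 + real m * r) / real m) * (0 + real m * r) powr (- s - 1)) \<partial>lborel) =
       (\<integral>\<^sup>+r. ennreal (real m powr (- s - 1)) * ennreal (f r * r powr (- s - 1)) \<partial>lborel)"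
    proof (intro nn_integral_cong)
      fix r :: real
      show "ennreal (f ((0 + real m * r) / real m) * (0 + real m * r) powr (- s - 1)) =
         ennreal (real m powr (- s - 1)) * ennreal (f r * r powr (- s - 1))"
      proof (cases "r < 1")
        case False
        have "f ((0 + real m * r) / real m) * (0 + real m * r) powr (- s - 1) = real m powr (- s - 1) * (f r * r powr (- s - 1))"
          using False m by (simp add: powr_mult)
        thus ?thesis by (simp only: ennreal_mult' powr_ge_zero)
      qed (use m cumulativeD(2)[OF f] in simp)
    qed
    also have "\<dots> = ennreal (real m powr (- s - 1)) * ?I"
      by (rule nn_integral_cmult) measurable
    also have "ennreal \<bar>real m\<bar> * (ennreal (real m powr (- s - 1)) * ?I)
       = ennreal (real m powr (- s)) * ?I"
    proof -
      have "\<bar>real m\<bar> * real m powr (- s - 1) = real m powr (- s)"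
        using m by (simp add: powr_diff)
      hence "ennreal \<bar>real m\<bar> * ennreal (real m powr (- s - 1)) = ennreal (real m powr (- s))"
        by (simp only: ennreal_mult'[symmetric] abs_ge_zero)
      thus ?thesis by (simp only: mult.assoc[symmetric])
    qed
    finally show ?thesis .
  qed
  have "(\<integral>\<^sup>+r. ennreal (Tsum f r * r powr (- s - 1)) \<partial>lborel) = (\<Sum>n. \<integral>\<^sup>+r. ennreal (f (r / real (Suc n)) * r powr (- s - 1)) \<partial>lborel)"
    unfolding ptw by (rule nn_integral_suminf) measurable
  also have "\<dots> = (\<Sum>n. ennreal (real (Suc n) powr (- s)) * ?I)"
    by (intro suminf_cong sc) simp
  also have "\<dots> = (\<Sum>n. ennreal (real (Suc n) powr (- s))) * ?I"
    by (rule ennreal_suminf_multc)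
  also have "(\<Sum>n. ennreal (real (Suc n) powr (- s))) = ennreal (\<Sum>n. real (Suc n) powr (- s))"
    using s by (intro suminf_ennreal2 summable_Suc_powr) auto
  finally show ?thesis .
qed

text \<open>In the variable \<open>ln r\<close> this is the Gamma integral. A primitive vanishing at
  infinity is built by repeated integration by parts, so the integral is minus its value at
  1.\<close>

lemma log_power_integral:
  fixes w :: real
  assumes w: "0 < w"
  shows "has_bochner_integral lborel (\<lambda>r. indicator {1..} r * (ln r ^ j * r powr (- w - 1))) (fact j / w ^ Suc j)"
proof -
  have "\<exists>F. (\<forall>r\<ge>1. DERIV F r :> ln r ^ j * r powr (- w - 1)) \<and> (F \<longlongrightarrow> 0) at_top \<and> F 1 = - (fact j / w ^ Suc j)"
  proof (induction j)
    have lim: "((\<lambda>r. ln r ^ j * r powr (- w)) \<longlongrightarrow> 0) at_top" for j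
    proof -
      have fl: "filterlim (\<lambda>r. w * ln r) at_top at_top"
        using w by (intro filterlim_tendsto_pos_mult_at_top[OF tendsto_const _ ln_at_top]) auto
      have "((\<lambda>r. (w * ln r) ^ j / exp (w * ln r) / w ^ j) \<longlongrightarrow> 0 / w ^ j) at_top"
        using w by (intro tendsto_divide tendsto_const filterlim_compose[OF tendsto_power_div_exp_0 fl]) auto
      moreover have "eventually (\<lambda>r. (w * ln r) ^ j / exp (w * ln r) / w ^ j = ln r ^ j * r powr (- w)) at_top"
        using eventually_gt_at_top[of 0]
        by eventually_elim (use w in \<open>simp add: powr_def power_mult_distrib exp_minus field_simps\<close>)
      ultimately show ?thesis by (simp add: tendsto_cong)
    qed
    {
      case 0
      have "((\<lambda>r. - (1 / w) * (ln r ^ 0 * r powr (- w))) \<longlongrightarrow> - (1 / w) * 0) at_top"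
        by (intro tendsto_mult tendsto_const lim)
      thus ?case using w
        by (intro exI[of _ "\<lambda>r. - (1 / w) * (r powr (- w))"]) (auto intro!: derivative_eq_intros)
    next
      case (Suc j)
      then obtain F where F: "\<And>r. r \<ge> 1 \<Longrightarrow> DERIV F r :> ln r ^ j * r powr (- w - 1)" "(F \<longlongrightarrow> 0) at_top" "F 1 = - (fact j / w ^ Suc j)" by blast
      let ?G = "\<lambda>r. - (1 / w) * (ln r ^ Suc j * r powr (- w)) + real (Suc j) / w * F r"
      have "DERIV ?G r :> ln r ^ Suc j * r powr (- w - 1)" if r: "1 \<le> r" for r
      proof -
        have "DERIV (\<lambda>r. ln r ^ Suc j) r :> real (Suc j) * ln r ^ j * (1 / r)"
          using DERIV_power_Suc[OF DERIV_ln_divide[of r], of j] r by (simp add: mult_ac add.commute)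
        moreover have "DERIV (\<lambda>r. r powr (- w)) r :> - w * r powr (- w - 1)"
          using r by (auto intro!: derivative_eq_intros)
        ultimately have "DERIV ?G r :> - (1 / w) * (real (Suc j) * ln r ^ j * (1 / r) * r powr (- w) + (- w * r powr (- w - 1)) * ln r ^ Suc j) + real (Suc j) / w * (ln r ^ j * r powr (- w - 1))"
          using F(1)[OF r] by (intro DERIV_add DERIV_cmult DERIV_mult)
        moreover have "1 / r * r powr (- w) = r powr (- w - 1)" using r by (simp add: powr_diff)
        hence "real (Suc j) * ln r ^ j * (1 / r) * r powr (- w) = real (Suc j) * ln r ^ j * r powr (- w - 1)"
          by (simp only: mult.assoc)
        hence "- (1 / w) * (real (Suc j) * ln r ^ j * (1 / r) * r powr (- w) + (- w * r powr (- w - 1)) * ln r ^ Suc j) + real (Suc j) / w * (ln r ^ j * r powr (- w - 1))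
            = ln r ^ Suc j * r powr (- w - 1)"
          using w by (simp add: field_simps del: power_Suc of_nat_Suc)
        ultimately show ?thesis by (simp only:)
      qed
      moreover have "(?G \<longlongrightarrow> - (1 / w) * 0 + real (Suc j) / w * 0) at_top"
        by (intro tendsto_add tendsto_mult tendsto_const lim F(2))
      moreover have "?G 1 = - (fact (Suc j) / w ^ Suc (Suc j))" using F(3) by simp
      ultimately show ?case by (intro exI[of _ ?G]) auto
    }
  qed
  then obtain F where F: "\<And>r. r \<ge> 1 \<Longrightarrow> DERIV F r :> ln r ^ j * r powr (- w - 1)" "(F \<longlongrightarrow> 0) at_top" "F 1 = - (fact j / w ^ Suc j)" by blast
  have "(\<integral>\<^sup>+r. ennreal (ln r ^ j * r powr (- w - 1)) * indicator {1..} r \<partial>lborel) = ennreal (0 - F 1)"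
    by (rule nn_integral_FTC_atLeast[OF _ F(1) _ F(2)]) auto
  also have "(\<lambda>r. ennreal (ln r ^ j * r powr (- w - 1)) * indicator {1..} r) = (\<lambda>r::real. ennreal (indicator {1..} r * (ln r ^ j * r powr (- w - 1))))"
    by (auto simp: indicator_def fun_eq_iff)
  finally show ?thesis using w unfolding F(3)
    by (intro has_bochner_integral_nn_integral) (auto simp: indicator_def)
qed

lemma Mellin_divisor_sum:
  fixes s :: real
  assumes s: "1 < s"
  shows "has_bochner_integral lborel (\<lambda>r. (Tsum ^^ k) unit_step r * r powr (- s - 1)) ((\<Sum>n. real (Suc n) powr (- s)) ^ k / s)"
proof -
  let ?Z = "\<Sum>n. real (Suc n) powr (- s)"
  have Z: "0 \<le> ?Z" using s by (intro suminf_nonneg summable_Suc_powr) auto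
  have cum: "cumulative ((Tsum ^^ k) unit_step)" for k
    by (induction k) (auto intro: cumulative_unit_step cumulative_Tsum)
  have "(\<integral>\<^sup>+r. ennreal ((Tsum ^^ k) unit_step r * r powr (- s - 1)) \<partial>lborel) = ennreal (?Z ^ k / s)"
  proof (induction k)
    case 0
    have "has_bochner_integral lborel (\<lambda>r. unit_step r * r powr (- s - 1)) (1 / s)"
    proof -
      have "unit_step = indicator {1..}" by (auto simp: unit_step_def indicator_def fun_eq_iff)
      thus ?thesis using log_power_integral[of s 0] s by simp
    qed
    thus ?case using s by (subst nn_integral_eq_integral) (auto simp: has_bochner_integral_iff unit_step_def)
  next
    case (Suc k)
    have "(\<integral>\<^sup>+r. ennreal ((Tsum ^^ Suc k) unit_step r * r powr (- s - 1)) \<partial>lborel) = ennreal ?Z * ennreal (?Z ^ k / s)"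
      using Mellin_Tsum[OF cum s, of k] Suc by simp
    thus ?case using Z s by (simp only: ennreal_mult'[symmetric]) simp
  qed
  moreover have "(Tsum ^^ k) unit_step \<in> borel_measurable borel"
    using cum by (intro borel_measurable_mono) (auto simp: cumulative_def)
  ultimately show ?thesis using Z s cumulativeD(3)[OF cum]
    by (intro has_bochner_integral_nn_integral) auto
qed

lemma zeta_of_real:
  assumes "1 < s" shows "zeta (of_real s) = of_real (\<Sum>n. real (Suc n) powr (- s))"
proof -
  have "(\<lambda>n. of_real (real (Suc n) powr (- s))) sums (of_real (\<Sum>n. real (Suc n) powr (- s)) :: complex)"
    using assms by (intro sums_of_real summable_sums summable_Suc_powr)
  moreover have "of_real (real (Suc n) powr (- s)) = 1 / (of_nat (Suc n) :: complex) powr of_real s" for n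
    using powr_of_real[of "real (Suc n)" s] by (simp add: powr_minus_divide del: of_nat_Suc)
  ultimately show ?thesis using zeta_sums[of "of_real s"] assms sums_unique2 by fastforce
qed

text \<open>A single term of the exponential series for
  \<open>r powr \<eta> = exp (\<eta> * ln r)\<close> is at most the whole sum.\<close>

lemma log_power_le:
  fixes r \<eta> :: real
  assumes "1 \<le> r" "0 < \<eta>"
  shows "ln r ^ m \<le> fact m / \<eta> ^ m * r powr \<eta>"
proof -
  let ?y = "\<eta> * ln r"
  have y: "0 \<le> ?y" using assms by simp
  have "?y ^ m / fact m = (\<Sum>n\<in>{m}. ?y ^ n /\<^sub>R fact n)" by (simp add: field_simps)
  also have "\<dots> \<le> exp ?y" unfolding exp_def
    by (rule sum_le_suminf[OF summable_exp_generic]) (use y in auto)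
  finally have "?y ^ m / fact m \<le> r powr \<eta>" using assms by (simp add: powr_def)
  thus ?thesis using assms by (simp add: power_mult_distrib field_simps)
qed

text \<open>A spare factor \<open>r powr \<eta>\<close> dominates all powers of \<open>ln r\<close>
  at the cost \<open>fact m / \<eta> ^ m\<close>, so power series in \<open>ln r\<close> may be
  integrated termwise. This is used for \<open>exp (- w * ln r)\<close>, which gives the Mellin
  transform near \<open>s = 1\<close>, and for the Bessel kernel.\<close>

lemma log_moments:
  fixes g :: "real \<Rightarrow> complex" and \<eta> :: real
  assumes [measurable]: "g \<in> borel_measurable borel" and g0: "\<And>r. r < 1 \<Longrightarrow> g r = 0" and \<eta>: "0 < \<eta>"
    and int: "integrable lborel (\<lambda>r. norm (g r) * r powr \<eta>)"
  defines "K \<equiv> (\<integral>r. norm (g r) * r powr \<eta> \<partial>lborel)"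
  shows "integrable lborel (\<lambda>r. g r * of_real (ln r ^ m))"
    and "norm (\<integral>r. g r * of_real (ln r ^ m) \<partial>lborel) \<le> K * (fact m / \<eta> ^ m)"
    and "summable (\<lambda>m. \<bar>a m\<bar> * (fact m / \<eta> ^ m)) \<Longrightarrow> (\<And>y. 0 \<le> y \<Longrightarrow> (\<lambda>m. a m * y ^ m) sums f y) \<Longrightarrow>
      (\<lambda>m. of_real (a m) * (\<integral>r. g r * of_real (ln r ^ m) \<partial>lborel)) sums (\<integral>r. g r * of_real (f (ln r)) \<partial>lborel)"
proof -
  have le: "norm (g r * of_real (ln r ^ m)) \<le> fact m / \<eta> ^ m * (norm (g r) * r powr \<eta>)" for r m
  proof (cases "r < 1")
    case False
    have "norm (g r) * \<bar>ln r ^ m\<bar> \<le> norm (g r) * (fact m / \<eta> ^ m * r powr \<eta>)"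
      using False log_power_le[of r \<eta> m] \<eta> by (intro mult_left_mono) auto
    thus ?thesis by (simp only: norm_mult norm_of_real) (simp add: mult_ac)
  qed (simp add: g0)
  show i: "integrable lborel (\<lambda>r. g r * of_real (ln r ^ m))" for m
    by (rule Bochner_Integration.integrable_bound[OF integrable_mult_right[OF int, of "fact m / \<eta> ^ m"]])
      (use le[of _ m] \<eta> in \<open>auto intro!: AE_I2 order_trans[OF le]\<close>)
  have nle: "(\<integral>r. norm (g r * of_real (ln r ^ m)) \<partial>lborel) \<le> K * (fact m / \<eta> ^ m)" for m
  proof -
    have "(\<integral>r. norm (g r * of_real (ln r ^ m)) \<partial>lborel) \<le> (\<integral>r. fact m / \<eta> ^ m * (norm (g r) * r powr \<eta>) \<partial>lborel)"
      by (intro integral_mono integrable_norm i integrable_mult_right int le)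
    thus ?thesis by (simp add: K_def mult_ac)
  qed
  show "norm (\<integral>r. g r * of_real (ln r ^ m) \<partial>lborel) \<le> K * (fact m / \<eta> ^ m)"
    by (rule order_trans[OF integral_norm_bound nle])
  assume sm: "summable (\<lambda>m. \<bar>a m\<bar> * (fact m / \<eta> ^ m))" and f: "\<And>y. 0 \<le> y \<Longrightarrow> (\<lambda>m. a m * y ^ m) sums f y"
  let ?h = "\<lambda>m r. of_real (a m) * (g r * of_real (ln r ^ m))"
  have "(\<lambda>m. \<integral>r. ?h m r \<partial>lborel) sums (\<integral>r. (\<Sum>m. ?h m r) \<partial>lborel)"
  proof (rule sums_integral)
    show "integrable lborel (?h m)" for m by (intro integrable_mult_right i)
    show "AE r in lborel. summable (\<lambda>m. norm (?h m r))"
    proof (intro AE_I2 summable_comparison_test'[OF summable_mult2[OF sm]])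
      fix r m
      have "norm (?h m r) \<le> \<bar>a m\<bar> * (fact m / \<eta> ^ m * (norm (g r) * r powr \<eta>))"
        unfolding norm_mult[of "of_real (a m)"] norm_of_real using le by (intro mult_left_mono) auto
      thus "norm (norm (?h m r)) \<le> \<bar>a m\<bar> * (fact m / \<eta> ^ m) * (norm (g r) * r powr \<eta>)" by (simp add: mult_ac)
    qed
    show "summable (\<lambda>m. \<integral>r. norm (?h m r) \<partial>lborel)"
    proof (rule summable_comparison_test'[OF summable_mult[OF sm, of K]])
      fix m
      have "(\<integral>r. norm (?h m r) \<partial>lborel) = \<bar>a m\<bar> * (\<integral>r. norm (g r * of_real (ln r ^ m)) \<partial>lborel)"
        by (simp only: norm_mult[of "of_real (a m)"] norm_of_real integral_mult_right_zero)
      also have "\<dots> \<le> \<bar>a m\<bar> * (K * (fact m / \<eta> ^ m))" by (intro mult_left_mono nle) auto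
      finally show "norm (\<integral>r. norm (?h m r) \<partial>lborel) \<le> K * (\<bar>a m\<bar> * (fact m / \<eta> ^ m))"
        by (simp add: mult_ac)
    qed
  qed
  moreover have "(\<Sum>m. ?h m r) = g r * of_real (f (ln r))" for r
  proof (cases "r < 1")
    case False
    have "(\<lambda>m. g r * of_real (a m * ln r ^ m)) sums (g r * of_real (f (ln r)))"
      using False by (intro sums_mult sums_of_real f) auto
    thus ?thesis by (simp add: sums_iff mult_ac)
  qed (simp add: g0)
  ultimately show "(\<lambda>m. of_real (a m) * (\<integral>r. g r * of_real (ln r ^ m) \<partial>lborel)) sums (\<integral>r. g r * of_real (f (ln r)) \<partial>lborel)"
    by simp
qed

text \<open>The Mellin transform is evaluated only for real \<open>s > 1\<close>. Such points
  accumulate at \<open>s = 1\<close>, so the identity theorem still determines all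
  coefficients.\<close>

lemma has_fps_expansion_eqI_positive_reals:
  assumes f: "f has_fps_expansion F" and g: "g has_fps_expansion G" and \<eta>: "0 < \<eta>"
    and eq: "\<And>w. 0 < w \<Longrightarrow> w < \<eta> \<Longrightarrow> f (of_real w) = g (of_real w)"
  shows "F = (G :: complex fps)"
proof -
  define h where "h z = f z - g z" for z
  have h: "h has_fps_expansion F - G" unfolding h_def by (intro has_fps_expansion_diff f g)
  then obtain A where A: "open A" "0 \<in> A" "h holomorphic_on A"
    using has_fps_expansion_imp_analytic_0 analytic_at by metis
  then obtain r where r: "0 < r" "ball 0 r \<subseteq> A" by (auto simp: open_contains_ball)
  have "h z = 0" if "z \<in> ball 0 r" for z
  proof (rule analytic_continuation[of h "ball 0 r" "of_real ` {0<..<min r \<eta>}" 0])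
    show "h holomorphic_on ball 0 r" using A r by (auto intro: holomorphic_on_subset)
    show "(of_real ` {0<..<min r \<eta>} :: complex set) \<subseteq> ball 0 r" by auto
    show "0 islimpt (of_real ` {0<..<min r \<eta>} :: complex set)"
    proof (rule islimptI)
      fix T :: "complex set" assume "0 \<in> T" "open T"
      then obtain e where e: "0 < e" "ball 0 e \<subseteq> T" by (auto simp: open_contains_ball)
      define w where "w = min e (min r \<eta>) / 2"
      have "0 < w" "w < e" "w < min r \<eta>" using e r \<eta> by (auto simp: w_def)
      thus "\<exists>y\<in>of_real ` {0<..<min r \<eta>}. y \<in> T \<and> y \<noteq> 0"
        using e by (intro bexI[of _ "of_real w"]) (auto simp: subset_iff)
    qed
    show "h z = 0" if "z \<in> of_real ` {0<..<min r \<eta>}" for z using that eq by (auto simp: h_def)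
  qed (use r that in auto)
  moreover have "eventually (\<lambda>z::complex. z \<in> ball 0 r) (nhds 0)" using r by (intro eventually_nhds_in_open) auto
  ultimately have "h has_fps_expansion 0" unfolding has_fps_expansion_0_iff by (auto elim: eventually_mono)
  with h have "F - G = 0" by (rule fps_expansion_unique_complex)
  thus ?thesis by simp
qed


text \<open>Near \<open>s = 1\<close>, the Mellin transform of the summatory function is known both as \<open>\<zeta>(s)\<^sup>k / s\<close> and
  through the main term and the moments of the remainder; comparing Laurent coefficients determines both.\<close>

lemma remainder_moments:
  obtains p \<eta> where "0 < \<eta>"
    "integrable lborel (\<lambda>r. norm (indicator {1..} r * of_real (((Tsum ^^ k) unit_step r - r * poly p (ln r)) / r\<^sup>2) :: complex) * r powr \<eta>)"
    "\<And>j. of_real (coeff p j * fact j) = (if j < k then quot_coef k (k - 1 - j) else 0)"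
    "\<And>m. (\<integral>r. indicator {1..} r * of_real (((Tsum ^^ k) unit_step r - r * poly p (ln r)) / r\<^sup>2) * of_real (ln r ^ m) \<partial>lborel)
       = (-1) ^ m * fact m * quot_coef k (k + m)"
proof -
  let ?D = "(Tsum ^^ k) unit_step"
  have cum: "cumulative ?D"
    by (induction k) (auto intro: cumulative_unit_step cumulative_Tsum)
  have D[measurable]: "?D \<in> borel_measurable borel"
    using cum by (intro borel_measurable_mono) (auto simp: cumulative_def)
  obtain p C \<delta> where \<delta>: "0 < \<delta>" "\<delta> \<le> 1" and C: "\<And>x. 1 \<le> x \<Longrightarrow> \<bar>?D x - x * poly p (ln x)\<bar> \<le> C * x powr (1 - \<delta>)"
    using divisor_sum_asymp by metis
  \<comment> \<open>Half of the saving is spent on the extra weight; the integrand remains of order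
    \<open>r powr (- \<eta> - 1)\<close>.\<close>
  define \<eta> where "\<eta> = \<delta> / 2"
  have \<eta>: "0 < \<eta>" using \<delta> by (simp add: \<eta>_def)
  define e where "e r = (?D r - r * poly p (ln r)) / r\<^sup>2" for r
  have [measurable]: "e \<in> borel_measurable borel"
    unfolding e_def[abs_def] poly_altdef by measurable
  define g where "g r = (indicator {1..} r * of_real (e r) :: complex)" for r :: real
  have [measurable]: "g \<in> borel_measurable borel" unfolding g_def by measurable
  have g0: "g r = 0" if "r < 1" for r using that by (simp add: g_def)
  have int: "integrable lborel (\<lambda>r. norm (g r) * r powr \<eta>)"
  proof (rule Bochner_Integration.integrable_bound)
    show "integrable lborel (\<lambda>r. C * (indicator {1..} r * (ln r ^ 0 * r powr (- \<eta> - 1))))"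
      using log_power_integral[OF \<eta>, of 0] by (intro integrable_mult_right) (auto simp: has_bochner_integral_iff)
    show "AE r in lborel. norm (norm (g r) * r powr \<eta>) \<le> norm (C * (indicator {1..} r * (ln r ^ 0 * r powr (- \<eta> - 1))))"
    proof (rule AE_I2)
      fix r :: real
      show "norm (norm (g r) * r powr \<eta>) \<le> norm (C * (indicator {1..} r * (ln r ^ 0 * r powr (- \<eta> - 1))))"
      proof (cases "r < 1")
        case False
        hence r: "1 \<le> r" by simp
        have "norm (g r) * r powr \<eta> = \<bar>?D r - r * poly p (ln r)\<bar> * (r powr \<eta> / r\<^sup>2)"
        proof -
          have "norm (g r) = \<bar>e r\<bar>" using r by (simp add: g_def)
          thus ?thesis by (simp add: e_def abs_div)
        qed
        also have "\<dots> \<le> C * r powr (1 - \<delta>) * (r powr \<eta> / r\<^sup>2)" using r by (intro mult_right_mono C) auto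
        also have "\<dots> = C * (r powr (1 - \<delta>) * r powr \<eta> * r powr (- 2))"
          using r by (simp add: powr_minus divide_inverse)
        also have "r powr (1 - \<delta>) * r powr \<eta> * r powr (- 2) = r powr (- \<eta> - 1)"
        proof -
          have "1 - \<delta> + \<eta> + - 2 = - \<eta> - 1" by (simp add: \<eta>_def)
          thus ?thesis by (simp only: powr_add[symmetric])
        qed
        finally show ?thesis using r by simp
      qed (simp add: g0)
    qed
  qed measurable
  define M where "M m = (\<integral>r. g r * of_real (ln r ^ m) \<partial>lborel)" for m
  define K where "K = (\<integral>r. norm (g r) * r powr \<eta> \<partial>lborel)"
  have M_le: "norm (M m) \<le> K * (fact m / \<eta> ^ m)" for m
    unfolding M_def K_def by (rule log_moments(2)[OF _ g0 \<eta> int]) measurable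
  define d where "d = degree p"
  let ?Q = "\<lambda>w r. \<Sum>j\<le>d. coeff p j * (indicator {1..} r * (ln r ^ j * r powr (- w - 1)))"
  have ser: "(\<lambda>m. of_real ((- w) ^ m / fact m) * M m) sums
      of_real ((\<Sum>n. real (Suc n) powr (- (1 + w))) ^ k / (1 + w) - (\<Sum>j\<le>d. coeff p j * (fact j / w ^ Suc j)))"
    if w: "0 < w" "w < \<eta>" for w
  proof -
    have "(\<lambda>m. of_real ((- w) ^ m / fact m) * M m) sums (\<integral>r. g r * of_real (exp (- w * ln r)) \<partial>lborel)"
      unfolding M_def
    proof (rule log_moments(3)[OF _ g0 \<eta> int])
      have "summable (\<lambda>m. (w / \<eta>) ^ m)" using w \<eta> by (intro summable_geometric) auto
      moreover have "\<bar>(- w) ^ m / fact m\<bar> * (fact m / \<eta> ^ m) = (w / \<eta>) ^ m" for m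
        using w by (simp add: abs_div power_abs power_divide)
      ultimately show "summable (\<lambda>m. \<bar>(- w) ^ m / fact m\<bar> * (fact m / \<eta> ^ m))" by simp
      show "(\<lambda>m. (- w) ^ m / fact m * y ^ m) sums exp (- w * y)" for y
      proof -
        have "(- w) ^ m / fact m * y ^ m = (- w * y) ^ m /\<^sub>R fact m" for m
          by (simp only: power_mult_distrib real_scaleR_def divide_inverse mult_ac)
        thus ?thesis using exp_converges[of "- w * y"] by (simp only:)
      qed
    qed measurable
    moreover have "has_bochner_integral lborel (\<lambda>r. ?D r * r powr (- (1 + w) - 1) - ?Q w r)
      ((\<Sum>n. real (Suc n) powr (- (1 + w))) ^ k / (1 + w) - (\<Sum>j\<le>d. coeff p j * (fact j / w ^ Suc j)))"
      using w by (intro has_bochner_integral_diff has_bochner_integral_sum has_bochner_integral_mult_right Mellin_divisor_sum log_power_integral) auto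
    moreover have "g r * of_real (exp (- w * ln r)) = of_real (?D r * r powr (- (1 + w) - 1) - ?Q w r)" for r
    proof (cases "r < 1")
      case True
      thus ?thesis using cumulativeD(2)[OF cum] by (simp add: g0)
    next
      case False
      hence r: "1 \<le> r" by simp
      have "e r * exp (- w * ln r) = ?D r * (r powr (- w) / r\<^sup>2) - poly p (ln r) * (r * r powr (- w) / r\<^sup>2)"
        using r by (simp add: e_def powr_def diff_divide_distrib algebra_simps)
      also have "r powr (- w) / r\<^sup>2 = r powr (- (1 + w) - 1)"
      proof -
        have "r powr (- w) / r\<^sup>2 = r powr (- w) * r powr (- 2)" using r by (simp add: powr_minus divide_inverse)
        moreover have "- w + - 2 = - (1 + w) - 1" by simp
        ultimately show ?thesis by (simp only: powr_add[symmetric])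
      qed
      also have "r * r powr (- w) / r\<^sup>2 = r powr (- w - 1)"
        using r by (simp add: powr_diff power2_eq_square)
      also have "poly p (ln r) * r powr (- w - 1) = ?Q w r"
        using r by (simp add: poly_altdef d_def sum_distrib_right mult.assoc)
      finally have "e r * exp (- w * ln r) = ?D r * r powr (- (1 + w) - 1) - ?Q w r" .
      moreover have "g r * of_real (exp (- w * ln r)) = of_real (e r * exp (- w * ln r))"
        using r by (simp add: g_def del: of_real_exp)
      ultimately show ?thesis by (simp only:)
    qed
    ultimately show ?thesis
      by (simp only: integral_complex_of_real has_bochner_integral_iff)
  qed
  \<comment> \<open>The Taylor coefficients at \<open>s = 1\<close> of the Mellin transform of the
    remainder, obtained by expanding \<open>r powr (- w)\<close> in powers of
    \<open>ln r\<close>.\<close>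
  define \<gamma> where "\<gamma> m = (-1) ^ m / fact m * M m" for m
  define Gf where "Gf z = (\<Sum>m. \<gamma> m * z ^ m)" for z
  have Gs: "(\<lambda>m. \<gamma> m * z ^ m) sums Gf z" if z: "z \<in> ball 0 \<eta>" for z
  proof -
    have sm: "summable (\<lambda>m. K * (norm z / \<eta>) ^ m)" using z \<eta> by (intro summable_mult summable_geometric) auto
    have "norm (\<gamma> m * z ^ m) \<le> K * (norm z / \<eta>) ^ m" for m
    proof -
      have "norm (\<gamma> m * z ^ m) = norm (M m) * (norm z ^ m / fact m)"
        by (simp add: \<gamma>_def norm_mult norm_divide norm_power)
      also have "\<dots> \<le> K * (fact m / \<eta> ^ m) * (norm z ^ m / fact m)" by (intro mult_right_mono M_le) auto
      finally show ?thesis by (simp add: power_divide)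
    qed
    hence "summable (\<lambda>m. \<gamma> m * z ^ m)" by (rule summable_comparison_test'[OF sm])
    thus ?thesis by (simp add: Gf_def summable_sums)
  qed
  have Gfps: "Gf has_fps_expansion Abs_fps \<gamma>"
  proof (rule has_fps_expansionI)
    have "eventually (\<lambda>u::complex. u \<in> ball 0 \<eta>) (nhds 0)" using \<eta> by (intro eventually_nhds_in_open) auto
    thus "\<forall>\<^sub>F u in nhds 0. (\<lambda>n. fps_nth (Abs_fps \<gamma>) n * u ^ n) sums Gf u"
      by eventually_elim (use Gs in auto)
  qed
  \<comment> \<open>Multiplication by \<open>w ^ N\<close> clears the pole of order \<open>k\<close>
    of \<open>\<zeta>(s)^k / s\<close> and the pole of order \<open>d + 1\<close> of the transformed
    main term, so that formal power series can be compared.\<close>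
  define N where "N = k + d + 1"
  let ?c = "\<lambda>j. complex_of_real (coeff p j * fact j)"
  have "fps_X ^ (d + 1) * Abs_fps (quot_coef k) = fps_X ^ N * Abs_fps \<gamma> + (\<Sum>j\<le>d. fps_const (?c j) * fps_X ^ (N - 1 - j))"
  proof (rule has_fps_expansion_eqI_positive_reals[OF _ _ \<eta>])
    show "(\<lambda>z. z ^ (d + 1) * (zeta_pow_reg k (1 + z) / (1 + z))) has_fps_expansion fps_X ^ (d + 1) * Abs_fps (quot_coef k)"
      by (intro has_fps_expansion_mult has_fps_expansion_fps_X_power quot_coef_fps)
    show "(\<lambda>z. z ^ N * Gf z + (\<Sum>j\<le>d. ?c j * z ^ (N - 1 - j))) has_fps_expansion
        fps_X ^ N * Abs_fps \<gamma> + (\<Sum>j\<le>d. fps_const (?c j) * fps_X ^ (N - 1 - j))"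
      by (intro has_fps_expansion_add has_fps_expansion_sum has_fps_expansion_mult has_fps_expansion_cmult_left has_fps_expansion_fps_X_power Gfps)
    fix w assume w: "0 < w" "w < \<eta>"
    let ?Z = "\<Sum>n. real (Suc n) powr (- (1 + w))"
    have w0: "complex_of_real w \<noteq> 0" using w by simp
    have Gw: "Gf (of_real w) = of_real (?Z ^ k / (1 + w) - (\<Sum>j\<le>d. coeff p j * (fact j / w ^ Suc j)))"
    proof -
      have "\<gamma> m * of_real w ^ m = of_real ((- w) ^ m / fact m) * M m" for m
        by (simp add: \<gamma>_def power_minus[of "of_real w"])
      hence "(\<lambda>m. \<gamma> m * of_real w ^ m) sums of_real (?Z ^ k / (1 + w) - (\<Sum>j\<le>d. coeff p j * (fact j / w ^ Suc j)))"
        using ser[OF w] by (simp only:)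
      moreover have "(\<lambda>m. \<gamma> m * of_real w ^ m) sums Gf (of_real w)" using w by (intro Gs) auto
      ultimately show ?thesis by (rule sums_unique2[symmetric])
    qed
    have "zeta (1 + of_real w) = of_real ?Z" using zeta_of_real[of "1 + w"] w by simp
    hence L: "zeta_pow_reg k (1 + of_real w) = of_real (w ^ k * ?Z ^ k)" using w0 by (simp add: zeta_pow_reg_def)
    have "w ^ N * (\<Sum>j\<le>d. coeff p j * (fact j / w ^ Suc j)) = (\<Sum>j\<le>d. coeff p j * fact j * w ^ (N - 1 - j))"
      unfolding sum_distrib_left
    proof (intro sum.cong refl)
      fix j assume "j \<in> {..d}"
      hence "w ^ N = w ^ Suc j * w ^ (N - 1 - j)" unfolding power_add[symmetric] by (simp add: N_def)
      thus "w ^ N * (coeff p j * (fact j / w ^ Suc j)) = coeff p j * fact j * w ^ (N - 1 - j)"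
        using w by simp
    qed
    hence "w ^ (d + 1) * (w ^ k * ?Z ^ k / (1 + w)) = w ^ N * (?Z ^ k / (1 + w) - (\<Sum>j\<le>d. coeff p j * (fact j / w ^ Suc j)))
       + (\<Sum>j\<le>d. coeff p j * fact j * w ^ (N - 1 - j))"
      by (simp add: right_diff_distrib N_def power_add mult_ac)
    hence "complex_of_real (w ^ (d + 1) * (w ^ k * ?Z ^ k / (1 + w))) = of_real (w ^ N * (?Z ^ k / (1 + w) - (\<Sum>j\<le>d. coeff p j * (fact j / w ^ Suc j)))
       + (\<Sum>j\<le>d. coeff p j * fact j * w ^ (N - 1 - j)))" by (simp only:)
    thus "of_real w ^ (d + 1) * (zeta_pow_reg k (1 + of_real w) / (1 + of_real w)) =
       of_real w ^ N * Gf (of_real w) + (\<Sum>j\<le>d. ?c j * of_real w ^ (N - 1 - j))"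
      unfolding Gw L by (simp only: of_real_add of_real_mult of_real_power of_real_divide of_real_sum of_real_1)
  qed
  hence nth: "(if n < d + 1 then 0 else quot_coef k (n - (d + 1))) = (if n < N then 0 else \<gamma> (n - N)) + (\<Sum>j\<le>d. if n = N - 1 - j then ?c j else 0)" for n
    by (simp only: fps_eq_iff fps_add_nth fps_X_power_mult_nth fps_sum_nth fps_mult_left_const_nth fps_X_power_nth Abs_fps_inverse)
      (auto simp: fps_nth_Abs_fps if_distrib cong: if_cong)
  have m1: "\<gamma> m = quot_coef k (k + m)" for m
  proof -
    have "(\<Sum>j\<le>d. if N + m = N - 1 - j then ?c j else 0) = 0" by (intro sum.neutral) (auto simp: N_def)
    thus ?thesis using nth[of "N + m"] by (simp add: N_def)
  qed
  have m2: "?c j = (if j < k then quot_coef k (k - 1 - j) else 0)" for j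
  proof (cases "j \<le> d")
    case True
    have "(\<Sum>i\<le>d. if N - 1 - j = N - 1 - i then ?c i else 0) = (\<Sum>i\<le>d. if i = j then ?c i else 0)"
      using True by (intro sum.cong) (auto simp: N_def)
    also have "\<dots> = ?c j" using True by simp
    finally have s: "(\<Sum>i\<le>d. if N - 1 - j = N - 1 - i then ?c i else 0) = ?c j" .
    have "N - 1 - j < N" by (simp add: N_def)
    hence "(if N - 1 - j < d + 1 then 0 else quot_coef k (N - 1 - j - (d + 1))) = ?c j"
      using nth[of "N - 1 - j"] s by simp
    moreover have "N - 1 - j < d + 1 \<longleftrightarrow> \<not> j < k" using True by (auto simp: N_def)
    moreover have "N - 1 - j - (d + 1) = k - 1 - j" by (simp add: N_def)
    ultimately show ?thesis by (simp only:) presburger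
  next
    case False
    hence c0: "?c j = 0" by (simp add: d_def coeff_eq_0)
    show ?thesis
    proof (cases "j < k")
      case True
      \<comment> \<open>The degree \<open>d\<close> is not known in advance. Beyond it, the
        comparison shows that the Laurent coefficient vanishes as well.\<close>
      have "(\<Sum>i\<le>d. if N - 1 - j = N - 1 - i then ?c i else 0) = 0"
        using True False by (intro sum.neutral) (auto simp: N_def)
      hence "quot_coef k (N - 1 - j - (d + 1)) = 0"
        using nth[of "N - 1 - j"] True False by (auto simp: N_def split: if_splits)
      thus ?thesis using c0 True by (simp add: N_def)
    qed (use c0 in simp)
  qed
  have m3: "M m = (-1) ^ m * fact m * quot_coef k (k + m)" for m
    unfolding m1[symmetric] \<gamma>_def by (simp add: minus_one_power_iff)
  show thesis
    by (rule that[OF \<eta>, of p]) (use int m2 m3 in \<open>simp_all only: g_def e_def M_def\<close>)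
qed

section \<open>Series expansion of phi\<close>

lemma bessel_J0_sums:
  assumes "0 \<le> (y::real)"
  shows "(\<lambda>m. (-1) ^ m / (fact m)\<^sup>2 * y ^ m) sums bessel_J0 (2 * sqrt y)"
proof -
  have "(2 * sqrt y / 2) ^ (2 * m) = y ^ m" for m
    using assms by (simp add: power_mult)
  hence eq: "bessel_J0 (2 * sqrt y) = (\<Sum>m. (-1) ^ m / (fact m)\<^sup>2 * y ^ m)"
    unfolding bessel_J0_def by (simp only:) simp
  have "summable (\<lambda>m. (-1) ^ m / (fact m)\<^sup>2 * y ^ m)"
  proof (rule summable_comparison_test'[OF summable_exp[of y]])
    fix m
    have "y ^ m / (fact m)\<^sup>2 \<le> y ^ m / fact m"
      using assms self_le_power[of "fact m :: real" 2] by (intro divide_left_mono) auto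
    moreover have "norm ((-1) ^ m / (fact m)\<^sup>2 * y ^ m) = y ^ m / (fact m)\<^sup>2"
      using assms by (simp add: abs_mult power_abs)
    ultimately show "norm ((-1) ^ m / (fact m)\<^sup>2 * y ^ m) \<le> inverse (fact m) * y ^ m"
      by (simp add: divide_inverse mult.commute)
  qed
  thus ?thesis unfolding eq by (rule summable_sums)
qed

text \<open>The polynomial found by the elementary argument has the coefficients of
  \<open>P_poly\<close>, so the remainder is \<open>Delta\<close>. In the termwise integral, the
  sign and one of the two factorials of the Bessel coefficients cancel against the moment.\<close>

lemma phi_sums_quot_coef:
  assumes k: "1 \<le> k"
  obtains K \<eta> where "0 < \<eta>" "\<And>m. norm (quot_coef k (k + m)) \<le> K / \<eta> ^ m"
    "\<And>x. 0 \<le> x \<Longrightarrow> (\<lambda>m. quot_coef k (k + m) / fact m * of_real x ^ m) sums phi k x"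
proof -
  obtain p \<eta> where \<eta>: "0 < \<eta>"
    and int: "integrable lborel (\<lambda>r. norm (indicator {1..} r * of_real (((Tsum ^^ k) unit_step r - r * poly p (ln r)) / r\<^sup>2) :: complex) * r powr \<eta>)"
    and p: "\<And>j. of_real (coeff p j * fact j) = (if j < k then quot_coef k (k - 1 - j) else 0)"
    and M: "\<And>m. (\<integral>r. indicator {1..} r * of_real (((Tsum ^^ k) unit_step r - r * poly p (ln r)) / r\<^sup>2) * of_real (ln r ^ m) \<partial>lborel)
       = (-1) ^ m * fact m * quot_coef k (k + m)"
    by (rule remainder_moments[of k]) blast
  define g where "g r = (indicator {1..} r * of_real (((Tsum ^^ k) unit_step r - r * poly p (ln r)) / r\<^sup>2) :: complex)" for r :: real
  have "degree p \<le> k - 1"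
  proof (rule degree_le, intro allI impI)
    fix j assume "k - 1 < j"
    hence "complex_of_real (coeff p j * fact j) = 0" using p[of j] by simp
    thus "coeff p j = 0" by (simp only: of_real_eq_0_iff mult_eq_0_iff) simp
  qed
  hence "of_real (poly p X) = P_poly k X" for X
  proof -
    assume d: "degree p \<le> k - 1"
    have "poly p X = (\<Sum>j\<le>k - 1. coeff p j * X ^ j)"
      unfolding poly_altdef using d by (intro sum.mono_neutral_left) (auto simp: coeff_eq_0)
    hence "complex_of_real (poly p X) = (\<Sum>j\<le>k - 1. of_real (coeff p j) * of_real X ^ j)" by simp
    also have "\<dots> = P_poly k X" unfolding P_poly_def atLeast0AtMost
    proof (intro sum.cong refl)
      fix j assume "j \<in> {..k - 1}"
      hence "a_coef j k = of_real (coeff p j * fact j)" using p[of j] k by (simp add: a_coef_conv_quot_coef)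
      thus "of_real (coeff p j) * of_real X ^ j = a_coef j k / fact j * of_real X ^ j" by simp
    qed
    finally show ?thesis .
  qed
  hence Delta: "Delta k r = of_real ((Tsum ^^ k) unit_step r - r * poly p (ln r))" for r
    unfolding Delta_def sum_dk_conv_Tsum[symmetric] by simp
  have g: "g r = indicator {1..} r * Delta k r / of_real (r\<^sup>2)" for r by (simp add: g_def Delta)
  have [measurable]: "g \<in> borel_measurable borel" unfolding g[abs_def] by measurable
  have g0: "g r = 0" if "r < 1" for r using that by (simp add: g_def)
  note int = int[folded g_def] and M = M[folded g_def]
  define K where "K = (\<integral>r. norm (g r) * r powr \<eta> \<partial>lborel)"
  have "norm (quot_coef k (k + m)) \<le> K / \<eta> ^ m" for m
  proof -
    have "norm (\<integral>r. g r * of_real (ln r ^ m) \<partial>lborel) \<le> K * (fact m / \<eta> ^ m)"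
      unfolding K_def by (rule log_moments(2)[OF _ g0 \<eta> int]) measurable
    hence "fact m * norm (quot_coef k (k + m)) \<le> fact m * (K / \<eta> ^ m)"
      unfolding M by (simp add: norm_mult norm_power mult_ac)
    thus ?thesis by (simp only: mult_le_cancel_left_pos fact_gt_zero)
  qed
  moreover have "(\<lambda>m. quot_coef k (k + m) / fact m * of_real x ^ m) sums phi k x" if x: "0 \<le> x" for x
  proof -
    let ?a = "\<lambda>m. (-1) ^ m / (fact m)\<^sup>2 * x ^ m"
    have "(\<lambda>m. of_real (?a m) * (\<integral>r. g r * of_real (ln r ^ m) \<partial>lborel)) sums (\<integral>r. g r * of_real (bessel_J0 (2 * sqrt (x * ln r))) \<partial>lborel)"
    proof (rule log_moments(3)[OF _ g0 \<eta> int])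
      \<comment> \<open>One factorial survives, so the majorant is an exponential series, convergent
        for every \<open>x\<close>.\<close>
      have "\<bar>?a m\<bar> * (fact m / \<eta> ^ m) = inverse (fact m) * (x / \<eta>) ^ m" for m
        using x \<eta> by (simp add: abs_mult abs_div power_divide power2_eq_square field_simps)
      thus "summable (\<lambda>m. \<bar>?a m\<bar> * (fact m / \<eta> ^ m))" using summable_exp[of "x / \<eta>"] by simp
      show "(\<lambda>m. ?a m * y ^ m) sums bessel_J0 (2 * sqrt (x * y))" if "0 \<le> y" for y
        using bessel_J0_sums[of "x * y"] x that by (simp add: power_mult_distrib mult_ac)
    qed measurable
    moreover have "of_real (?a m) * (\<integral>r. g r * of_real (ln r ^ m) \<partial>lborel) = quot_coef k (k + m) / fact m * of_real x ^ m" for m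
      unfolding M by (simp add: power2_eq_square field_simps minus_one_power_iff)
    moreover have "(\<integral>r. g r * of_real (bessel_J0 (2 * sqrt (x * ln r))) \<partial>lborel) = phi k x"
      unfolding phi_def set_lebesgue_integral_def
      by (intro Bochner_Integration.integral_cong) (auto simp: g indicator_def)
    ultimately show ?thesis by (simp only:)
  qed
  ultimately show thesis using that \<eta> by blast
qed

text \<open>Multiplying by \<open>e\<^sup>x\<close> turns the coefficients into their binomial transforms.\<close>

lemma phi_sums_lag_coef:
  assumes k: "1 \<le> k" and x: "0 \<le> x"
  shows "(\<lambda>n. lag_coef k n * of_real (exp (- x) * x ^ n / fact n)) sums phi k x"
proof -
  obtain K \<eta> where \<eta>: "0 < \<eta>" and K: "\<And>m. norm (quot_coef k (k + m)) \<le> K / \<eta> ^ m"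
    and phi: "(\<lambda>m. quot_coef k (k + m) / fact m * of_real x ^ m) sums phi k x"
    by (rule phi_sums_quot_coef[OF k]) (use x in blast)
  let ?a = "\<lambda>m. quot_coef k (k + m) / fact m * of_real x ^ m"
  let ?b = "\<lambda>m. of_real (x ^ m / fact m) :: complex"
  have b: "?b sums of_real (exp x)"
    using exp_converges[of x] by (intro sums_of_real) (simp add: scaleR_conv_of_real field_simps)
  have sK: "summable (\<lambda>m. K * (inverse (fact m) * (x / \<eta>) ^ m))" by (intro summable_mult summable_exp)
  have "norm (norm (?a m)) \<le> K * (inverse (fact m) * (x / \<eta>) ^ m)" for m
  proof -
    have "norm (?a m) = norm (quot_coef k (k + m)) * (x ^ m / fact m)" using x by (simp add: norm_mult norm_divide norm_power)
    also have "\<dots> \<le> K / \<eta> ^ m * (x ^ m / fact m)" using x by (intro mult_right_mono K) auto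
    finally show ?thesis by (simp add: power_divide field_simps)
  qed
  hence sa: "summable (\<lambda>m. norm (?a m))" by (rule summable_comparison_test'[OF sK])
  have "summable (\<lambda>m. norm (?b m))" using summable_exp[of x] x by (simp add: norm_divide norm_power field_simps)
  from Cauchy_product_sums[OF sa this]
  have "(\<lambda>n. \<Sum>i\<le>n. ?a i * ?b (n - i)) sums (phi k x * of_real (exp x))"
    using phi b by (simp add: sums_iff)
  moreover have "(\<Sum>i\<le>n. ?a i * ?b (n - i)) = lag_coef k n * of_real (x ^ n / fact n)" for n
    unfolding lag_coef_conv_quot_coef sum_distrib_right
  proof (intro sum.cong refl)
    fix i assume "i \<in> {..n}"
    hence i: "i \<le> n" by simp
    have "of_nat (n choose i) = fact n / (fact i * fact (n - i) :: complex)" using i by (rule binomial_fact)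
    moreover have "x ^ n = x ^ i * x ^ (n - i)" using i by (simp add: power_add[symmetric])
    ultimately show "?a i * ?b (n - i) = of_nat (n choose i) * quot_coef k (k + i) * of_real (x ^ n / fact n)"
      by (simp add: field_simps)
  qed
  ultimately have "(\<lambda>n. lag_coef k n * of_real (x ^ n / fact n)) sums (phi k x * of_real (exp x))" by simp
  from sums_mult[OF this, of "of_real (exp (- x))"]
  have "(\<lambda>n. of_real (exp (- x)) * (lag_coef k n * of_real (x ^ n / fact n))) sums (phi k x * (of_real (exp (- x)) * of_real (exp x)))"
    by (simp only: mult_ac)
  moreover have "of_real (exp (- x)) * of_real (exp x) = (1 :: complex)"
    by (simp add: exp_minus)
  moreover have "of_real (exp (- x)) * (lag_coef k n * of_real (x ^ n / fact n)) = lag_coef k n * of_real (exp (- x) * x ^ n / fact n)" for n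
    by simp
  ultimately show ?thesis by (simp only: mult_1_right)
qed

text \<open>Write each weight as a product of two square roots; total weight at most 1 removes the
  second factor.\<close>

lemma cauchy_schwarz_weighted:
  fixes c :: "nat \<Rightarrow> complex" and e :: "nat \<Rightarrow> real"
  assumes e: "\<And>n. 0 \<le> e n" and s: "(\<Sum>n\<in>A. e n) \<le> 1"
  shows "(norm (\<Sum>n\<in>A. c n * of_real (e n)))\<^sup>2 \<le> (\<Sum>n\<in>A. (norm (c n))\<^sup>2 * e n)"
proof -
  have "norm (\<Sum>n\<in>A. c n * of_real (e n)) \<le> (\<Sum>n\<in>A. (norm (c n) * sqrt (e n)) * sqrt (e n))"
    using e by (intro order_trans[OF norm_sum] sum_mono) (simp add: norm_mult mult.assoc)
  hence "(norm (\<Sum>n\<in>A. c n * of_real (e n)))\<^sup>2 \<le> (\<Sum>n\<in>A. (norm (c n) * sqrt (e n)) * sqrt (e n))\<^sup>2"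
    by (intro power_mono) auto
  also have "\<dots> \<le> (\<Sum>n\<in>A. (norm (c n) * sqrt (e n))\<^sup>2) * (\<Sum>n\<in>A. (sqrt (e n))\<^sup>2)"
    by (rule Cauchy_Schwarz_ineq_sum)
  also have "\<dots> = (\<Sum>n\<in>A. (norm (c n))\<^sup>2 * e n) * (\<Sum>n\<in>A. e n)"
    using e by (simp add: power_mult_distrib)
  also have "\<dots> \<le> (\<Sum>n\<in>A. (norm (c n))\<^sup>2 * e n) * 1"
    using e s by (intro mult_left_mono sum_nonneg) auto
  finally show ?thesis by simp
qed

lemma L2_convergence_if_square_summable:
  assumes k: "1 \<le> k" and sm: "summable (\<lambda>n. (norm (lag_coef k n))\<^sup>2)"
  shows "(\<lambda>N. \<integral>\<^sup>+ x\<in>{0..}. ennreal ((cmod (phi_N N k x - phi k x))\<^sup>2) \<partial>lborel) \<longlonglongrightarrow> 0"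
proof -
  define e where "e n x = exp (- x) * x ^ n / fact n" for n and x :: real
  have [measurable]: "e n \<in> borel_measurable borel" for n unfolding e_def by measurable
  have e0: "0 \<le> e n x" if "0 \<le> x" for n x using that by (simp add: e_def)
  have e1: "(\<lambda>n. e n x) sums 1" for x
    using sums_mult[OF exp_converges[of x], of "exp (- x)"] by (simp add: e_def exp_minus field_simps)
  let ?t = "\<lambda>N. \<Sum>n. (norm (lag_coef k (n + Suc N)))\<^sup>2"
  have bound: "(\<integral>\<^sup>+ x\<in>{0..}. ennreal ((cmod (phi_N N k x - phi k x))\<^sup>2) \<partial>lborel) \<le> ennreal (?t N)" for N
  proof -
    let ?c = "\<lambda>n. lag_coef k (n + Suc N)" and ?e = "\<lambda>n. e (n + Suc N)"
    let ?q = "\<lambda>n. (norm (?c n))\<^sup>2"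
    have ptw: "ennreal ((cmod (phi_N N k x - phi k x))\<^sup>2) \<le> (\<Sum>n. ennreal (?q n * ?e n x))"
      if x: "0 \<le> x" for x
    proof -
      have "phi_N N k x = (\<Sum>n<Suc N. lag_coef k n * of_real (e n x))"
        unfolding phi_N_conv sum_distrib_left lessThan_Suc_atMost by (intro sum.cong) (auto simp: e_def)
      moreover have "(\<lambda>n. lag_coef k n * of_real (e n x)) sums phi k x"
        using phi_sums_lag_coef[OF k x] by (simp add: e_def)
      ultimately have "(\<lambda>n. ?c n * of_real (?e n x)) sums (phi k x - phi_N N k x)"
        using sums_split_initial_segment[of _ _ "Suc N"] by (simp only:)
      hence lim: "(\<lambda>M. ennreal ((norm (\<Sum>n<M. ?c n * of_real (?e n x)))\<^sup>2)) \<longlonglongrightarrow> ennreal ((norm (phi k x - phi_N N k x))\<^sup>2)"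
        unfolding sums_def by (intro tendsto_ennrealI tendsto_power tendsto_norm)
      have "ennreal ((norm (phi k x - phi_N N k x))\<^sup>2) \<le> (\<Sum>n. ennreal (?q n * ?e n x))"
      \<comment> \<open>Cauchy-Schwarz is applied to finite blocks, whose weights are distinct terms
        of a series with sum 1, and the limit is taken afterwards.\<close>
      proof (rule LIMSEQ_le_const2[OF lim], intro exI allI impI)
        fix M :: nat
        have "(\<Sum>n<M. ?e n x) = (\<Sum>n\<in>(\<lambda>n. n + Suc N) ` {..<M}. e n x)"
          by (subst sum.reindex) (auto simp: inj_on_def)
        also have "\<dots> \<le> 1"
          using e1[of x] e0[OF x] sum_le_suminf[of "\<lambda>n. e n x"] by (simp add: sums_iff)
        finally have "(norm (\<Sum>n<M. ?c n * of_real (?e n x)))\<^sup>2 \<le> (\<Sum>n<M. ?q n * ?e n x)"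
          using e0[OF x] by (intro cauchy_schwarz_weighted)
        hence "ennreal ((norm (\<Sum>n<M. ?c n * of_real (?e n x)))\<^sup>2) \<le> (\<Sum>n<M. ennreal (?q n * ?e n x))"
          using e0[OF x] by (subst sum_ennreal) (auto intro!: ennreal_leI)
        also have "\<dots> \<le> (\<Sum>n. ennreal (?q n * ?e n x))"
          by (intro sum_le_suminf) auto
        finally show "ennreal ((norm (\<Sum>n<M. ?c n * of_real (?e n x)))\<^sup>2) \<le> (\<Sum>n. ennreal (?q n * ?e n x))" .
      qed
      thus ?thesis by (simp only: norm_minus_commute)
    qed
    have "(\<integral>\<^sup>+ x\<in>{0..}. ennreal ((cmod (phi_N N k x - phi k x))\<^sup>2) \<partial>lborel)
        \<le> (\<integral>\<^sup>+ x. (\<Sum>n. ennreal (?q n) * (ennreal (?e n x) * indicator {0..} x)) \<partial>lborel)"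
    proof (intro nn_integral_mono)
      fix x :: real
      show "ennreal ((cmod (phi_N N k x - phi k x))\<^sup>2) * indicator {0..} x \<le> (\<Sum>n. ennreal (?q n) * (ennreal (?e n x) * indicator {0..} x))"
      proof (cases "0 \<le> x")
        case True
        thus ?thesis using ptw[OF True] by (simp add: ennreal_mult')
      qed auto
    qed
    also have "\<dots> = (\<Sum>n. \<integral>\<^sup>+ x. ennreal (?q n) * (ennreal (?e n x) * indicator {0..} x) \<partial>lborel)"
      by (rule nn_integral_suminf) measurable
    also have "\<dots> = (\<Sum>n. ennreal (?q n))"
    proof (intro suminf_cong)
      fix n
      have "(\<integral>\<^sup>+ x. ennreal (?q n) * (ennreal (?e n x) * indicator {0..} x) \<partial>lborel)
         = ennreal (?q n) * (\<integral>\<^sup>+ x\<in>{0..}. ennreal (?e n x) \<partial>lborel)"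
        by (rule nn_integral_cmult) measurable
      also have "(\<integral>\<^sup>+ x\<in>{0..}. ennreal (?e n x) \<partial>lborel) = 1"
        unfolding e_def by (rule nn_integral_poisson)
      finally show "(\<integral>\<^sup>+ x. ennreal (?q n) * (ennreal (?e n x) * indicator {0..} x) \<partial>lborel) = ennreal (?q n)"
        by simp
    qed
    also have "\<dots> = ennreal (?t N)"
      using summable_ignore_initial_segment[OF sm, of "Suc N"] by (intro suminf_ennreal2) simp_all
    finally show ?thesis .
  qed
  have "?t \<longlonglongrightarrow> 0"
    using LIMSEQ_Suc[OF suminf_exist_split2[OF sm]] by simp
  hence "(\<lambda>N. ennreal (?t N)) \<longlonglongrightarrow> 0" using tendsto_ennrealI by fastforce
  thus ?thesis
    by (rule tendsto_sandwich[rotated 3, where f = "\<lambda>_. 0"]) (simp_all only: bound zero_le eventually_True tendsto_const)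
qed

section \<open>Square summability of the coefficients\<close>

text \<open>For \<open>y = \<bar>\<theta>\<bar> / 2 \<le> 2\<close>, the sine series gives
  \<open>sin y \<ge> y / 3\<close>. The squared distance is at least
  \<open>2 * \<rho> * (1 - cos \<theta>)\<close>, hence at least \<open>2 * (sin y)\<^sup>2\<close>
  as \<open>\<rho> \<ge> 1/2\<close>, and this exceeds \<open>\<theta>\<^sup>2 / 25\<close>.\<close>

lemma norm_one_minus_cis_ge:
  fixes \<rho> \<theta> :: real
  assumes "1/2 \<le> \<rho>" "\<bar>\<theta>\<bar> \<le> pi"
  shows "\<bar>\<theta>\<bar> / 5 \<le> norm (1 - of_real \<rho> * cis \<theta>)"
proof (rule power2_le_imp_le)
  define y where "y = \<bar>\<theta>\<bar> / 2"
  have y: "0 \<le> y" "y \<le> 2" using assms pi_half_less_two by (auto simp: y_def)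
  have "(\<Sum>m<3. sin_coeff m * y ^ m) = y"
    by (simp add: eval_nat_numeral sin_coeff_def)
  hence "\<bar>sin y - y\<bar> \<le> inverse (fact 3) * \<bar>y\<bar> ^ 3"
    using Maclaurin_sin_bound[of y 3] by simp
  also have "\<dots> = y * y\<^sup>2 / 6" using y by (simp add: eval_nat_numeral)
  also have "\<dots> \<le> y * 2\<^sup>2 / 6" using y by (intro divide_right_mono mult_left_mono power_mono) auto
  finally have "y / 3 \<le> sin y" using abs_le_D2 by fastforce
  hence "(y / 3)\<^sup>2 \<le> (sin y)\<^sup>2" using y by (intro power_mono) auto
  moreover have "cos \<theta> = 1 - 2 * (sin y)\<^sup>2"
    using cos_double_sin[of y] by (simp add: y_def)
  ultimately have c: "2 * (\<bar>\<theta>\<bar> / 6)\<^sup>2 \<le> 1 - cos \<theta>" by (simp add: y_def)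
  have "(norm (1 - of_real \<rho> * cis \<theta>))\<^sup>2 = (1 - \<rho>)\<^sup>2 + 2 * \<rho> * (1 - cos \<theta>)"
  proof -
    have "(norm (1 - of_real \<rho> * cis \<theta>))\<^sup>2 = (1 - \<rho> * cos \<theta>)\<^sup>2 + (\<rho> * sin \<theta>)\<^sup>2"
      by (simp add: cmod_power2)
    also have "\<dots> = 1 - 2 * \<rho> * cos \<theta> + \<rho>\<^sup>2 * ((sin \<theta>)\<^sup>2 + (cos \<theta>)\<^sup>2)"
      by algebra
    also have "\<dots> = 1 - 2 * \<rho> * cos \<theta> + \<rho>\<^sup>2" by (simp only: sin_cos_squared_add mult_1_right)
    finally show ?thesis by (simp add: power2_eq_square algebra_simps)
  qed
  also have "\<dots> \<ge> 0 + 1 * (1 - cos \<theta>)"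
    using assms by (intro add_mono mult_right_mono) auto
  finally have "1 - cos \<theta> \<le> (norm (1 - of_real \<rho> * cis \<theta>))\<^sup>2" by simp
  moreover have "(\<bar>\<theta>\<bar> / 5)\<^sup>2 \<le> 2 * (\<bar>\<theta>\<bar> / 6)\<^sup>2" by (simp add: power_divide)
  ultimately show "(\<bar>\<theta>\<bar> / 5)\<^sup>2 \<le> (norm (1 - of_real \<rho> * cis \<theta>))\<^sup>2" using c by linarith
qed simp

lemma has_integral_cis_int:
  "((\<lambda>\<theta>. cis (of_int m * \<theta>)) has_integral (if m = 0 then 2 * of_real pi else 0)) {- pi..pi}"
proof (cases "m = 0")
  case True
  thus ?thesis using has_integral_const_real[of "1::complex" "- pi" pi] by (simp add: scaleR_conv_of_real)
next
  case False
  let ?F = "\<lambda>\<theta>. exp (\<i> * of_int m * of_real \<theta>) / (\<i> * of_int m)"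
  have "((\<lambda>\<theta>. exp (\<i> * of_int m * of_real \<theta>)) has_integral (?F pi - ?F (- pi))) {- pi..pi}"
  proof (rule fundamental_theorem_of_calculus)
    fix \<theta> :: real
    have "((\<lambda>\<theta>. \<i> * of_int m * complex_of_real \<theta>) has_vector_derivative (\<i> * of_int m * of_real 1)) (at \<theta> within {- pi..pi})"
      by (intro has_vector_derivative_mult_right has_vector_derivative_of_real DERIV_ident)
    moreover have "((\<lambda>z. exp z / (\<i> * of_int m)) has_field_derivative exp y / (\<i> * of_int m)) (at y within S)" for y S
      using False by (auto intro!: derivative_eq_intros)
    ultimately show "(?F has_vector_derivative exp (\<i> * of_int m * of_real \<theta>)) (at \<theta> within {- pi..pi})"
      using field_vector_diff_chain_within False by (fastforce simp: o_def)
  qed simp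
  moreover have "exp (\<i> * of_int m * of_real \<theta>) = cis (of_int m * \<theta>)" for \<theta>
    by (simp add: cis_conv_exp mult_ac)
  ultimately have "((\<lambda>\<theta>. cis (of_int m * \<theta>)) has_integral
      (cis (of_int m * pi) / (\<i> * of_int m) - cis (of_int m * (- pi)) / (\<i> * of_int m))) {- pi..pi}"
    by (simp only:)
  moreover have "cis (of_int m * (- pi)) = cis (of_int m * pi)"
    using sin_npi_int[of m] by (simp add: complex_eq_iff mult.commute)
  ultimately show ?thesis using False by (simp only: diff_self if_False)
qed

lemma parseval_polynomial:
  fixes a :: "nat \<Rightarrow> complex"
  shows "((\<lambda>\<theta>. (norm (\<Sum>n\<le>M. a n * cis (real n * \<theta>)))\<^sup>2) has_integral (2 * pi * (\<Sum>n\<le>M. (norm (a n))\<^sup>2))) {- pi..pi}"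
proof -
  let ?S = "\<lambda>\<theta>. \<Sum>n\<le>M. a n * cis (real n * \<theta>)"
  let ?p = "\<lambda>n m. if int n - int m = 0 then 2 * of_real pi else 0 :: complex"
  have eq: "complex_of_real ((norm (?S \<theta>))\<^sup>2) = (\<Sum>n\<le>M. \<Sum>m\<le>M. a n * cnj (a m) * cis (of_int (int n - int m) * \<theta>))" for \<theta>
  proof -
    have "complex_of_real ((norm (?S \<theta>))\<^sup>2) = (?S \<theta>) * cnj (\<Sum>m\<le>M. a m * cis (real m * \<theta>))"
      by (rule complex_norm_square)
    also have "\<dots> = (\<Sum>n\<le>M. \<Sum>m\<le>M. (a n * cis (real n * \<theta>)) * (cnj (a m) * cis (- (real m * \<theta>))))"
      by (simp add: sum_product cis_cnj)
    also have "\<dots> = (\<Sum>n\<le>M. \<Sum>m\<le>M. a n * cnj (a m) * cis (of_int (int n - int m) * \<theta>))"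
    proof (intro sum.cong refl)
      fix n m
      have "cis (of_int (int n - int m) * \<theta>) = cis (real n * \<theta>) * cis (- (real m * \<theta>))"
        unfolding cis_mult by (simp add: algebra_simps)
      thus "(a n * cis (real n * \<theta>)) * (cnj (a m) * cis (- (real m * \<theta>))) = a n * cnj (a m) * cis (of_int (int n - int m) * \<theta>)"
        by (simp add: mult_ac)
    qed
    finally show ?thesis .
  qed
  have "((\<lambda>\<theta>. \<Sum>n\<le>M. \<Sum>m\<le>M. a n * cnj (a m) * cis (of_int (int n - int m) * \<theta>)) has_integral
     (\<Sum>n\<le>M. \<Sum>m\<le>M. a n * cnj (a m) * ?p n m)) {- pi..pi}"
    by (intro has_integral_sum has_integral_mult_right has_integral_cis_int) auto
  also have "(\<Sum>n\<le>M. \<Sum>m\<le>M. a n * cnj (a m) * ?p n m) = of_real (2 * pi * (\<Sum>n\<le>M. (norm (a n))\<^sup>2))"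
  proof -
    have "(\<Sum>m\<le>M. a n * cnj (a m) * ?p n m) = of_real (2 * pi * (norm (a n))\<^sup>2)" if "n \<le> M" for n
    proof -
      have "(\<Sum>m\<le>M. a n * cnj (a m) * ?p n m) = (\<Sum>m\<le>M. if m = n then a n * cnj (a m) * (2 * of_real pi) else 0)"
        by (intro sum.cong) auto
      also have "\<dots> = a n * cnj (a n) * (2 * of_real pi)" using that by simp
      also have "\<dots> = of_real (2 * pi * (norm (a n))\<^sup>2)" unfolding complex_norm_square[symmetric] by simp
      finally show ?thesis .
    qed
    thus ?thesis by (simp add: sum_distrib_left)
  qed
  finally have "((\<lambda>\<theta>. complex_of_real ((norm (?S \<theta>))\<^sup>2)) has_integral of_real (2 * pi * (\<Sum>n\<le>M. (norm (a n))\<^sup>2))) {- pi..pi}"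
    by (simp only: eq)
  from has_integral_linear[OF this bounded_linear_Re] show ?thesis
    by (simp only: o_def Re_complex_of_real)
qed

lemma has_integral_abs_powr:
  fixes c :: real
  assumes "0 \<le> c"
  shows "((\<lambda>x. \<bar>x\<bar> powr (- 1/2)) has_integral 4 * c powr (1/2)) {- c..c}"
proof -
  have 1: "((\<lambda>x. x powr (- 1/2)) has_integral 2 * c powr (1/2)) {0..c}"
    using has_integral_powr_from_0[of "- 1/2" c] assms by (simp add: mult.commute)
  hence 2: "((\<lambda>x. (- x) powr (- 1/2)) has_integral 2 * c powr (1/2)) {- c..- 0}"
    by (subst has_integral_reflect_real)
  have "((\<lambda>x. \<bar>x\<bar> powr (- 1/2)) has_integral 2 * c powr (1/2)) {0..c}"
    by (rule has_integral_eq[OF _ 1]) auto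
  moreover have "((\<lambda>x. \<bar>x\<bar> powr (- 1/2)) has_integral 2 * c powr (1/2)) {- c..0}"
    by (rule has_integral_eq[OF _ 2[simplified]]) auto
  ultimately have "((\<lambda>x. \<bar>x\<bar> powr (- 1/2)) has_integral 2 * c powr (1/2) + 2 * c powr (1/2)) {- c..c}"
    using assms by (intro has_integral_combine[of "- c" 0 c]) auto
  thus ?thesis by simp
qed

text \<open>Hardy space argument: the bound by \<open>\<bar>1 - z\<bar> powr (-1/4)\<close> is square integrable on the unit circle.\<close>

lemma taylor_coefs_square_summable:
  fixes c :: "nat \<Rightarrow> complex"
  assumes H: "\<And>z. norm z < 1 \<Longrightarrow> (\<lambda>n. c n * z ^ n) sums h z"
    and C: "\<And>z. norm z < 1 \<Longrightarrow> norm (h z) \<le> C * norm (1 - z) powr (- 1/4)"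
  shows "summable (\<lambda>n. (norm (c n))\<^sup>2)"
proof -
  \<comment> \<open>The integral over \<open>{- pi..pi}\<close> of the majorant of the squared
    truncations; it depends neither on the radius nor on the truncation.\<close>
  define B where "B = 2 * C\<^sup>2 * 5 powr (1/2) * (4 * pi powr (1/2)) + 2 * (2 * pi)"
  have circle: "2 * pi * (\<Sum>n\<le>N. (norm (c n))\<^sup>2 * (\<rho>\<^sup>2) ^ n) \<le> B" if \<rho>: "1/2 \<le> \<rho>" "\<rho> < 1" for \<rho> N
  proof -
    define z where "z \<theta> = of_real \<rho> * cis \<theta>" for \<theta>
    have nz: "norm (z \<theta>) = \<rho>" for \<theta> using \<rho> by (simp add: z_def norm_mult)
    have zn: "z \<theta> ^ n = of_real (\<rho> ^ n) * cis (real n * \<theta>)" for \<theta> n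
      by (simp add: z_def power_mult_distrib Complex.DeMoivre)
    have abs: "summable (\<lambda>n. norm (c n) * \<rho> ^ n)"
    proof -
      define q where "q = (1 + \<rho>) / 2"
      have q: "\<rho> < q" "q < 1" "0 < q" using \<rho> by (auto simp: q_def)
      have "summable (\<lambda>n. c n * of_real q ^ n)"
        using H[of "of_real q"] q by (intro sums_summable[of _ "h (of_real q)"]) auto
      hence "summable (\<lambda>n. norm (c n * of_real \<rho> ^ n))"
        by (rule powser_insidea) (use \<rho> q in auto)
      thus ?thesis using \<rho> by (simp add: norm_mult norm_power)
    qed
    obtain M0 where M0: "\<And>n. M0 \<le> n \<Longrightarrow> norm (\<Sum>i. norm (c (i + n)) * \<rho> ^ (i + n)) < 1"
      using suminf_exist_split[OF zero_less_one abs] by blast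
    \<comment> \<open>Truncating here gives a trigonometric polynomial, to which Parseval applies
      directly, while the discarded tail stays below 1 for every angle.\<close>
    define M where "M = max M0 N"
    define T where "T \<theta> = (\<Sum>n\<le>M. (c n * of_real (\<rho> ^ n)) * cis (real n * \<theta>))" for \<theta>
    have T: "T \<theta> = (\<Sum>n<Suc M. c n * z \<theta> ^ n)" for \<theta>
      by (simp add: T_def zn lessThan_Suc_atMost mult.assoc)
    have tail: "norm (T \<theta>) \<le> norm (h (z \<theta>)) + 1" for \<theta>
    proof -
      have "(\<lambda>n. c (n + Suc M) * z \<theta> ^ (n + Suc M)) sums (h (z \<theta>) - T \<theta>)"
        unfolding T using \<rho> by (intro sums_split_initial_segment H) (simp add: nz)
      hence "norm (h (z \<theta>) - T \<theta>) = norm (\<Sum>n. c (n + Suc M) * z \<theta> ^ (n + Suc M))" by (simp only: sums_iff)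
      also have "\<dots> \<le> (\<Sum>n. norm (c (n + Suc M)) * \<rho> ^ (n + Suc M))"
        by (intro norm_suminf_le summable_ignore_initial_segment[OF abs]) (simp only: norm_mult norm_power nz)
      also have "\<dots> \<le> 1"
      proof -
        have "norm (\<Sum>n. norm (c (n + Suc M)) * \<rho> ^ (n + Suc M)) < 1" by (rule M0) (simp add: M_def)
        thus ?thesis unfolding real_norm_def by linarith
      qed
      finally have "norm (T \<theta> - h (z \<theta>)) \<le> 1" by (simp add: norm_minus_commute)
      thus ?thesis using norm_triangle_ineq[of "T \<theta> - h (z \<theta>)" "h (z \<theta>)"] by simp
    qed
    have bd: "(norm (T \<theta>))\<^sup>2 \<le> 2 * C\<^sup>2 * 5 powr (1/2) * \<bar>\<theta>\<bar> powr (- 1/2) + 2" if \<theta>: "\<theta> \<in> {- pi..pi}" "\<theta> \<noteq> 0" for \<theta>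
    proof -
      have le: "\<bar>\<theta>\<bar> / 5 \<le> norm (1 - z \<theta>)" unfolding z_def using \<rho> \<theta> by (intro norm_one_minus_cis_ge) auto
      have "(norm (T \<theta>))\<^sup>2 \<le> (norm (h (z \<theta>)) + 1)\<^sup>2" using tail by (intro power_mono) auto
      also have "\<dots> \<le> 2 * (norm (h (z \<theta>)))\<^sup>2 + 2"
        using zero_le_power2[of "norm (h (z \<theta>)) - 1"] by (simp add: power2_eq_square algebra_simps)
      also have "(norm (h (z \<theta>)))\<^sup>2 \<le> (C * norm (1 - z \<theta>) powr (- 1/4))\<^sup>2"
        using \<rho> by (intro power_mono C) (auto simp: nz)
      also have "\<dots> = C\<^sup>2 * norm (1 - z \<theta>) powr (- 1/2)"
        by (simp add: power_mult_distrib) (simp add: power2_eq_square powr_add[symmetric])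
      also have "\<dots> \<le> C\<^sup>2 * (\<bar>\<theta>\<bar> / 5) powr (- 1/2)"
        using le \<theta> by (intro mult_left_mono powr_mono2') auto
      also have "(\<bar>\<theta>\<bar> / 5) powr (- 1/2) = 5 powr (1/2) * \<bar>\<theta>\<bar> powr (- 1/2)"
        using powr_minus_divide[of "5::real" "1/2"] by (simp add: powr_divide)
      finally show ?thesis by (simp add: mult_ac)
    qed
    \<comment> \<open>At \<open>\<theta> = 0\<close> the expression \<open>0 powr (- 1/2)\<close> is
      0 by convention and would not bound the left side, so the majorant is altered at this one
      point.\<close>
    define b where "b \<theta> = (if \<theta> = 0 then (norm (T 0))\<^sup>2 else 2 * C\<^sup>2 * 5 powr (1/2) * \<bar>\<theta>\<bar> powr (- 1/2) + 2)" for \<theta>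
    have "((\<lambda>\<theta>. 2 * C\<^sup>2 * 5 powr (1/2) * \<bar>\<theta>\<bar> powr (- 1/2) + 2) has_integral B) {- pi..pi}"
    proof -
      have "((\<lambda>\<theta>::real. 2::real) has_integral 2 * (2 * pi)) {- pi..pi}"
        using has_integral_const_real[of "2::real" "- pi" pi] by simp
      thus ?thesis unfolding B_def
        by (intro has_integral_add has_integral_mult_right has_integral_abs_powr) auto
    qed
    hence "(b has_integral B) {- pi..pi}"
      by (rule has_integral_spike_finite[of "{0}", rotated 2]) (auto simp: b_def)
    with parseval_polynomial[of "\<lambda>n. c n * of_real (\<rho> ^ n)" M]
    have "2 * pi * (\<Sum>n\<le>M. (norm (c n * of_real (\<rho> ^ n)))\<^sup>2) \<le> B"
      unfolding T_def[symmetric] by (rule has_integral_le) (use bd in \<open>auto simp: b_def\<close>)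
    moreover have "(norm (c n * of_real (\<rho> ^ n)))\<^sup>2 = (norm (c n))\<^sup>2 * (\<rho>\<^sup>2) ^ n" for n
      using \<rho> by (simp add: norm_mult norm_power power_mult_distrib power_mult[symmetric] mult.commute abs_of_nonneg)
    ultimately have "2 * pi * (\<Sum>n\<le>M. (norm (c n))\<^sup>2 * (\<rho>\<^sup>2) ^ n) \<le> B" by (simp only:)
    moreover have "(\<Sum>n\<le>N. (norm (c n))\<^sup>2 * (\<rho>\<^sup>2) ^ n) \<le> (\<Sum>n\<le>M. (norm (c n))\<^sup>2 * (\<rho>\<^sup>2) ^ n)"
      by (intro sum_mono2) (auto simp: M_def)
    ultimately show ?thesis using mult_left_mono[of _ _ "2 * pi"] by (meson order_trans pi_ge_zero mult_nonneg_nonneg zero_le_numeral)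
  qed
  have part: "2 * pi * (\<Sum>n\<le>N. (norm (c n))\<^sup>2) \<le> B" for N
  proof (rule LIMSEQ_le_const2)
    \<comment> \<open>The double successor makes the radii start at 1/2, the least radius allowed in
      \<open>circle\<close>.\<close>
    define \<rho> where "\<rho> j = 1 - inverse (real (Suc (Suc j)))" for j
    have "\<rho> \<longlonglongrightarrow> 1 - 0" unfolding \<rho>_def
      by (intro tendsto_diff tendsto_const LIMSEQ_Suc[OF LIMSEQ_inverse_real_of_nat])
    hence "(\<lambda>j. 2 * pi * (\<Sum>n\<le>N. (norm (c n))\<^sup>2 * ((\<rho> j)\<^sup>2) ^ n)) \<longlonglongrightarrow> 2 * pi * (\<Sum>n\<le>N. (norm (c n))\<^sup>2 * ((1 - 0)\<^sup>2) ^ n)"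
      by (intro tendsto_intros)
    thus "(\<lambda>j. 2 * pi * (\<Sum>n\<le>N. (norm (c n))\<^sup>2 * ((\<rho> j)\<^sup>2) ^ n)) \<longlonglongrightarrow> 2 * pi * (\<Sum>n\<le>N. (norm (c n))\<^sup>2)" by simp
    have "1/2 \<le> \<rho> j" "\<rho> j < 1" for j by (auto simp: \<rho>_def field_simps)
    thus "\<exists>M. \<forall>j\<ge>M. 2 * pi * (\<Sum>n\<le>N. (norm (c n))\<^sup>2 * ((\<rho> j)\<^sup>2) ^ n) \<le> B" using circle by blast
  qed
  show ?thesis
  proof (rule summableI_nonneg_bounded)
    fix N
    have "(\<Sum>n<N. (norm (c n))\<^sup>2) \<le> (\<Sum>n\<le>N. (norm (c n))\<^sup>2)" by (intro sum_mono2) auto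
    also have "\<dots> \<le> B / (2 * pi)" using part[of N] by (simp add: field_simps)
    finally show "(\<Sum>n<N. (norm (c n))\<^sup>2) \<le> B / (2 * pi)" .
  qed simp
qed

text \<open>The exponent \<open>1 / (4 k)\<close> for \<open>zeta\<close> becomes 1/4 for its
  \<open>k\<close>-th power, and \<open>s = 1 / (1 - z)\<close> turns a bound by
  \<open>\<bar>s\<bar> powr (1/4)\<close> into one by
  \<open>\<bar>1 - z\<bar> powr (- 1/4)\<close>.\<close>

lemma lag_coef_square_summable:
  assumes LH: "lindelof_hypothesis" and k: "1 \<le> k"
  shows "summable (\<lambda>n. (norm (lag_coef k n))\<^sup>2)"
proof -
  obtain E where E: "E holomorphic_on UNIV"
    "\<And>w. w \<noteq> 0 \<Longrightarrow> E w = zeta (1 + w) ^ k - (\<Sum>i<k. lam i k / fact i / w ^ (k - i)) - quot_coef k (k - 1)"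
    "\<And>z. norm z < 1 \<Longrightarrow> (\<lambda>n. lag_coef k n * z ^ n) sums E (z / (1 - z))"
    using regularised_zeta_power[OF k] by blast
  define A where "A = (\<Sum>i<k. norm (lam i k / fact i)) + norm (quot_coef k (k - 1))"
  have A0: "0 \<le> A" by (auto simp: A_def intro!: add_nonneg_nonneg sum_nonneg)
  have EA: "norm (E w) \<le> norm (zeta (1 + w)) ^ k + A" if w1: "1 \<le> norm w" for w
  proof -
    have w0: "w \<noteq> 0" using w1 by auto
    have "norm (\<Sum>i<k. lam i k / fact i / w ^ (k - i)) \<le> (\<Sum>i<k. norm (lam i k / fact i))"
      using w1 by (rule norm_principal_part_le)
    moreover have "norm (E w) \<le> norm (zeta (1 + w) ^ k) + norm (\<Sum>i<k. lam i k / fact i / w ^ (k - i)) + norm (quot_coef k (k - 1))"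
      unfolding E(2)[OF w0] by (intro order_trans[OF norm_triangle_ineq4] add_mono norm_triangle_ineq4 order_refl)
    ultimately show ?thesis by (simp add: A_def norm_power)
  qed
  have e: "0 < 1 / (4 * real k)" using k by simp
  obtain C1 where C1: "0 \<le> C1" "\<And>s. 1/2 \<le> Re s \<Longrightarrow> 2 \<le> \<bar>Im s\<bar> \<Longrightarrow> norm (zeta s) \<le> C1 * \<bar>Im s\<bar> powr (1 / (4 * real k))"
    using lindelof_strip[OF LH e] by blast
  obtain C2 where C2: "0 < C2" "\<And>s. 2 \<le> Re s \<Longrightarrow> norm (zeta s) \<le> C2"
    using norm_zeta_le_const by blast
  \<comment> \<open>A compact set around the pole, on which the entire function \<open>E\<close> is
    bounded by continuity. Elsewhere in the half-plane, \<open>\<bar>Im w\<bar> \<ge> 2\<close> or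
    \<open>Re w \<ge> 2\<close>, and the estimates for \<open>zeta\<close> apply.\<close>
  define R where "R = cbox (Complex (- 1/2) (- 2)) (Complex 2 2)"
  have "compact (E ` R)" unfolding R_def
    using E(1) by (intro compact_continuous_image holomorphic_on_imp_continuous_on) (auto intro: holomorphic_on_subset)
  then obtain B where B: "\<And>w. w \<in> R \<Longrightarrow> norm (E w) \<le> B"
    by (metis bounded_iff compact_imp_bounded imageI)
  have "0 \<in> R" by (auto simp: R_def in_cbox_complex_iff)
  from B[OF this] have B0: "0 \<le> B" using norm_ge_zero order_trans by blast
  define C where "C = C1 ^ k + C2 ^ k + A + 2 * B"
  have bound: "norm (E w) \<le> C * norm (1 + w) powr (1/4)" if w: "- 1/2 \<le> Re w" for w
  proof -
    have one: "1 \<le> norm (1 + w) powr (1/4)" if "1 \<le> norm (1 + w)" using that by (intro ge_one_powr_ge_zero) auto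
    consider "2 \<le> \<bar>Im w\<bar>" | "2 \<le> Re w" | "w \<in> R" using w by (force simp: R_def in_cbox_complex_iff)
    thus ?thesis
    proof cases
      case 1
      have n: "\<bar>Im w\<bar> \<le> norm (1 + w)" "\<bar>Im w\<bar> \<le> norm w" using abs_Im_le_cmod[of "1 + w"] abs_Im_le_cmod[of w] by auto
      have "norm (zeta (1 + w)) ^ k \<le> (C1 * \<bar>Im w\<bar> powr (1 / (4 * real k))) ^ k"
        using C1(2)[of "1 + w"] 1 w by (intro power_mono) auto
      also have "\<dots> = C1 ^ k * \<bar>Im w\<bar> powr (1/4)"
        using 1 k by (simp add: power_mult_distrib powr_power)
      also have "\<dots> \<le> C1 ^ k * norm (1 + w) powr (1/4)"
        using n C1(1) by (intro mult_left_mono powr_mono2) auto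
      finally have "norm (E w) \<le> C1 ^ k * norm (1 + w) powr (1/4) + A * 1" using EA[of w] n 1 by simp
      also have "\<dots> \<le> C1 ^ k * norm (1 + w) powr (1/4) + A * norm (1 + w) powr (1/4)"
        using one n 1 A0 by (intro add_left_mono mult_left_mono) auto
      also have "\<dots> = (C1 ^ k + A) * norm (1 + w) powr (1/4)" by (simp add: distrib_right)
      also have "\<dots> \<le> C * norm (1 + w) powr (1/4)"
        using B0 C2(1) by (intro mult_right_mono) (auto simp: C_def)
      finally show ?thesis .
    next
      case 2
      have n: "1 \<le> norm (1 + w)" "1 \<le> norm w" using 2 abs_Re_le_cmod[of "1 + w"] abs_Re_le_cmod[of w] by auto
      have "norm (zeta (1 + w)) ^ k \<le> C2 ^ k" using C2(2)[of "1 + w"] 2 by (intro power_mono) auto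
      hence "norm (E w) \<le> (C2 ^ k + A) * 1" using EA[of w] n by simp
      also have "\<dots> \<le> C * norm (1 + w) powr (1/4)"
        using one n A0 B0 C1(1) C2(1) by (intro mult_mono) (auto simp: C_def)
      finally show ?thesis .
    next
      case 3
      have "1/2 \<le> norm (1 + w)" using w abs_Re_le_cmod[of "1 + w"] by auto
      hence "(1/2) powr (1/4) \<le> norm (1 + w) powr (1/4)" by (intro powr_mono2) auto
      moreover have "(1/2) powr 1 \<le> (1/2 :: real) powr (1/4)" by (intro powr_mono') auto
      \<comment> \<open>On \<open>R\<close> the comparison function may fall below 1 but not below
        1/2, which accounts for the term \<open>2 * B\<close> in \<open>C\<close>.\<close>
      ultimately have "1 \<le> 2 * norm (1 + w) powr (1/4)" by simp
      hence "B * 1 \<le> B * (2 * norm (1 + w) powr (1/4))" using B0 by (intro mult_left_mono)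
      hence "norm (E w) \<le> (2 * B) * norm (1 + w) powr (1/4)" using B[OF 3] by (simp add: mult_ac)
      also have "\<dots> \<le> C * norm (1 + w) powr (1/4)"
        using A0 C1(1) C2(1) by (intro mult_right_mono) (auto simp: C_def)
      finally show ?thesis .
    qed
  qed
  show ?thesis
  proof (rule taylor_coefs_square_summable[OF E(3)])
    fix z :: complex assume z: "norm z < 1"
    have z1: "1 - z \<noteq> 0" using z by auto
    have s: "1 + z / (1 - z) = 1 / (1 - z)" using z1 by (simp add: field_simps)
    have "1/2 \<le> Re (1 / (1 - z))"
    proof -
      have "(norm (1 - z))\<^sup>2 = 1 - 2 * Re z + (norm z)\<^sup>2"
        by (simp add: cmod_power2) (simp add: power2_eq_square algebra_simps)
      also have "\<dots> \<le> 2 * (1 - Re z)" using z by (simp add: power2_eq_square mult_le_one)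
      finally have le: "(norm (1 - z))\<^sup>2 \<le> 2 * (1 - Re z)" .
      have "Re (1 / (1 - z)) = (1 - Re z) / (norm (1 - z))\<^sup>2"
        by (simp add: Re_divide cmod_power2)
      moreover have "0 < (norm (1 - z))\<^sup>2" using z1 by simp
      ultimately show ?thesis using le by (simp only: pos_le_divide_eq) simp
    qed
    hence "- 1/2 \<le> Re (z / (1 - z))" using arg_cong[OF s, of Re] by simp
    from bound[OF this] have "norm (E (z / (1 - z))) \<le> C * norm (1 / (1 - z)) powr (1/4)" by (simp only: s)
    also have "norm (1 / (1 - z)) powr (1/4) = norm (1 - z) powr (- 1/4)"
      using powr_minus_divide[of "norm (1 - z)" "1/4"] by (simp add: norm_divide powr_divide)
    finally show "norm (E (z / (1 - z))) \<le> C * norm (1 - z) powr (- 1/4)" .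
  qed
qed

theorem theorem4:
  shows "lindelof_hypothesis \<longleftrightarrow>
    (\<forall>k::nat. k \<ge> 1 \<longrightarrow>
       ((\<lambda>N. \<integral>\<^sup>+ x\<in>{0..}. ennreal ((cmod (phi_N N k x - phi k x))\<^sup>2) \<partial>lborel) \<longlonglongrightarrow> 0))"
proof
  assume "lindelof_hypothesis"
  thus "\<forall>k::nat. k \<ge> 1 \<longrightarrow>
       ((\<lambda>N. \<integral>\<^sup>+ x\<in>{0..}. ennreal ((cmod (phi_N N k x - phi k x))\<^sup>2) \<partial>lborel) \<longlonglongrightarrow> 0)"
    using L2_convergence_if_square_summable lag_coef_square_summable by blast
next
  assume "\<forall>k::nat. k \<ge> 1 \<longrightarrow>
       ((\<lambda>N. \<integral>\<^sup>+ x\<in>{0..}. ennreal ((cmod (phi_N N k x - phi k x))\<^sup>2) \<partial>lborel) \<longlonglongrightarrow> 0)"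
  thus "lindelof_hypothesis" by (intro lindelof_if_L2_convergence) blast
qed

end
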